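(* Let $G=(V,E)$ be an $n$-vertex, $m$-edge graph with $n$ sufficiently large and $m\ge n\log^{10}n$, $b\in\mathbb{R}^V_{\ge0}$, $r\in\mathbb{R}^E_{\ge0}$, and let $\tilde x=OneRoundMPC(G,b,r)$. Then $\tilde x$ is a feasible solution of the LP $\max\sum_e x_e$ s.t. $\sum_{e\in E(v)}x_e\le b_v$ ($v\in V$), $x_e\le r_e$ ($e\in E$), $x\ge0$, and $\mathbb{E}\big[|E^{loose}(\tilde x,0.05)|/n\big]\le (m/n)^{0.9999}$. Moreover, $\tilde x$ can be computed in $O(1)$ MPC rounds with local memory $\tilde O(n)$ and global memory $O(m)$.
   Context: $E(v)$ is the set of edges incident to $v$, $\bar d=2m/n$. $V^{loose}(x,\alpha)=\{v:\sum_{e\in E(v)}x_e<\alpha b_v\}$, $E^{loose}(x,\alpha)=\{e=\{u,v\}:x_e<\alpha r_e,\ u,v\in V^{loose}(x,\alpha)\}$. $OneRoundMPC(G,b,r)$: $N=\lceil\sqrt{\bar d}\rceil$, $T=\lfloor\log_2(N)/1000\rfloor$; independent thresholds $\mathcal{T}_{v,t}\sim\mathcal{U}[0.2b_v,0.4b_v]$; $q_v=0.8b_v/\max(|E(v)|,\bar d)$; $\tilde x_{e,0}=\min(r_e,q_u,q_v)$ for $e=\{u,v\}$; each $v$ independently picks $i_v$ uniformly in $\{1,\dots,N\}$, $E^{local}(v)=\{\{u,v\}\in E: i_u=i_v\}$; $\tilde V_0^{active}=V$; for $t=1,\dots,T$: $\tilde y_{v,t-1}=N\sum_{e\in E^{local}(v)}\tilde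 x_{e,t-1}$, $\tilde V_t^{active}=\{v\in\tilde V_{t-1}^{active}:\tilde y_{v,t-1}\le\mathcal{T}_{v,t}\}$, $\tilde E_t^{active}=\{e=\{u,v\}:u,v\in\tilde V_t^{active},\ \tilde x_{e,t-1}\le r_e/2\}$, $\tilde x_{e,t}=2\tilde x_{e,t-1}$ if $e\in\tilde E_t^{active}$ else $\tilde x_{e,t-1}$; output $\tilde x_e=\tilde x_{e,T}$ if both endpoints $u$ of $e$ satisfy $\sum_{f\in E(u)}\tilde x_{f,T}\le b_u$, and $\tilde x_e=0$ otherwise. MPC model: machines with bounded local memory communicating in synchronous all-to-all rounds. *)

theory Defs
  imports "HOL-Probability.Probability"
begin

section \<open>Graphs, the linear program and loose edges\<close>

definition simple_graph :: "nat set \<Rightarrow> nat set set \<Rightarrow> bool" where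
  "simple_graph V E \<longleftrightarrow> finite V \<and> (\<forall>e\<in>E. e \<subseteq> V \<and> card e = 2)"

definition incident :: "nat set set \<Rightarrow> nat \<Rightarrow> nat set set" where
  "incident E v = {e \<in> E. v \<in> e}"

definition avg_degree :: "nat set \<Rightarrow> nat set set \<Rightarrow> real" where
  "avg_degree V E = 2 * real (card E) / real (card V)"

definition lp_feasible ::
  "nat set \<Rightarrow> nat set set \<Rightarrow> (nat \<Rightarrow> real) \<Rightarrow> (nat set \<Rightarrow> real) \<Rightarrow> (nat set \<Rightarrow> real) \<Rightarrow> bool" where
  "lp_feasible V E b r x \<longleftrightarrow>
     (\<forall>v\<in>V. (\<Sum>e\<in>incident E v. x e) \<le> b v) \<and> (\<forall>e\<in>E. x e \<le> r e) \<and> (\<forall>e\<in>E. 0 \<le> x e)"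

definition V_loose ::
  "nat set \<Rightarrow> nat set set \<Rightarrow> (nat \<Rightarrow> real) \<Rightarrow> (nat set \<Rightarrow> real) \<Rightarrow> real \<Rightarrow> nat set" where
  "V_loose V E b x \<alpha> = {v \<in> V. (\<Sum>e\<in>incident E v. x e) < \<alpha> * b v}"

definition E_loose ::
  "nat set \<Rightarrow> nat set set \<Rightarrow> (nat \<Rightarrow> real) \<Rightarrow> (nat set \<Rightarrow> real) \<Rightarrow> (nat set \<Rightarrow> real) \<Rightarrow> real \<Rightarrow> nat set set" where
  "E_loose V E b r x \<alpha> = {e \<in> E. x e < \<alpha> * r e \<and> e \<subseteq> V_loose V E b x \<alpha>}"


section \<open>The algorithm OneRoundMPC\<close>

definition num_parts :: "nat set \<Rightarrow> nat set set \<Rightarrow> nat" where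
  "num_parts V E = nat \<lceil>sqrt (avg_degree V E)\<rceil>"

definition num_iters :: "nat set \<Rightarrow> nat set set \<Rightarrow> nat" where
  "num_iters V E = nat \<lfloor>log 2 (real (num_parts V E)) / 1000\<rfloor>"

text \<open>
  An outcome of the random choices is a pair \<open>(i, \<theta>)\<close>: \<open>i v\<close> is the part picked by \<open>v\<close>, and
  \<open>\<theta> (v, t)\<close> is the threshold of \<open>v\<close> in iteration \<open>t\<close>.
\<close>

type_synonym outcome = "(nat \<Rightarrow> nat) \<times> (nat \<times> nat \<Rightarrow> real)"

definition q_val :: "nat set \<Rightarrow> nat set set \<Rightarrow> (nat \<Rightarrow> real) \<Rightarrow> nat \<Rightarrow> real" where
  "q_val V E b v = 0.8 * b v / max (real (card (incident E v))) (avg_degree V E)"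

definition x_init ::
  "nat set \<Rightarrow> nat set set \<Rightarrow> (nat \<Rightarrow> real) \<Rightarrow> (nat set \<Rightarrow> real) \<Rightarrow> nat set \<Rightarrow> real" where
  "x_init V E b r e = min (r e) (Min (q_val V E b ` e))"

definition E_local :: "nat set set \<Rightarrow> (nat \<Rightarrow> nat) \<Rightarrow> nat \<Rightarrow> nat set set" where
  "E_local E i v = {e \<in> incident E v. \<forall>u\<in>e. i u = i v}"

definition y_est ::
  "nat set \<Rightarrow> nat set set \<Rightarrow> (nat \<Rightarrow> nat) \<Rightarrow> (nat set \<Rightarrow> real) \<Rightarrow> nat \<Rightarrow> real" where
  "y_est V E i x v = real (num_parts V E) * (\<Sum>e\<in>E_local E i v. x e)"

text \<open>The state after iteration \<open>t\<close> consists of the active vertices and the edge values.\<close>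

primrec one_round_state ::
  "nat set \<Rightarrow> nat set set \<Rightarrow> (nat \<Rightarrow> real) \<Rightarrow> (nat set \<Rightarrow> real) \<Rightarrow> outcome \<Rightarrow> nat
    \<Rightarrow> nat set \<times> (nat set \<Rightarrow> real)" where
  "one_round_state V E b r \<omega> 0 = (V, x_init V E b r)"
| "one_round_state V E b r \<omega> (Suc t) =
     (let (A, x) = one_round_state V E b r \<omega> t;
          A' = {v \<in> A. y_est V E (fst \<omega>) x v \<le> snd \<omega> (v, Suc t)};
          F = {e \<in> E. e \<subseteq> A' \<and> x e \<le> r e / 2}
      in (A', \<lambda>e. if e \<in> F then 2 * x e else x e))"

definition one_round_mpc ::
  "nat set \<Rightarrow> nat set set \<Rightarrow> (nat \<Rightarrow> real) \<Rightarrow> (nat set \<Rightarrow> real) \<Rightarrow> outcome \<Rightarrow> nat set \<Rightarrow> real" where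
  "one_round_mpc V E b r \<omega> =
     (let x = snd (one_round_state V E b r \<omega> (num_iters V E))
      in (\<lambda>e. if (\<forall>u\<in>e. (\<Sum>f\<in>incident E u. x f) \<le> b u) then x e else 0))"

text \<open>
  The uniform distribution on \<open>[lo, hi]\<close>; a degenerate interval (here: \<open>b v = 0\<close>) gives a point
  mass, whereas \<^const>\<open>uniform_measure\<close> would give the null measure.
\<close>

definition uniform_dist :: "real \<Rightarrow> real \<Rightarrow> real measure" where
  "uniform_dist lo hi = (if lo < hi then uniform_measure lborel {lo..hi} else return borel lo)"

definition one_round_space ::
  "nat set \<Rightarrow> nat set set \<Rightarrow> (nat \<Rightarrow> real) \<Rightarrow> outcome measure" where
  "one_round_space V E b =
     (\<Pi>\<^sub>M v\<in>V. measure_pmf (pmf_of_set {1..num_parts V E})) \<Otimes>\<^sub>M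
     (\<Pi>\<^sub>M p\<in>V \<times> {1..num_iters V E}. uniform_dist (0.2 * b (fst p)) (0.4 * b (fst p)))"


section \<open>The MPC model\<close>

text \<open>
  A memory word holds a natural number (required below to be polynomial in \<open>n\<close>, that is, to have
  \<open>O(log n)\<close> bits) or a real number; exact reals are needed because the inputs \<open>b\<close>, \<open>r\<close> and the
  thresholds are reals. Local computation is unbounded, as usual in MPC, but it may access reals
  only through field operations and comparisons: if arbitrary functions on the reals were allowed,
  the whole input could be packed into a single word and the memory bounds would be void.
  Accordingly a local computation is, for every assignment of the natural number words, a finite
  algebraic decision tree over the real words.
\<close>

datatype word = IntW nat | RealW real

datatype aexp = Reg nat | Const rat | Add aexp aexp | Sub aexp aexp | Mul aexp aexp | Div aexp aexp

datatype out_word = OutInt nat | OutReal aexp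

text \<open>\<open>Emit f\<close> sends the words \<open>f j\<close> to machine \<open>j\<close>.\<close>

datatype prog = Emit "nat \<Rightarrow> out_word list" | IfLe aexp aexp prog prog

primrec aval :: "(nat \<Rightarrow> real) \<Rightarrow> aexp \<Rightarrow> real" where
  "aval s (Reg k) = s k"
| "aval s (Const c) = of_rat c"
| "aval s (Add a a') = aval s a + aval s a'"
| "aval s (Sub a a') = aval s a - aval s a'"
| "aval s (Mul a a') = aval s a * aval s a'"
| "aval s (Div a a') = aval s a / aval s a'"

primrec out_val :: "(nat \<Rightarrow> real) \<Rightarrow> out_word \<Rightarrow> word" where
  "out_val s (OutInt k) = IntW k"
| "out_val s (OutReal a) = RealW (aval s a)"

primrec exec :: "(nat \<Rightarrow> real) \<Rightarrow> prog \<Rightarrow> nat \<Rightarrow> word list" where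
  "exec s (Emit f) j = map (out_val s) (f j)"
| "exec s (IfLe a a' P Q) j = (if aval s a \<le> aval s a' then exec s P j else exec s Q j)"

text \<open>
  The discrete part of a memory content, with \<open>None\<close> at the positions of the reals, and the
  assignment of values to registers.
\<close>

definition shape :: "word list \<Rightarrow> nat option list" where
  "shape ws = map (\<lambda>w. case w of IntW k \<Rightarrow> Some k | RealW _ \<Rightarrow> None) ws"

definition registers :: "word list \<Rightarrow> nat \<Rightarrow> real" where
  "registers ws k =
     (if k < length ws then (case ws ! k of IntW j \<Rightarrow> real j | RealW x \<Rightarrow> x) else 0)"

text \<open>
  In round \<open>t\<close>, machine \<open>i\<close> draws \<open>mpc_fresh t i\<close> private random reals, uniform in \<open>[0, 1]\<close>, and
  runs \<open>mpc_step t i\<close> on its memory. What a machine keeps for the next round is what it sends to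
  itself, so a random word can be reused only if it is stored.
\<close>

record mpc =
  mpc_machines :: nat
  mpc_rounds :: nat
  mpc_fresh :: "nat \<Rightarrow> nat \<Rightarrow> nat"
  mpc_step :: "nat \<Rightarrow> nat \<Rightarrow> nat option list \<Rightarrow> prog"

text \<open>\<open>\<rho> (t, i, k)\<close> is the \<open>k\<close>-th random word of machine \<open>i\<close> in round \<open>t\<close>.\<close>

type_synonym tape = "nat \<times> nat \<times> nat \<Rightarrow> real"

definition tape_space :: "tape measure" where
  "tape_space = (\<Pi>\<^sub>M p\<in>UNIV. uniform_dist 0 1)"

definition mpc_work :: "mpc \<Rightarrow> tape \<Rightarrow> nat \<Rightarrow> (nat \<Rightarrow> word list) \<Rightarrow> nat \<Rightarrow> word list" where
  "mpc_work P \<rho> t mem i = mem i @ map (\<lambda>k. RealW (\<rho> (t, i, k))) [0..<mpc_fresh P t i]"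

definition mpc_sent :: "mpc \<Rightarrow> tape \<Rightarrow> nat \<Rightarrow> (nat \<Rightarrow> word list) \<Rightarrow> nat \<Rightarrow> nat \<Rightarrow> word list" where
  "mpc_sent P \<rho> t mem i j =
     (let ws = mpc_work P \<rho> t mem i in exec (registers ws) (mpc_step P t i (shape ws)) j)"

primrec mpc_mem :: "mpc \<Rightarrow> (nat \<Rightarrow> word list) \<Rightarrow> tape \<Rightarrow> nat \<Rightarrow> nat \<Rightarrow> word list" where
  "mpc_mem P input \<rho> 0 = input"
| "mpc_mem P input \<rho> (Suc t) =
     (\<lambda>j. concat (map (\<lambda>i. mpc_sent P \<rho> t (mpc_mem P input \<rho> t) i j) [0..<mpc_machines P]))"

definition mpc_respects_memory ::
  "mpc \<Rightarrow> nat \<Rightarrow> nat \<Rightarrow> (nat \<Rightarrow> word list) \<Rightarrow> tape \<Rightarrow> bool" where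
  "mpc_respects_memory P S B input \<rho> \<longleftrightarrow>
     (\<forall>t\<le>mpc_rounds P. \<forall>j<mpc_machines P.
        length (mpc_mem P input \<rho> t j) \<le> S \<and>
        (\<forall>k. IntW k \<in> set (mpc_mem P input \<rho> t j) \<longrightarrow> k \<le> B)) \<and>
     (\<forall>t<mpc_rounds P. \<forall>i<mpc_machines P.
        length (mpc_work P \<rho> t (mpc_mem P input \<rho> t) i) \<le> S \<and>
        (\<Sum>j<mpc_machines P. length (mpc_sent P \<rho> t (mpc_mem P input \<rho> t) i j)) \<le> S)"

text \<open>
  The input consists of a record for every vertex and every edge, spread over the machines.
  Vertices are named by \<open>lab\<close>, a bijection onto \<open>{..<n}\<close>.
\<close>

definition vertex_record :: "(nat \<Rightarrow> nat) \<Rightarrow> (nat \<Rightarrow> real) \<Rightarrow> nat \<Rightarrow> word list" where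
  "vertex_record lab b v = [IntW (lab v), RealW (b v)]"

definition edge_record :: "(nat \<Rightarrow> nat) \<Rightarrow> (nat set \<Rightarrow> real) \<Rightarrow> nat set \<Rightarrow> word list" where
  "edge_record lab x e = [IntW (Min (lab ` e)), IntW (Max (lab ` e)), RealW (x e)]"

definition distributes :: "nat \<Rightarrow> (nat \<Rightarrow> 'r list) \<Rightarrow> 'r set \<Rightarrow> bool" where
  "distributes k place X \<longleftrightarrow>
     distinct (concat (map place [0..<k])) \<and> set (concat (map place [0..<k])) = X"

definition mpc_input ::
  "(nat \<Rightarrow> nat) \<Rightarrow> (nat \<Rightarrow> real) \<Rightarrow> (nat set \<Rightarrow> real) \<Rightarrow> (nat \<Rightarrow> (nat + nat set) list)
    \<Rightarrow> nat \<Rightarrow> word list" where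
  "mpc_input lab b r place j =
     concat (map (case_sum (vertex_record lab b) (edge_record lab r)) (place j))"

definition mpc_outputs ::
  "mpc \<Rightarrow> (nat \<Rightarrow> nat) \<Rightarrow> nat set set \<Rightarrow> (nat \<Rightarrow> word list) \<Rightarrow> tape \<Rightarrow> (nat set \<Rightarrow> real) \<Rightarrow> bool" where
  "mpc_outputs P lab E input \<rho> x \<longleftrightarrow>
     (\<exists>out. distributes (mpc_machines P) out E \<and>
        (\<forall>j<mpc_machines P.
           mpc_mem P input \<rho> (mpc_rounds P) j = concat (map (edge_record lab x) (out j))))"

text \<open>
  \<open>P\<close> computes the random vector of OneRoundMPC with probability at least \<open>p\<close>, for every initial
  distribution of the input that fits into the local memories: the random words of the machines are
  mapped by some \<open>\<phi>\<close> to random choices of OneRoundMPC with the correct joint law, and on an event of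
  probability at least \<open>p\<close> the memory bounds are respected and the output is the one
  determined by these choices.
\<close>

definition mpc_computes_one_round ::
  "mpc \<Rightarrow> nat \<Rightarrow> nat \<Rightarrow> real \<Rightarrow> nat set \<Rightarrow> nat set set \<Rightarrow> (nat \<Rightarrow> real) \<Rightarrow> (nat set \<Rightarrow> real) \<Rightarrow> bool"
where
  "mpc_computes_one_round P S B p V E b r \<longleftrightarrow>
     (\<forall>lab place. bij_betw lab V {..<card V} \<longrightarrow>
        distributes (mpc_machines P) place (V <+> E) \<longrightarrow>
        (\<forall>j<mpc_machines P. length (mpc_input lab b r place j) \<le> S) \<longrightarrow>
        (\<exists>\<phi> good.
           \<phi> \<in> measurable tape_space (one_round_space V E b) \<and>
           distr tape_space (one_round_space V E b) \<phi> = one_round_space V E b \<and>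
           good \<in> sets tape_space \<and> p \<le> measure tape_space good \<and>
           (\<forall>\<rho>\<in>good.
              mpc_respects_memory P S B (mpc_input lab b r place) \<rho> \<and>
              mpc_outputs P lab E (mpc_input lab b r place) \<rho> (one_round_mpc V E b r (\<phi> \<rho>)))))"

end

theory Submission
  imports Defs "HOL-Real_Asymp.Real_Asymp"
begin

text \<open>
  Loose edges. The algorithm is compared with an ideal process that uses the same thresholds but
  the exact loads \<open>y v = (\<Sum>e\<ni>v. x e)\<close>, so that it does not depend on the partition. Call a vertex
  near in iteration \<open>t\<close> if its threshold is within \<open>\<epsilon> 128\<^sup>t\<^sup>-\<^sup>1 b v\<close> of its ideal load, and clean if it is
  never near. Nearness depends on the thresholds only, and given the past, different vertices are
  near independently, each with probability at most \<open>10 \<epsilon> 128\<^sup>t\<^sup>-\<^sup>1\<close>. Hence, by Chernoff bounds, with high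
  probability every vertex has little weight on near neighbours, and every local estimate of an
  ideal load is accurate. On this event, clean vertices behave in the algorithm exactly as in the
  ideal process: an edge \<open>{u, w}\<close> with \<open>w\<close> first near in iteration \<open>s\<close> deviates by at most
  \<open>2\<^sup>t\<^sup>-\<^sup>s\<^sup>+\<^sup>1\<close> times its weight before \<open>s\<close>, so the error of an estimate grows by a constant factor per
  iteration. A loose edge with clean endpoints was then doubled in all \<open>T\<close> iterations, and
  since an active vertex has load at most \<open>0.4 b\<close> there are at most \<open>m / 2\<^sup>T\<close> such edges; the others
  have an unclean endpoint and are few in expectation.

  MPC. The edges stay where they are. Data of a vertex are summed up by the machine that owns it,
  which broadcasts the result, so every machine knows the degrees, capacities and
  random numbers of all vertices. Each machine sends its edges inside part \<open>p\<close> to machine \<open>p\<close>, which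
  simulates all iterations for the vertices of its part. The iterations in which a vertex is active
  determine the values of its edges, and one more summation yields the final loads.
  With high probability a part has only \<open>O(n log\<^sup>2 n)\<close> edges. Programs are not written down:
  a step is a function of the memory that is shown to be computed by some algebraic decision tree.
\<close>

section \<open>Concentration of sums of independent bits\<close>

text \<open>The values and the estimates use the same partition, so after one iteration an estimate
  is no sum of independent terms. The ideal process restores independence, but a threshold test can
  turn a tiny error into a wrong decision. Possible wrong decisions are charged to nearness, an
  event of the ideal process alone. The bookkeeping of errors fixes the constants: the tolerated
  error grows by 128 = 2^7 per iteration, hence \<open>128 ^ T\<close> <= N^0.007 as T is at most a
  thousandth of log N, and \<epsilon> = N^(-0.1) still beats it. A vertex of capacity 0 has a point
  mass as threshold and may always be near; but its edges have value 0 and are not loose, so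
  nearness needs a probability bound only for positive capacities. The density assumption enters
  twice: it makes n at most exp (N^0.2), so that union bounds over vertices are affordable, and it
  makes the number of machines exceed the number of parts, so that every part can have a machine of
  its own.\<close>

text \<open>For x < 0 and y = -x the product (1 - y + y^2)(1 + y + y^2/2) equals 1 + y^2/2 + y^3/2 +
  y^4/2, which is at least 1; so 1 - y + y^2 is at least 1 / exp y. Negative x occurs in the lower
  tail.\<close>

lemma exp_le_quadratic:
  fixes x :: real
  assumes "\<bar>x\<bar> \<le> 1"
  shows "exp x \<le> 1 + x + x\<^sup>2"
proof (cases "0 \<le> x")
  case True
  with assms show ?thesis by (intro exp_bound) auto
next
  case False
  define y where "y = - x"
  have y: "0 < y" using False by (simp add: y_def)
  have 1: "1 + y + y\<^sup>2 / 2 \<le> exp y"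
    using exp_lower_Taylor_quadratic[of y] y by simp
  have "1 \<le> (1 - y + y\<^sup>2) * (1 + y + y\<^sup>2 / 2)"
  proof -
    have "(1 - y + y\<^sup>2) * (1 + y + y\<^sup>2 / 2) = 1 + y^2/2 + y^3/2 + y^4/2"
      by (simp add: field_simps power2_eq_square power3_eq_cube power4_eq_xxxx)
    then show ?thesis using y by simp
  qed
  also have "\<dots> \<le> (1 - y + y\<^sup>2) * exp y"
  proof (rule mult_left_mono[OF 1])
    have "0 \<le> (1 - y)\<^sup>2 + y" using y by (intro add_nonneg_nonneg) auto
    then show "0 \<le> 1 - y + y\<^sup>2" by (simp add: power2_eq_square algebra_simps)
  qed
  finally have "exp (- y) \<le> 1 - y + y\<^sup>2"
    by (simp add: exp_minus field_simps)
  then show ?thesis by (simp add: y_def)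
qed

lemma (in prob_space) exponential_markov:
  assumes [measurable]: "f \<in> borel_measurable M"
    and mgf: "(\<integral>\<^sup>+x. ennreal (exp (f x)) \<partial>M) \<le> ennreal (exp K)"
  shows "prob {x \<in> space M. K + L < f x} \<le> exp (- L)"
proof -
  let ?A = "{x \<in> space M. K + L < f x}"
  have "emeasure M ?A = (\<integral>\<^sup>+x. indicator ?A x \<partial>M)"
    by simp
  also have "\<dots> \<le> (\<integral>\<^sup>+x. ennreal (exp (- (K + L))) * ennreal (exp (f x)) \<partial>M)"
    by (intro nn_integral_mono)
       (auto simp: indicator_def ennreal_mult'[symmetric] exp_add[symmetric] simp flip: ennreal_1
             intro!: ennreal_leI)
  also have "\<dots> = ennreal (exp (- (K + L))) * (\<integral>\<^sup>+x. ennreal (exp (f x)) \<partial>M)"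
    by (intro nn_integral_cmult) measurable
  also have "\<dots> \<le> ennreal (exp (- (K + L))) * ennreal (exp K)"
    by (intro mult_left_mono mgf) auto
  also have "\<dots> = ennreal (exp (- L))"
    by (simp add: ennreal_mult'[symmetric] exp_add[symmetric])
  finally show ?thesis
    by (simp add: emeasure_eq_measure)
qed

text \<open>Independence of the coordinates factors the exponential moment; a single bit contributes
  1 + (e^c - 1) p. The bounds \<open>k i\<close> are left open because the two tail estimates bound
  this factor in different ways.\<close>

lemma (in product_prob_space) mgf_weighted_bits:
  assumes I: "finite I" and B: "\<And>i. i \<in> I \<Longrightarrow> B i \<in> sets (M i)"
    and bound: "\<And>i. i \<in> I \<Longrightarrow> 1 + (exp (c i) - 1) * measure (M i) (B i) \<le> exp (k i)"
  shows "(\<integral>\<^sup>+x. ennreal (exp (\<Sum>i\<in>I. c i * indicator (B i) (x i))) \<partial>PiM I M)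
    \<le> ennreal (exp (\<Sum>i\<in>I. k i))"
proof -
  have "(\<integral>\<^sup>+x. ennreal (exp (\<Sum>i\<in>I. c i * indicator (B i) (x i))) \<partial>PiM I M)
      = (\<integral>\<^sup>+x. (\<Prod>i\<in>I. ennreal (exp (c i * indicator (B i) (x i)))) \<partial>PiM I M)"
    by (simp add: exp_sum[OF I] prod_ennreal)
  also have "\<dots> = (\<Prod>i\<in>I. \<integral>\<^sup>+x. ennreal (exp (c i * indicator (B i) x)) \<partial>M i)"
    using B by (intro product_nn_integral_prod I) (auto intro!: measurable_compose[OF _ measurable_ennreal])
  also have "\<dots> \<le> (\<Prod>i\<in>I. ennreal (exp (k i)))"
  proof (intro prod_mono_ennreal)
    fix i assume i: "i \<in> I"
    note [measurable] = B[OF i]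
    have "(\<integral>\<^sup>+x. ennreal (exp (c i * indicator (B i) x)) \<partial>M i)
        = (\<integral>\<^sup>+x. ennreal (exp (c i)) * indicator (B i) x + indicator (space (M i) - B i) x \<partial>M i)"
      by (intro nn_integral_cong) (auto simp: indicator_def)
    also have "\<dots> = ennreal (exp (c i)) * emeasure (M i) (B i) + emeasure (M i) (space (M i) - B i)"
      by (subst nn_integral_add) (auto simp: nn_integral_cmult)
    also have "\<dots> = ennreal (exp (c i) * measure (M i) (B i) + (1 - measure (M i) (B i)))"
      using M.prob_compl[OF B[OF i]]
      by (subst ennreal_plus) (auto simp: M.emeasure_eq_measure ennreal_mult')
    also have "\<dots> \<le> ennreal (exp (k i))"
      using bound[OF i] by (intro ennreal_leI) (simp add: algebra_simps)
    finally show "(\<integral>\<^sup>+x. ennreal (exp (c i * indicator (B i) x)) \<partial>M i) \<le> ennreal (exp (k i))" .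
  qed
  also have "\<dots> = ennreal (exp (\<Sum>i\<in>I. k i))"
    by (simp add: exp_sum[OF I] prod_ennreal)
  finally show ?thesis .
qed

text \<open>Chernoff bound without the exact mean: e^c - 1 <= 2c for weights in [0, 1], so the log
  moment is at most 2p times the total weight, and the threshold exceeds this by at least L. The
  bound \<open>p\<close> is asked for positive weights only, because vertices of capacity 0 can be
  near with probability 1 but carry weight 0.\<close>

lemma (in product_prob_space) upper_tail_weighted_bits:
  assumes I: "finite I" and B: "\<And>i. i \<in> I \<Longrightarrow> B i \<in> sets (M i)"
    and c: "\<And>i. i \<in> I \<Longrightarrow> 0 \<le> c i" "\<And>i. i \<in> I \<Longrightarrow> c i \<le> 1"
    and p: "\<And>i. i \<in> I \<Longrightarrow> 0 < c i \<Longrightarrow> measure (M i) (B i) \<le> p" "0 \<le> p"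
  shows "measure (PiM I M) {x \<in> space (PiM I M).
      4 * p * (\<Sum>i\<in>I. c i) + L < (\<Sum>i\<in>I. c i * indicator (B i) (x i))} \<le> exp (- L)"
proof -
  interpret P: prob_space "PiM I M" by (intro prob_space_PiM M.prob_space_axioms)
  have [measurable]: "(\<lambda>x. \<Sum>i\<in>I. c i * indicator (B i) (x i)) \<in> borel_measurable (PiM I M)"
    using B by measurable
  have "1 + (exp (c i) - 1) * measure (M i) (B i) \<le> exp (2 * p * c i)" if i: "i \<in> I" for i
  proof (cases "c i = 0")
    case False
    then have c0: "0 < c i" using c i by (metis less_eq_real_def)
    have "exp (c i) \<le> 1 + c i + (c i)\<^sup>2"
      using c[OF i] by (intro exp_le_quadratic) auto
    also have "(c i)\<^sup>2 \<le> c i"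
      using c[OF i] by (simp add: power2_eq_square mult_left_le)
    finally have "exp (c i) - 1 \<le> 2 * c i" by simp
    then have "(exp (c i) - 1) * measure (M i) (B i) \<le> 2 * c i * p"
      using p(1)[OF i c0] c0 p(2) by (intro mult_mono) auto
    then show ?thesis by (intro order_trans[OF _ exp_ge_add_one_self]) (simp add: mult_ac)
  qed simp
  from mgf_weighted_bits[OF I B this]
  have "P.prob {x \<in> space (PiM I M). (\<Sum>i\<in>I. 2 * p * c i) + (2 * p * (\<Sum>i\<in>I. c i) + L)
      < (\<Sum>i\<in>I. c i * indicator (B i) (x i))} \<le> exp (- (2 * p * (\<Sum>i\<in>I. c i) + L))"
    by (intro P.exponential_markov) auto
  also have "\<dots> \<le> exp (- L)"
    using p(2) c by (simp add: sum_nonneg)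
  also have "(\<Sum>i\<in>I. 2 * p * c i) = 2 * p * (\<Sum>i\<in>I. c i)"
    by (simp add: sum_distrib_left)
  finally show ?thesis
    by (simp add: algebra_simps)
qed

text \<open>Here \<open>l\<close> is the Chernoff parameter and \<open>a\<close> bounds the weights.
  The condition l * a <= 1 permits the quadratic bound on exp, and the third condition makes the
  second-order term at most 1; this term is the 1 in the exponent. The sign s = 1 or s = -1 gives
  the two tails.\<close>

lemma (in product_prob_space) two_sided_tail_weighted_bits:
  assumes I: "finite I" and B: "\<And>i. i \<in> I \<Longrightarrow> B i \<in> sets (M i)"
    and c: "\<And>i. i \<in> I \<Longrightarrow> 0 \<le> c i" "\<And>i. i \<in> I \<Longrightarrow> c i \<le> a"
    and p: "\<And>i. i \<in> I \<Longrightarrow> measure (M i) (B i) = p"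
    and l: "0 < l" "l * a \<le> 1" "l\<^sup>2 * a * p * (\<Sum>i\<in>I. c i) \<le> 1"
  shows "measure (PiM I M) {x \<in> space (PiM I M).
      d < \<bar>(\<Sum>i\<in>I. c i * indicator (B i) (x i)) - p * (\<Sum>i\<in>I. c i)\<bar>} \<le> 2 * exp (1 - l * d)"
proof -
  interpret P: prob_space "PiM I M" by (intro prob_space_PiM M.prob_space_axioms)
  let ?Y = "\<lambda>x. \<Sum>i\<in>I. c i * indicator (B i) (x i)"
  let ?m = "p * (\<Sum>i\<in>I. c i)"
  have [measurable]: "?Y \<in> borel_measurable (PiM I M)"
    using B by measurable
  have *: "P.prob {x \<in> space (PiM I M). l * d < s * l * (?Y x - ?m)} \<le> exp (1 - l * d)"
    if s: "s = 1 \<or> s = -1" for s :: real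
  proof -
    have bound: "1 + (exp (s * l * c i) - 1) * measure (M i) (B i)
        \<le> exp (s * l * p * c i + l\<^sup>2 * a * p * c i)" if i: "i \<in> I" for i
    proof -
      have p0: "0 \<le> p" using p[OF i] by (metis measure_nonneg)
      have "l * c i \<le> 1" using c(2)[OF i] l by (meson less_imp_le mult_left_mono order_trans)
      then have "exp (s * l * c i) \<le> 1 + s * l * c i + (s * l * c i)\<^sup>2"
        using s c(1)[OF i] l(1) by (intro exp_le_quadratic) (auto simp: abs_mult)
      also have "(s * l * c i)\<^sup>2 = l\<^sup>2 * (c i * c i)"
        using s by (auto simp: power2_eq_square)
      also have "\<dots> \<le> l\<^sup>2 * (a * c i)"
        using c[OF i] by (intro mult_left_mono mult_right_mono) auto
      finally have "exp (s * l * c i) - 1 \<le> s * l * c i + l\<^sup>2 * (a * c i)" by simp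
      then have "(exp (s * l * c i) - 1) * p \<le> (s * l * c i + l\<^sup>2 * (a * c i)) * p"
        using p0 by (rule mult_right_mono)
      then show ?thesis
        using p[OF i] by (intro order_trans[OF _ exp_ge_add_one_self]) (simp add: algebra_simps)
    qed
    have mgf: "(\<integral>\<^sup>+x. ennreal (exp (s * l * ?Y x)) \<partial>PiM I M)
        \<le> ennreal (exp (\<Sum>i\<in>I. s * l * p * c i + l\<^sup>2 * a * p * c i))"
      using mgf_weighted_bits[OF I B bound] by (simp add: sum_distrib_left mult.assoc)
    have "(\<Sum>i\<in>I. s * l * p * c i + l\<^sup>2 * a * p * c i)
        = s * l * ?m + l\<^sup>2 * a * p * (\<Sum>i\<in>I. c i)"
      by (simp add: sum.distrib mult.assoc flip: sum_distrib_left)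
    also have "\<dots> \<le> s * l * ?m + 1" using l(3) by simp
    finally have "(\<integral>\<^sup>+x. ennreal (exp (s * l * ?Y x)) \<partial>PiM I M) \<le> ennreal (exp (s * l * ?m + 1))"
      by (intro order_trans[OF mgf] ennreal_leI) simp
    then have "P.prob {x \<in> space (PiM I M). (s * l * ?m + 1) + (l * d - 1) < s * l * ?Y x}
        \<le> exp (- (l * d - 1))"
      by (intro P.exponential_markov) measurable
    then show ?thesis by (simp add: algebra_simps)
  qed
  have "P.prob {x \<in> space (PiM I M). d < \<bar>?Y x - ?m\<bar>}
      \<le> P.prob ({x \<in> space (PiM I M). l * d < 1 * l * (?Y x - ?m)}
          \<union> {x \<in> space (PiM I M). l * d < - 1 * l * (?Y x - ?m)})"
  proof (rule P.finite_measure_mono)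
    show "{x \<in> space (PiM I M). d < \<bar>?Y x - ?m\<bar>} \<subseteq> {x \<in> space (PiM I M). l * d < 1 * l * (?Y x - ?m)}
          \<union> {x \<in> space (PiM I M). l * d < - 1 * l * (?Y x - ?m)}"
    proof safe
      fix x assume h: "d < \<bar>?Y x - ?m\<bar>" "\<not> l * d < - 1 * l * (?Y x - ?m)"
      have "\<not> d < - (?Y x - ?m)"
        using h(2) l(1) by (auto simp: mult_less_cancel_left_pos simp flip: mult_minus_right)
      with h(1) have "d < ?Y x - ?m" by linarith
      then show "l * d < 1 * l * (?Y x - ?m)" using l(1) by simp
    qed
  qed measurable
  also have "\<dots> \<le> P.prob {x \<in> space (PiM I M). l * d < 1 * l * (?Y x - ?m)}
      + P.prob {x \<in> space (PiM I M). l * d < - 1 * l * (?Y x - ?m)}"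
    by (intro measure_Un_le) measurable
  also have "\<dots> \<le> 2 * exp (1 - l * d)"
    using *[of 1] *[of "-1"] by simp
  finally show ?thesis .
qed

section \<open>Bounding probabilities by conditioning on the other coordinates\<close>

lemma prob_pair_le_sections:
  assumes "prob_space M1" "prob_space M2" and A: "A \<in> sets (M1 \<Otimes>\<^sub>M M2)"
    and le: "\<And>x. x \<in> space M1 \<Longrightarrow> measure M2 (Pair x -` A) \<le> p" and p: "0 \<le> p"
  shows "measure (M1 \<Otimes>\<^sub>M M2) A \<le> p"
proof -
  interpret M1: prob_space M1 by fact
  interpret M2: prob_space M2 by fact
  interpret P: pair_prob_space M1 M2 ..
  have "emeasure (M1 \<Otimes>\<^sub>M M2) A = (\<integral>\<^sup>+x. emeasure M2 (Pair x -` A) \<partial>M1)"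
    by (rule M2.emeasure_pair_measure_alt[OF A])
  also have "\<dots> \<le> (\<integral>\<^sup>+x. ennreal p \<partial>M1)"
    by (intro nn_integral_mono) (auto simp: M2.emeasure_eq_measure intro!: ennreal_leI le)
  also have "\<dots> = ennreal p" by (simp add: M1.emeasure_space_1)
  finally show ?thesis using p by (simp add: P.emeasure_eq_measure)
qed

lemma prob_pair_le_sections':
  assumes "prob_space M1" "prob_space M2" and A: "A \<in> sets (M1 \<Otimes>\<^sub>M M2)"
    and le: "\<And>y. y \<in> space M2 \<Longrightarrow> measure M1 ((\<lambda>x. (x, y)) -` A) \<le> p" and p: "0 \<le> p"
  shows "measure (M1 \<Otimes>\<^sub>M M2) A \<le> p"
proof -
  interpret M1: prob_space M1 by fact
  interpret M2: prob_space M2 by fact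
  interpret P: pair_prob_space M1 M2 ..
  have "emeasure (M1 \<Otimes>\<^sub>M M2) A = (\<integral>\<^sup>+y. emeasure M1 ((\<lambda>x. (x, y)) -` A) \<partial>M2)"
    by (rule P.emeasure_pair_measure_alt2[OF A])
  also have "\<dots> \<le> (\<integral>\<^sup>+y. ennreal p \<partial>M2)"
    by (intro nn_integral_mono) (auto simp: M1.emeasure_eq_measure intro!: ennreal_leI le)
  also have "\<dots> = ennreal p" by (simp add: M2.emeasure_space_1)
  finally show ?thesis using p by (simp add: P.emeasure_eq_measure)
qed

text \<open>Fubini in the form needed for adaptive processes: the coordinates in \<open>I\<close>
  are frozen, and only the fresh ones in \<open>J\<close> are random.\<close>

lemma (in product_prob_space) prob_PiM_le_sections:
  assumes "finite I" "finite J" "I \<inter> J = {}" and A: "A \<in> sets (PiM (I \<union> J) M)"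
    and le: "\<And>x. x \<in> space (PiM I M) \<Longrightarrow>
        measure (PiM J M) {y \<in> space (PiM J M). merge I J (x, y) \<in> A} \<le> p" and p: "0 \<le> p"
  shows "measure (PiM (I \<union> J) M) A \<le> p"
proof -
  let ?P = "PiM I M \<Otimes>\<^sub>M PiM J M"
  have "measure (PiM (I \<union> J) M) A = measure (distr ?P (PiM (I \<union> J) M) (merge I J)) A"
    using assms by (simp add: distr_merge)
  also have "\<dots> = measure ?P (merge I J -` A \<inter> space ?P)"
    by (rule measure_distr[OF _ A]) measurable
  also have "\<dots> \<le> p"
  proof (rule prob_pair_le_sections)
    show "merge I J -` A \<inter> space ?P \<in> sets ?P"
      using A by measurable
    show "measure (PiM J M) (Pair x -` (merge I J -` A \<inter> space ?P)) \<le> p"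
      if x: "x \<in> space (PiM I M)" for x
    proof -
      have "Pair x -` (merge I J -` A \<inter> space ?P) = {y \<in> space (PiM J M). merge I J (x, y) \<in> A}"
        using x by (auto simp: space_pair_measure)
      then show ?thesis using le[OF x] by simp
    qed
  qed (auto intro!: prob_space_PiM M.prob_space_axioms p)
  finally show ?thesis .
qed

lemma prob_space_uniform_dist: "prob_space (uniform_dist lo hi)"
  by (auto simp: uniform_dist_def intro!: prob_space_uniform_measure prob_space_return)

lemma sets_uniform_dist [simp, measurable_cong]: "sets (uniform_dist lo hi) = sets borel"
  by (simp add: uniform_dist_def)

lemma space_uniform_dist [simp]: "space (uniform_dist lo hi) = UNIV"
  by (simp add: uniform_dist_def)

lemma measure_uniform_dist_le:
  assumes "lo < hi" "l \<le> u"
  shows "measure (uniform_dist lo hi) {l..u} \<le> (u - l) / (hi - lo)"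
proof -
  have "emeasure (uniform_dist lo hi) {l..u} = emeasure lborel ({lo..hi} \<inter> {l..u}) / emeasure lborel {lo..hi}"
    using assms by (simp add: uniform_dist_def)
  also have "\<dots> \<le> emeasure lborel {l..u} / emeasure lborel {lo..hi}"
    by (intro divide_right_mono_ennreal emeasure_mono) auto
  also have "\<dots> = ennreal ((u - l) / (hi - lo))"
    using assms by (simp add: divide_ennreal)
  finally have "ennreal (measure (uniform_dist lo hi) {l..u}) \<le> ennreal ((u - l) / (hi - lo))"
    using prob_space_uniform_dist[of lo hi]
    by (simp add: finite_measure.emeasure_eq_measure prob_space.finite_measure)
  then show ?thesis using assms by (subst (asm) ennreal_le_iff) auto
qed

lemma product_prob_space_uniform_dist: "product_prob_space (\<lambda>p. uniform_dist (lo p) (hi p))"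
  by (intro product_prob_spaceI prob_space_uniform_dist)

lemma product_prob_space_pmf: "product_prob_space (\<lambda>i. measure_pmf (p i))"
  by (intro product_prob_spaceI prob_space_measure_pmf)

lemma measure_pmf_of_interval:
  assumes "k \<in> {1..N::nat}"
  shows "measure (measure_pmf (pmf_of_set {1..N})) {k} = 1 / real N"
  using assms by (subst measure_pmf_of_set) auto

section \<open>Tracking the ideal process\<close>

locale lp_graph =
  fixes V :: "nat set" and E :: "nat set set" and b :: "nat \<Rightarrow> real" and r :: "nat set \<Rightarrow> real"
  assumes graph: "simple_graph V E"
    and b_nonneg: "\<And>v. v \<in> V \<Longrightarrow> 0 \<le> b v"
    and r_nonneg: "\<And>e. e \<in> E \<Longrightarrow> 0 \<le> r e"
begin

section \<open>Sums over the edges at a vertex\<close>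

lemma finite_V [simp]: "finite V"
  and edge_subset: "e \<in> E \<Longrightarrow> e \<subseteq> V"
  and card_edge: "e \<in> E \<Longrightarrow> card e = 2"
  using graph by (auto simp: simple_graph_def)

lemma finite_E [simp]: "finite E"
  using edge_subset by (intro finite_subset[of E "Pow V"]) auto

lemma finite_edge: "e \<in> E \<Longrightarrow> finite e"
  using card_edge by (metis card.infinite zero_neq_numeral)

lemma finite_incident [simp]: "finite (incident E v)"
  by (simp add: incident_def)

lemma incidentD: "e \<in> incident E v \<Longrightarrow> e \<in> E" "e \<in> incident E v \<Longrightarrow> v \<in> e"
  by (auto simp: incident_def)

lemma edge_eq_pair:
  assumes "e \<in> E" "u \<in> e"
  obtains w where "e = {u, w}" "w \<noteq> u" "w \<in> V"
proof -
  from card_edge[OF assms(1)] obtain x y where "e = {x, y}" "x \<noteq> y"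
    by (auto simp: card_2_iff)
  then show ?thesis using that assms edge_subset[OF assms(1)] by (auto simp: insert_commute)
qed

text \<open>Randomness belongs to vertices, so sums over the edges at u are rewritten as sums over
  the other endpoints; the terms then carry independent bits.\<close>

lemma sum_incident_neighbours:
  fixes f :: "nat set \<Rightarrow> real"
  assumes "u \<in> V"
  shows "(\<Sum>e\<in>incident E u. f e) = (\<Sum>w\<in>V. if {u, w} \<in> E then f {u, w} else 0)"
proof -
  have "(\<Sum>w\<in>V. if {u, w} \<in> E then f {u, w} else 0) = (\<Sum>w\<in>{w\<in>V. {u, w} \<in> E}. f {u, w})"
    by (intro sum.mono_neutral_cong_right) auto
  also have "\<dots> = (\<Sum>e\<in>incident E u. f e)"
  proof (rule sum.reindex_bij_betw)
    show "bij_betw (\<lambda>w. {u, w}) {w \<in> V. {u, w} \<in> E} (incident E u)"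
      unfolding bij_betw_def
    proof (intro conjI equalityI)
      show "inj_on (\<lambda>w. {u, w}) {w \<in> V. {u, w} \<in> E}"
        by (auto simp: inj_on_def doubleton_eq_iff)
      show "incident E u \<subseteq> (\<lambda>w. {u, w}) ` {w \<in> V. {u, w} \<in> E}"
      proof
        fix e assume "e \<in> incident E u"
        then have e: "e \<in> E" "u \<in> e" by (auto simp: incident_def)
        then obtain w where "e = {u, w}" "w \<noteq> u" "w \<in> V" by (rule edge_eq_pair)
        with e show "e \<in> (\<lambda>w. {u, w}) ` {w \<in> V. {u, w} \<in> E}" by auto
      qed
    qed (auto simp: incident_def)
  qed
  finally show ?thesis ..
qed

lemma sum_incident_swap:
  fixes g :: "nat \<Rightarrow> nat set \<Rightarrow> real"
  shows "(\<Sum>v\<in>V. \<Sum>e\<in>incident E v. g v e) = (\<Sum>e\<in>E. \<Sum>v\<in>e. g v e)"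
proof -
  have "(\<Sum>v\<in>V. \<Sum>e\<in>{e \<in> E. v \<in> e}. g v e) = (\<Sum>e\<in>E. \<Sum>v\<in>{v \<in> V. v \<in> e}. g v e)"
    by (rule sum.swap_restrict[where R = "\<lambda>v e. v \<in> e"]) auto
  also have "\<dots> = (\<Sum>e\<in>E. \<Sum>v\<in>e. g v e)"
  proof (rule sum.cong[OF refl])
    fix e assume "e \<in> E"
    then have "{v \<in> V. v \<in> e} = e" using edge_subset by auto
    then show "(\<Sum>v\<in>{v \<in> V. v \<in> e}. g v e) = (\<Sum>v\<in>e. g v e)" by simp
  qed
  finally show ?thesis by (simp add: incident_def)
qed

lemma sum_endpoints:
  fixes f :: "nat \<Rightarrow> real"
  shows "(\<Sum>v\<in>V. real (card (incident E v)) * f v) = (\<Sum>e\<in>E. \<Sum>v\<in>e. f v)"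
  using sum_incident_swap[of "\<lambda>v _. f v"] by simp

lemma sum_card_incident: "(\<Sum>v\<in>V. real (card (incident E v))) = 2 * real (card E)"
  using sum_endpoints[of "\<lambda>_. 1"] card_edge by simp

lemma q_val_nonneg: "v \<in> V \<Longrightarrow> 0 \<le> q_val V E b v"
  using b_nonneg by (auto simp: q_val_def avg_degree_def max_def intro!: divide_nonneg_nonneg)

lemma x_init_nonneg: "e \<in> E \<Longrightarrow> 0 \<le> x_init V E b r e"
  using r_nonneg q_val_nonneg edge_subset finite_edge[of e] card_edge[of e]
  by (auto simp: x_init_def intro!: Min.boundedI)

lemma x_init_le_r: "x_init V E b r e \<le> r e"
  by (simp add: x_init_def)

lemma x_init_le_q: "e \<in> E \<Longrightarrow> u \<in> e \<Longrightarrow> x_init V E b r e \<le> q_val V E b u"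
  using finite_edge[of e] by (auto simp: x_init_def intro!: min.coboundedI2)

text \<open>Both the algorithm and its idealisation are instances of this process: they differ only in how
  the load of a vertex is estimated.\<close>

primrec process ::
  "((nat set \<Rightarrow> real) \<Rightarrow> nat \<Rightarrow> real) \<Rightarrow> (nat \<times> nat \<Rightarrow> real) \<Rightarrow> nat \<Rightarrow> nat set \<times> (nat set \<Rightarrow> real)" where
  "process est \<theta> 0 = (V, x_init V E b r)"
| "process est \<theta> (Suc t) =
     (let (A, x) = process est \<theta> t;
          A' = {v \<in> A. est x v \<le> \<theta> (v, Suc t)};
          F = {e \<in> E. e \<subseteq> A' \<and> x e \<le> r e / 2}
      in (A', \<lambda>e. if e \<in> F then 2 * x e else x e))"

definition act where "act est \<theta> t = fst (process est \<theta> t)"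
definition xval where "xval est \<theta> t = snd (process est \<theta> t)"

lemma one_round_state_eq_process:
  "one_round_state V E b r \<omega> t = process (y_est V E (fst \<omega>)) (snd \<omega>) t"
  by (induction t) simp_all

lemma act_0 [simp]: "act est \<theta> 0 = V"
  and xval_0 [simp]: "xval est \<theta> 0 = x_init V E b r"
  by (simp_all add: act_def xval_def)

lemma act_Suc: "act est \<theta> (Suc t) = {v \<in> act est \<theta> t. est (xval est \<theta> t) v \<le> \<theta> (v, Suc t)}"
  by (simp add: act_def xval_def Let_def split: prod.split)

lemma xval_Suc: "xval est \<theta> (Suc t) e =
    (if e \<in> E \<and> e \<subseteq> act est \<theta> (Suc t) \<and> xval est \<theta> t e \<le> r e / 2
     then 2 * xval est \<theta> t e else xval est \<theta> t e)"
  by (simp add: act_def xval_def Let_def split: prod.split)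

lemma act_subset: "act est \<theta> t \<subseteq> V"
  by (induction t) (auto simp: act_Suc)

lemma act_antimono: "s \<le> t \<Longrightarrow> act est \<theta> t \<subseteq> act est \<theta> s"
  by (rule lift_Suc_antimono_le) (auto simp: act_Suc)

lemma xval_nonneg: "e \<in> E \<Longrightarrow> 0 \<le> xval est \<theta> t e"
  by (induction t) (auto simp: xval_Suc x_init_nonneg)

lemma xval_le_r: "xval est \<theta> t e \<le> r e"
  by (induction t) (auto simp: xval_Suc x_init_le_r)

lemma xval_mono: "e \<in> E \<Longrightarrow> s \<le> t \<Longrightarrow> xval est \<theta> s e \<le> xval est \<theta> t e"
  by (rule lift_Suc_mono_le[of "\<lambda>t. xval est \<theta> t e"]) (auto simp: xval_Suc xval_nonneg)

lemma xval_le_power: "e \<in> E \<Longrightarrow> xval est \<theta> (s + k) e \<le> 2 ^ k * xval est \<theta> s e"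
proof (induction k)
  case (Suc k)
  have "xval est \<theta> (s + Suc k) e \<le> 2 * xval est \<theta> (s + k) e"
    using Suc.prems xval_nonneg[OF Suc.prems, of est \<theta> "s + k"] by (simp add: xval_Suc)
  with Suc show ?case by simp
qed simp

text \<open>Estimates influence the value of an edge only through the activity of its two endpoints.
  This makes agreement of two processes a local matter.\<close>

lemma xval_agree:
  assumes "\<And>s u. s \<le> t \<Longrightarrow> u \<in> e \<Longrightarrow> u \<in> act est \<theta> s \<longleftrightarrow> u \<in> act est' \<theta> s"
  shows "xval est \<theta> t e = xval est' \<theta> t e"
  using assms
proof (induction t)
  case (Suc t)
  have "e \<subseteq> act est \<theta> (Suc t) \<longleftrightarrow> e \<subseteq> act est' \<theta> (Suc t)"
    using Suc.prems[of "Suc t"] by auto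
  with Suc show ?case by (simp add: xval_Suc)
qed simp

text \<open>The state after t iterations is determined by the thresholds of the iterations up to t.
  Hence the ideal load tested in iteration s does not depend on the thresholds of iteration
  s.\<close>

lemma process_cong:
  assumes "\<And>v s. v \<in> V \<Longrightarrow> 1 \<le> s \<Longrightarrow> s \<le> t \<Longrightarrow> \<theta> (v, s) = \<theta>' (v, s)"
  shows "act est \<theta> t = act est \<theta>' t \<and> xval est \<theta> t = xval est \<theta>' t"
  using assms
proof (induction t)
  case (Suc t)
  then have IH: "act est \<theta> t = act est \<theta>' t" "xval est \<theta> t = xval est \<theta>' t" by auto
  have "act est \<theta> (Suc t) = act est \<theta>' (Suc t)"
    using IH Suc.prems act_subset[of est \<theta>' t] by (auto simp: act_Suc)
  then show ?case using IH by (auto simp: xval_Suc fun_eq_iff)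
qed simp

text \<open>The denominator of \<open>q_val\<close> is at least the average degree d and a value
  doubles at most T times. So one edge carries at most the fraction 2^T / d of the capacity of
  either endpoint; this bounds the single weights in the Chernoff bounds.\<close>

lemma xval_le_b:
  assumes "e \<in> E" "u \<in> e" "t \<le> T" "0 < avg_degree V E"
  shows "xval est \<theta> t e \<le> 2 ^ T * (b u / avg_degree V E)"
proof -
  have u: "u \<in> V" using assms edge_subset by auto
  have "xval est \<theta> t e \<le> 2 ^ t * x_init V E b r e"
    using xval_le_power[OF assms(1), of est \<theta> 0 t] by simp
  also have "\<dots> \<le> 2 ^ T * (b u / avg_degree V E)"
  proof (rule mult_mono)
    have "x_init V E b r e \<le> 0.8 * b u / max (real (card (incident E u))) (avg_degree V E)"
      using x_init_le_q[OF assms(1,2)] by (simp add: q_val_def)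
    also have "\<dots> \<le> b u / avg_degree V E"
      using b_nonneg[OF u] assms(4) by (intro frac_le) auto
    finally show "x_init V E b r e \<le> b u / avg_degree V E" .
  qed (use assms x_init_nonneg in \<open>auto intro: power_increasing\<close>)
  finally show ?thesis .
qed

text \<open>Feasibility holds for every outcome: all edges at an overloaded vertex are set to 0, and
  elsewhere this can only lower the loads.\<close>

lemma one_round_mpc_feasible: "lp_feasible V E b r (one_round_mpc V E b r \<omega>)"
proof -
  define x where "x = xval (y_est V E (fst \<omega>)) (snd \<omega>) (num_iters V E)"
  have eq: "one_round_mpc V E b r \<omega> e = (if \<forall>u\<in>e. (\<Sum>f\<in>incident E u. x f) \<le> b u then x e else 0)" for e
    by (simp add: one_round_mpc_def x_def xval_def one_round_state_eq_process Let_def)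
  have nonneg: "0 \<le> one_round_mpc V E b r \<omega> e" and le: "one_round_mpc V E b r \<omega> e \<le> x e" if "e \<in> E" for e
    using that by (auto simp: eq x_def xval_nonneg)
  have "(\<Sum>e\<in>incident E v. one_round_mpc V E b r \<omega> e) \<le> b v" if "v \<in> V" for v
  proof (cases "(\<Sum>f\<in>incident E v. x f) \<le> b v")
    case True
    have "(\<Sum>e\<in>incident E v. one_round_mpc V E b r \<omega> e) \<le> (\<Sum>f\<in>incident E v. x f)"
      by (intro sum_mono le incidentD)
    with True show ?thesis by linarith
  next
    case False
    then have "(\<Sum>e\<in>incident E v. one_round_mpc V E b r \<omega> e) = 0"
      by (intro sum.neutral) (auto simp: eq dest: incidentD)
    with b_nonneg[OF that] show ?thesis by simp
  qed
  moreover have "one_round_mpc V E b r \<omega> e \<le> r e" if "e \<in> E" for e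
    using le[OF that] xval_le_r[of _ _ _ e] unfolding x_def by (meson order_trans)
  ultimately show ?thesis using nonneg by (auto simp: lp_feasible_def)
qed

subsection \<open>The ideal process\<close>

definition load :: "(nat set \<Rightarrow> real) \<Rightarrow> nat \<Rightarrow> real" where "load x v = (\<Sum>e\<in>incident E v. x e)"

abbreviation "ideal_x \<theta> t \<equiv> xval load \<theta> t"
abbreviation "ideal_act \<theta> t \<equiv> act load \<theta> t"

definition in_range where
  "in_range T \<theta> \<longleftrightarrow> (\<forall>v\<in>V. \<forall>t\<in>{1..T}. 0.2 * b v \<le> \<theta> (v, t) \<and> \<theta> (v, t) \<le> 0.4 * b v)"

text \<open>The load of u changes only in iterations that u survives as active. It was then at most
  the threshold, hence at most 0.4 b, and at most doubles. Initially the bound comes from the factor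
  0.8 in \<open>q_val\<close>.\<close>

lemma ideal_load_le:
  assumes "in_range T \<theta>" "t \<le> T" "u \<in> V"
  shows "load (ideal_x \<theta> t) u \<le> 0.8 * b u"
  using assms(2)
proof (induction t)
  case 0
  show ?case
  proof (cases "incident E u = {}")
    case True
    then show ?thesis using b_nonneg[OF assms(3)] by (simp add: load_def)
  next
    case False
    then have pos: "0 < real (card (incident E u))"
      by (simp add: card_gt_0_iff)
    have "load (ideal_x \<theta> 0) u \<le> real (card (incident E u)) * q_val V E b u"
      unfolding load_def[of _ u] by (rule sum_bounded_above) (auto intro: x_init_le_q dest: incidentD)
    also have "\<dots> \<le> max (real (card (incident E u))) (avg_degree V E) * q_val V E b u"
      using q_val_nonneg[OF assms(3)] by (intro mult_right_mono) auto
    also have "\<dots> = 0.8 * b u"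
      using pos by (auto simp: q_val_def max_def)
    finally show ?thesis .
  qed
next
  case (Suc t)
  show ?case
  proof (cases "u \<in> ideal_act \<theta> (Suc t)")
    case True
    have "load (ideal_x \<theta> (Suc t)) u \<le> (\<Sum>e\<in>incident E u. 2 * ideal_x \<theta> t e)"
      unfolding load_def[of _ u] using xval_le_power[of _ load \<theta> t 1]
      by (intro sum_mono) (auto dest: incidentD)
    also have "\<dots> = 2 * load (ideal_x \<theta> t) u"
      by (simp add: load_def sum_distrib_left)
    also have "load (ideal_x \<theta> t) u \<le> \<theta> (u, Suc t)"
      using True by (simp add: act_Suc)
    also have "\<dots> \<le> 0.4 * b u"
      using assms(1,3) Suc.prems by (auto simp: in_range_def)
    finally show ?thesis by simp
  next
    case False
    then have "load (ideal_x \<theta> (Suc t)) u = load (ideal_x \<theta> t) u"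
      unfolding load_def[of _ u] by (intro sum.cong refl) (auto simp: xval_Suc dest: incidentD)
    with Suc show ?thesis by simp
  qed
qed

text \<open>A vertex becomes inactive because its load exceeds a threshold of at least 0.2 b, and
  loads never decrease.\<close>

lemma ideal_load_inactive:
  assumes "in_range T \<theta>" "t \<le> T" "u \<in> V" "u \<notin> ideal_act \<theta> t"
  shows "0.2 * b u \<le> load (ideal_x \<theta> t) u"
  using assms(2,4)
proof (induction t)
  case (Suc t)
  have mono: "load (ideal_x \<theta> t) u \<le> load (ideal_x \<theta> (Suc t)) u"
    unfolding load_def[of _ u] by (intro sum_mono xval_mono) (auto dest: incidentD)
  show ?case
  proof (cases "u \<in> ideal_act \<theta> t")
    case True
    then have "\<theta> (u, Suc t) < load (ideal_x \<theta> t) u"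
      using Suc.prems by (auto simp: act_Suc)
    moreover have "0.2 * b u \<le> \<theta> (u, Suc t)"
      using assms(1,3) Suc.prems by (auto simp: in_range_def)
    ultimately show ?thesis using mono by linarith
  next
    case False
    with Suc mono show ?thesis by fastforce
  qed
qed (use assms in simp)

section \<open>Near vertices and the propagation of errors\<close>

definition near where
  "near \<epsilon> \<theta> v t \<longleftrightarrow> \<bar>\<theta> (v, t) - load (ideal_x \<theta> (t - 1)) v\<bar> \<le> \<epsilon> * 128 ^ (t - 1) * b v"

definition clean where
  "clean \<epsilon> \<theta> v t \<longleftrightarrow> (\<forall>s\<in>{1..t}. \<not> near \<epsilon> \<theta> v s)"

text \<open>40 is the product of the Chernoff factor 4 and the factor 10 between the margin and the
  probability of nearness; \<epsilon> * b u absorbs the fluctuation. The weights \<open>k\<close>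
  are later the coefficients of the estimate and, for true loads, constantly 1.\<close>

definition few_near where
  "few_near k \<epsilon> \<theta> T \<longleftrightarrow> (\<forall>u\<in>V. \<forall>s\<in>{1..T}.
     (\<Sum>e\<in>incident E u. k u e * ideal_x \<theta> (s - 1) e * of_bool (\<exists>w\<in>e - {u}. near \<epsilon> \<theta> w s))
       \<le> 40 * (\<epsilon> * 128 ^ (s - 1)) * (\<Sum>e\<in>incident E u. k u e * ideal_x \<theta> (s - 1) e) + \<epsilon> * b u)"

text \<open>Bounds how far the value of e can be off after t iterations, seen from a clean endpoint
  u. The sum runs over all iterations in which the other endpoint is near, not only the first, so
  that it is linear in the indicators bounded by \<open>few_near\<close>.\<close>

definition near_weight where
  "near_weight \<epsilon> \<theta> u t e =
     (\<Sum>s\<in>{1..t}. 2 ^ (t + 1 - s) * ideal_x \<theta> (s - 1) e * of_bool (\<exists>w\<in>e - {u}. near \<epsilon> \<theta> w s))"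

lemma clean_mono: "clean \<epsilon> \<theta> v t \<Longrightarrow> s \<le> t \<Longrightarrow> clean \<epsilon> \<theta> v s"
  by (auto simp: clean_def)

lemma near_weight_nonneg: "e \<in> E \<Longrightarrow> 0 \<le> near_weight \<epsilon> \<theta> u t e"
  by (auto simp: near_weight_def xval_nonneg intro!: sum_nonneg)

text \<open>The factor is 37 = 40 * 0.9 + 1. If h(t) is the left-hand side, h(t + 1) <= 2 h(t) + 74
  * 128^t, so any base from 76 on closes the induction; 128 is a power of 2 and easily compared with
  2^T. The summand 1 reserves room for the sampling error.\<close>

lemma geometric_tail: "37 * (\<Sum>s\<in>{1..t}. 2 ^ (t + 1 - s) * 128 ^ (s - 1)) + 1 \<le> (128::real) ^ t"
proof (induction t)
  case (Suc t)
  define g where "g = (\<Sum>s\<in>{1..t}. 2 ^ (t + 1 - s) * (128::real) ^ (s - 1))"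
  have "(\<Sum>s\<in>{1..Suc t}. 2 ^ (Suc t + 1 - s) * (128::real) ^ (s - 1)) = 2 * g + 2 * 128 ^ t"
    by (auto simp: g_def sum_distrib_left Suc_diff_le intro!: sum.cong)
  moreover have "(0::real) \<le> 128 ^ t" by simp
  moreover have "37 * g + 1 \<le> 128 ^ t" unfolding g_def by (rule Suc)
  ultimately show ?case unfolding power_Suc by linarith
qed simp

text \<open>After an exchange of sums, iteration s contributes 2^(t+1-s) times the weight on
  neighbours near in s. The bound 0.9 b on the weighted loads covers true loads (at most 0.8 b) and
  estimated ones (at most 0.05 b more).\<close>

lemma weighted_deviation_le:
  assumes few: "few_near k \<epsilon> \<theta> T" and u: "u \<in> V" and t: "t \<le> T" and \<epsilon>: "0 \<le> \<epsilon>"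
    and k: "\<And>e. e \<in> incident E u \<Longrightarrow> 0 \<le> k u e"
    and row: "\<And>s. s < t \<Longrightarrow> (\<Sum>e\<in>incident E u. k u e * ideal_x \<theta> s e) \<le> 0.9 * b u"
    and z: "\<And>e. e \<in> incident E u \<Longrightarrow> \<bar>z e - ideal_x \<theta> t e\<bar> \<le> near_weight \<epsilon> \<theta> u t e"
  shows "\<bar>(\<Sum>e\<in>incident E u. k u e * z e) - (\<Sum>e\<in>incident E u. k u e * ideal_x \<theta> t e)\<bar>
      \<le> \<epsilon> * (128 ^ t - 1) * b u"
proof -
  have "\<bar>(\<Sum>e\<in>incident E u. k u e * z e) - (\<Sum>e\<in>incident E u. k u e * ideal_x \<theta> t e)\<bar>
      = \<bar>\<Sum>e\<in>incident E u. k u e * (z e - ideal_x \<theta> t e)\<bar>"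
    by (simp add: algebra_simps sum_subtractf)
  also have "\<dots> \<le> (\<Sum>e\<in>incident E u. k u e * near_weight \<epsilon> \<theta> u t e)"
    using k z by (intro order_trans[OF sum_abs] sum_mono) (auto simp: abs_mult intro!: mult_left_mono)
  also have "\<dots> = (\<Sum>s\<in>{1..t}. 2 ^ (t + 1 - s) *
      (\<Sum>e\<in>incident E u. k u e * ideal_x \<theta> (s - 1) e * of_bool (\<exists>w\<in>e - {u}. near \<epsilon> \<theta> w s)))"
    unfolding near_weight_def sum_distrib_left
    by (subst sum.swap) (intro sum.cong refl, simp)
  also have "\<dots> \<le> (\<Sum>s\<in>{1..t}. 2 ^ (t + 1 - s) * (37 * (\<epsilon> * 128 ^ (s - 1)) * b u))"
  proof (intro sum_mono mult_left_mono)
    fix s assume s: "s \<in> {1..t}"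
    have "(\<Sum>e\<in>incident E u. k u e * ideal_x \<theta> (s - 1) e * of_bool (\<exists>w\<in>e - {u}. near \<epsilon> \<theta> w s))
       \<le> 40 * (\<epsilon> * 128 ^ (s - 1)) * (\<Sum>e\<in>incident E u. k u e * ideal_x \<theta> (s - 1) e) + \<epsilon> * b u"
      using few u s t by (auto simp: few_near_def)
    also have "\<dots> \<le> 40 * (\<epsilon> * 128 ^ (s - 1)) * (0.9 * b u) + \<epsilon> * 128 ^ (s - 1) * b u"
      using s \<epsilon> b_nonneg[OF u] by (intro add_mono mult_left_mono row mult_right_mono) (auto simp: mult_le_cancel_left1)
    also have "\<dots> = 37 * (\<epsilon> * 128 ^ (s - 1)) * b u" by (simp add: algebra_simps)
    finally show "(\<Sum>e\<in>incident E u. k u e * ideal_x \<theta> (s - 1) e * of_bool (\<exists>w\<in>e - {u}. near \<epsilon> \<theta> w s))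
       \<le> 37 * (\<epsilon> * 128 ^ (s - 1)) * b u" .
  qed simp
  also have "\<dots> = \<epsilon> * (37 * (\<Sum>s\<in>{1..t}. 2 ^ (t + 1 - s) * 128 ^ (s - 1))) * b u"
    by (simp add: sum_distrib_left sum_distrib_right mult_ac)
  also have "\<dots> \<le> \<epsilon> * (128 ^ t - 1) * b u"
    using geometric_tail[of t] \<epsilon> b_nonneg[OF u] by (intro mult_right_mono mult_left_mono) auto
  finally show ?thesis .
qed

end

text \<open>Here \<open>k u e\<close> is the coefficient with which the edge \<open>e\<close> enters the estimate of the load of \<open>u\<close>.\<close>

locale tracked = lp_graph +
  fixes k :: "nat \<Rightarrow> nat set \<Rightarrow> real" and est :: "(nat set \<Rightarrow> real) \<Rightarrow> nat \<Rightarrow> real"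
    and \<epsilon> :: real and \<theta> :: "nat \<times> nat \<Rightarrow> real" and T :: nat
  assumes est: "\<And>x u. u \<in> V \<Longrightarrow> est x u = (\<Sum>e\<in>incident E u. k u e * x e)"
    and k_nonneg: "\<And>u e. u \<in> V \<Longrightarrow> e \<in> incident E u \<Longrightarrow> 0 \<le> k u e"
    and eps: "0 \<le> \<epsilon>" "\<epsilon> * 128 ^ T \<le> 0.05"
    and range: "in_range T \<theta>"
    and concentrated: "\<And>u t. u \<in> V \<Longrightarrow> t \<le> T \<Longrightarrow>
        \<bar>est (ideal_x \<theta> t) u - load (ideal_x \<theta> t) u\<bar> \<le> \<epsilon> * b u"
    and few_k: "few_near k \<epsilon> \<theta> T"
    and few_1: "few_near (\<lambda>_ _. 1) \<epsilon> \<theta> T"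
begin

lemma eps_le: "\<epsilon> \<le> 0.05"
proof -
  have "\<epsilon> * 1 \<le> \<epsilon> * 128 ^ T" using eps by (intro mult_left_mono) auto
  with eps show ?thesis by simp
qed

text \<open>Let s be the first iteration in which w is near. Up to s - 1 both endpoints are clean,
  so the two processes agree on e; from then on either value at most doubles per iteration. Both
  values lie between 0 and \<open>near_weight\<close>, hence so does their distance. Tracking is a
  hypothesis here because the induction that proves it relies on this lemma.\<close>

lemma near_weight_bounds:
  assumes e: "e \<in> E" "u \<in> e" and c: "clean \<epsilon> \<theta> u t"
    and act: "\<And>s v. s \<le> t \<Longrightarrow> v \<in> V \<Longrightarrow> clean \<epsilon> \<theta> v s \<Longrightarrow> v \<in> act est \<theta> s \<longleftrightarrow> v \<in> ideal_act \<theta> s"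
    and w: "w \<in> e - {u}" "\<not> clean \<epsilon> \<theta> w t"
  shows "xval est \<theta> t e \<le> near_weight \<epsilon> \<theta> u t e" "ideal_x \<theta> t e \<le> near_weight \<epsilon> \<theta> u t e"
proof -
  define P where "P s \<longleftrightarrow> s \<in> {1..t} \<and> near \<epsilon> \<theta> w s" for s
  define s where "s = (LEAST s. P s)"
  have "\<exists>s. P s" using w(2) by (auto simp: clean_def P_def)
  then have "P s" unfolding s_def by (rule LeastI_ex)
  then have s: "s \<in> {1..t}" "near \<epsilon> \<theta> w s" by (auto simp: P_def)
  have "clean \<epsilon> \<theta> w (s - 1)"
    unfolding clean_def
  proof
    fix s' assume s': "s' \<in> {1..s - 1}"
    then have "s' < (LEAST s. P s)" using s by (auto simp: s_def[symmetric])
    then have "\<not> P s'" by (rule not_less_Least)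
    with s' s show "\<not> near \<epsilon> \<theta> w s'" by (auto simp: P_def)
  qed
  moreover have "e = {u, w}" using e w by (metis edge_eq_pair insertE Diff_iff insert_iff singletonD)
  ultimately have ends: "clean \<epsilon> \<theta> v (s - 1)" if "v \<in> e" for v
    using that c s by (auto intro: clean_mono)
  have "xval est \<theta> (s - 1) e = ideal_x \<theta> (s - 1) e"
  proof (rule xval_agree)
    fix s' v assume "s' \<le> s - 1" "v \<in> e"
    then show "v \<in> act est \<theta> s' \<longleftrightarrow> v \<in> ideal_act \<theta> s'"
      using s e edge_subset by (intro act clean_mono[OF ends]) auto
  qed
  moreover have "xval est' \<theta> t e \<le> 2 ^ (t + 1 - s) * xval est' \<theta> (s - 1) e" for est'
    using xval_le_power[OF e(1), of est' \<theta> "s - 1" "t + 1 - s"] s by simp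
  moreover have "2 ^ (t + 1 - s) * ideal_x \<theta> (s - 1) e \<le> near_weight \<epsilon> \<theta> u t e"
  proof -
    have "2 ^ (t + 1 - s) * ideal_x \<theta> (s - 1) e =
      2 ^ (t + 1 - s) * ideal_x \<theta> (s - 1) e * of_bool (\<exists>w\<in>e - {u}. near \<epsilon> \<theta> w s)"
      using w s by auto
    also have "\<dots> \<le> near_weight \<epsilon> \<theta> u t e"
      unfolding near_weight_def using s e
      by (intro member_le_sum[of s]) (auto simp: xval_nonneg)
    finally show ?thesis .
  qed
  ultimately show "xval est \<theta> t e \<le> near_weight \<epsilon> \<theta> u t e" "ideal_x \<theta> t e \<le> near_weight \<epsilon> \<theta> u t e"
    by (metis order_trans)+
qed

lemma xval_eq_ideal:
  assumes "e \<in> E" "\<And>v. v \<in> e \<Longrightarrow> clean \<epsilon> \<theta> v t"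
    and act: "\<And>s v. s \<le> t \<Longrightarrow> v \<in> V \<Longrightarrow> clean \<epsilon> \<theta> v s \<Longrightarrow> v \<in> act est \<theta> s \<longleftrightarrow> v \<in> ideal_act \<theta> s"
  shows "xval est \<theta> t e = ideal_x \<theta> t e"
  using assms(2) edge_subset[OF assms(1)] by (intro xval_agree act) (auto intro: clean_mono)

lemma row_k:
  assumes "u \<in> V" "s \<le> T"
  shows "(\<Sum>e\<in>incident E u. k u e * ideal_x \<theta> s e) \<le> 0.9 * b u"
proof -
  have "\<epsilon> * b u \<le> 0.05 * b u" using eps_le b_nonneg[OF assms(1)] by (intro mult_right_mono) auto
  then show ?thesis
    using concentrated[OF assms] ideal_load_le[OF range assms(2,1)] b_nonneg[OF assms(1)]
    by (simp add: est[OF assms(1)])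
qed

text \<open>The two error sources add up exactly: \<epsilon> * (128^t - 1) * b from unclean
  neighbours and \<epsilon> * b from sampling.\<close>

lemma estimate_close:
  assumes u: "u \<in> V" and t: "t \<le> T" and c: "clean \<epsilon> \<theta> u t"
    and act: "\<And>s v. s \<le> t \<Longrightarrow> v \<in> V \<Longrightarrow> clean \<epsilon> \<theta> v s \<Longrightarrow> v \<in> act est \<theta> s \<longleftrightarrow> v \<in> ideal_act \<theta> s"
  shows "\<bar>est (xval est \<theta> t) u - load (ideal_x \<theta> t) u\<bar> \<le> \<epsilon> * 128 ^ t * b u"
proof -
  have "\<bar>xval est \<theta> t e - ideal_x \<theta> t e\<bar> \<le> near_weight \<epsilon> \<theta> u t e" if "e \<in> incident E u" for e
  proof (cases "\<forall>v\<in>e. clean \<epsilon> \<theta> v t")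
    case True
    then have "xval est \<theta> t e = ideal_x \<theta> t e"
      using that act by (intro xval_eq_ideal) (auto dest: incidentD)
    then show ?thesis using that by (auto simp: near_weight_nonneg dest: incidentD)
  next
    case False
    then obtain w where w: "w \<in> e - {u}" "\<not> clean \<epsilon> \<theta> w t" using c by auto
    have e: "e \<in> E" "u \<in> e" using that by (auto dest: incidentD)
    show ?thesis
      using near_weight_bounds[OF e c act w] xval_nonneg[OF e(1), of est \<theta> t]
        xval_nonneg[OF e(1), of load \<theta> t] by linarith
  qed
  then have "\<bar>est (xval est \<theta> t) u - est (ideal_x \<theta> t) u\<bar> \<le> \<epsilon> * (128 ^ t - 1) * b u"
    unfolding est[OF u] using u t
    by (intro weighted_deviation_le[OF few_k u t eps(1)] k_nonneg row_k) auto
  with concentrated[OF u t] show ?thesis by (simp add: algebra_simps)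
qed

text \<open>Strong induction over all vertices at once. A vertex that is not near in iteration t has
  its threshold farther from the ideal load than the estimate can be, so both tests have the same
  result.\<close>

lemma clean_tracked:
  assumes "t \<le> T" "v \<in> V" "clean \<epsilon> \<theta> v t"
  shows "v \<in> act est \<theta> t \<longleftrightarrow> v \<in> ideal_act \<theta> t"
  using assms
proof (induction t arbitrary: v rule: less_induct)
  case (less t)
  show ?case
  proof (cases t)
    case (Suc t')
    have c: "clean \<epsilon> \<theta> v t'" and far: "\<not> near \<epsilon> \<theta> v (Suc t')"
      using less.prems Suc by (auto simp: clean_def)
    have "\<bar>est (xval est \<theta> t') v - load (ideal_x \<theta> t') v\<bar> \<le> \<epsilon> * 128 ^ t' * b v"
      using less Suc c by (intro estimate_close) auto
    with far have "est (xval est \<theta> t') v \<le> \<theta> (v, Suc t') \<longleftrightarrow> load (ideal_x \<theta> t') v \<le> \<theta> (v, Suc t')"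
      by (auto simp: near_def)
    moreover have "v \<in> act est \<theta> t' \<longleftrightarrow> v \<in> ideal_act \<theta> t'"
      using less.IH[of t' v] less.prems Suc c by auto
    ultimately show ?thesis by (simp add: Suc act_Suc)
  qed simp
qed

definition out where
  "out e = (if \<forall>u\<in>e. load (xval est \<theta> T) u \<le> b u then xval est \<theta> T e else 0)"

text \<open>Stated for any \<open>z\<close> between 0 and the computed values, as it is used twice:
  for the computed values it shows that clean vertices are not overloaded; then edges between clean
  vertices survive the final filter, and it applies to the output too.\<close>

lemma true_load_close:
  assumes u: "u \<in> V" and c: "clean \<epsilon> \<theta> u T"
    and z: "\<And>e. e \<in> incident E u \<Longrightarrow> \<forall>v\<in>e. clean \<epsilon> \<theta> v T \<Longrightarrow> z e = xval est \<theta> T e"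
      "\<And>e. e \<in> incident E u \<Longrightarrow> 0 \<le> z e" "\<And>e. e \<in> incident E u \<Longrightarrow> z e \<le> xval est \<theta> T e"
  shows "\<bar>load z u - load (ideal_x \<theta> T) u\<bar> \<le> 0.05 * b u"
proof -
  have "\<bar>z e - ideal_x \<theta> T e\<bar> \<le> near_weight \<epsilon> \<theta> u T e" if "e \<in> incident E u" for e
  proof (cases "\<forall>v\<in>e. clean \<epsilon> \<theta> v T")
    case True
    then have "z e = ideal_x \<theta> T e"
      using that z(1)[of e] clean_tracked xval_eq_ideal[of e T] by (auto dest: incidentD)
    then show ?thesis using that by (auto simp: near_weight_nonneg dest: incidentD)
  next
    case False
    then obtain w where w: "w \<in> e - {u}" "\<not> clean \<epsilon> \<theta> w T" using c by auto
    have e: "e \<in> E" "u \<in> e" using that by (auto dest: incidentD)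
    show ?thesis
      using near_weight_bounds[OF e c clean_tracked w] z(2,3)[OF that]
        xval_nonneg[OF e(1), of load \<theta> T] by linarith
  qed
  moreover have "(\<Sum>e\<in>incident E u. 1 * ideal_x \<theta> s e) \<le> 0.9 * b u" if "s < T" for s
    using ideal_load_le[OF range _ u, of s] b_nonneg[OF u] that by (simp add: load_def)
  ultimately have "\<bar>(\<Sum>e\<in>incident E u. 1 * z e) - (\<Sum>e\<in>incident E u. 1 * ideal_x \<theta> T e)\<bar>
      \<le> \<epsilon> * (128 ^ T - 1) * b u"
    by (intro weighted_deviation_le[OF few_1 u order_refl eps(1)]) auto
  also have "\<dots> \<le> 0.05 * b u"
    using eps b_nonneg[OF u] by (intro mult_right_mono) (auto simp: algebra_simps)
  finally show ?thesis by (simp add: load_def)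
qed

lemma clean_not_violated:
  assumes u: "u \<in> V" and c: "clean \<epsilon> \<theta> u T"
  shows "load (xval est \<theta> T) u \<le> b u"
proof -
  have "\<bar>load (xval est \<theta> T) u - load (ideal_x \<theta> T) u\<bar> \<le> 0.05 * b u"
    by (rule true_load_close[OF u c]) (auto simp: xval_nonneg dest: incidentD)
  then show ?thesis
    using ideal_load_le[OF range order_refl u] b_nonneg[OF u] unfolding abs_le_iff by simp
qed

lemma out_load_close:
  assumes u: "u \<in> V" and c: "clean \<epsilon> \<theta> u T"
  shows "\<bar>load out u - load (ideal_x \<theta> T) u\<bar> \<le> 0.05 * b u"
proof (rule true_load_close[OF u c])
  fix e assume "e \<in> incident E u" "\<forall>v\<in>e. clean \<epsilon> \<theta> v T"
  then show "out e = xval est \<theta> T e"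
    using edge_subset[of e] clean_not_violated by (auto simp: out_def dest: incidentD)
qed (auto simp: out_def xval_nonneg dest: incidentD)

text \<open>A loose edge with clean endpoints was doubled T times, starting from
  \<open>q_val\<close> of one endpoint u, and is charged to this u. Each such edge has ideal value
  2^T * 0.8 b / M with M <= deg u + d, and together they weigh at most 0.1 b. So u is charged at
  most (deg u + d) / (4 * 2^T) times. This sums up to m / 2^T since the degrees and the n copies of
  d both add up to 2m.\<close>

lemma card_loose_le:
  assumes m: "0 < card E"
  shows "real (card (E_loose V E b r out 0.05))
    \<le> real (card E) / 2 ^ T + real (card {e \<in> E. \<exists>v\<in>e. 0 < b v \<and> \<not> clean \<epsilon> \<theta> v T})"
proof -
  let ?U = "{e \<in> E. \<exists>v\<in>e. 0 < b v \<and> \<not> clean \<epsilon> \<theta> v T}"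
  define Q where "Q u = {e \<in> incident E u. 0 < b u \<and> ideal_x \<theta> T e = 2 ^ T * q_val V E b u \<and>
      load (ideal_x \<theta> T) u \<le> 0.1 * b u}" for u
  have sub: "E_loose V E b r out 0.05 \<subseteq> ?U \<union> (\<Union>u\<in>V. Q u)"
  proof
    fix e assume "e \<in> E_loose V E b r out 0.05"
    then have e: "e \<in> E" "out e < 0.05 * r e" and loose: "\<And>u. u \<in> e \<Longrightarrow> load out u < 0.05 * b u"
      by (auto simp: E_loose_def V_loose_def load_def)
    have V: "u \<in> V" if "u \<in> e" for u using that e edge_subset by auto
    have out_nonneg: "0 \<le> out f" if "f \<in> E" for f using that by (simp add: out_def xval_nonneg)
    have bpos: "0 < b u" if "u \<in> e" for u
    proof -
      have "0 \<le> load out u" unfolding load_def[of _ u] by (intro sum_nonneg out_nonneg) (auto dest: incidentD)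
      then show ?thesis using loose[OF that] by simp
    qed
    show "e \<in> ?U \<union> (\<Union>u\<in>V. Q u)"
    proof (cases "\<forall>v\<in>e. clean \<epsilon> \<theta> v T")
      case False
      with bpos e show ?thesis by auto
    next
      case True
      have low: "load (ideal_x \<theta> T) u \<le> 0.1 * b u" if "u \<in> e" for u
        using out_load_close[OF V[OF that]] True that loose[OF that] unfolding abs_le_iff by simp
      \<comment> \<open>0.1 b is below 0.2 b, the least ideal load of an inactive vertex; strictness
        needs b > 0.\<close>
      have active: "u \<in> ideal_act \<theta> T" if "u \<in> e" for u
        using ideal_load_inactive[OF range order_refl V[OF that]] low[OF that] bpos[OF that] by fastforce
      have "out e = xval est \<theta> T e"
        using True V clean_not_violated by (auto simp: out_def)
      also have "\<dots> = ideal_x \<theta> T e"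
        using True e clean_tracked by (intro xval_eq_ideal) auto
      finally have small: "ideal_x \<theta> T e < 0.05 * r e" using e by simp
      have rpos: "0 < r e" using small xval_nonneg[OF e(1), of load \<theta> T] by simp
      \<comment> \<open>The final ideal value is below 0.05 r, so no earlier value is above r / 2
        and the cap never blocks a doubling.\<close>
      have double: "ideal_x \<theta> t e = 2 ^ t * x_init V E b r e" if "t \<le> T" for t
        using that
      proof (induction t)
        case (Suc t)
        have "ideal_x \<theta> t e \<le> ideal_x \<theta> T e" using Suc.prems e by (intro xval_mono) auto
        with small rpos have "ideal_x \<theta> t e \<le> r e / 2" by simp
        moreover have "e \<subseteq> ideal_act \<theta> (Suc t)"
          using active act_antimono[of "Suc t" T] Suc.prems by blast
        ultimately show ?case using Suc e by (simp add: xval_Suc)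
      qed simp
      have "x_init V E b r e \<le> ideal_x \<theta> T e"
        using xval_mono[OF e(1), of 0 T] by simp
      with small rpos have "x_init V E b r e < r e" by simp
      then have "x_init V E b r e = Min (q_val V E b ` e)"
        by (auto simp: x_init_def min_def split: if_splits)
      moreover have "Min (q_val V E b ` e) \<in> q_val V E b ` e"
        using finite_edge[OF e(1)] card_edge[OF e(1)] by (intro Min_in) auto
      ultimately obtain u where u: "u \<in> e" "x_init V E b r e = q_val V E b u" by auto
      then have "e \<in> Q u"
        using e bpos low double[of T] by (auto simp: Q_def incident_def)
      with u V show ?thesis by auto
    qed
  qed
  have dpos: "0 < avg_degree V E"
  proof -
    from m obtain e where "e \<in> E" by (metis card.empty ex_in_conv less_irrefl)
    then have "V \<noteq> {}" using edge_subset card_edge by fastforce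
    with m show ?thesis by (auto simp: avg_degree_def card_gt_0_iff)
  qed
  have Q: "real (card (Q u)) \<le> (real (card (incident E u)) + avg_degree V E) / (4 * 2 ^ T)" if "u \<in> V" for u
  proof (cases "Q u = {}")
    case True
    then show ?thesis using dpos by (simp add: add_nonneg_nonneg)
  next
    case False
    then have bu: "0 < b u" and low: "load (ideal_x \<theta> T) u \<le> 0.1 * b u" by (auto simp: Q_def)
    define M where "M = max (real (card (incident E u))) (avg_degree V E)"
    have M: "0 < M" using dpos by (simp add: M_def)
    have "real (card (Q u)) * (2 ^ T * q_val V E b u) = (\<Sum>e\<in>Q u. ideal_x \<theta> T e)"
      by (simp add: Q_def)
    also have "\<dots> \<le> load (ideal_x \<theta> T) u"
      unfolding load_def[of _ u] by (intro sum_mono2) (auto simp: Q_def xval_nonneg dest: incidentD)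
    also have "\<dots> \<le> 0.1 * b u" by (rule low)
    finally have "real (card (Q u)) * (2 ^ T * (0.8 * b u / M)) \<le> 0.1 * b u"
      by (simp add: q_val_def M_def)
    then have "(real (card (Q u)) * 2 ^ T * 0.8) * b u \<le> (0.1 * M) * b u"
      using M by (simp add: field_simps)
    then have "real (card (Q u)) * 2 ^ T * 0.8 \<le> 0.1 * M"
      using bu by (simp add: mult_le_cancel_right)
    moreover have "M \<le> real (card (incident E u)) + avg_degree V E"
      using dpos by (simp add: M_def)
    moreover have "0 \<le> real (card (Q u)) * 2 ^ T" by simp
    ultimately have "4 * (real (card (Q u)) * 2 ^ T) \<le> real (card (incident E u)) + avg_degree V E"
      by linarith
    then show ?thesis by (simp add: field_simps)
  qed
  have "real (card (E_loose V E b r out 0.05)) \<le> real (card (?U \<union> (\<Union>u\<in>V. Q u)))"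
    using sub by (intro of_nat_mono card_mono) (auto simp: Q_def)
  also have "\<dots> \<le> real (card ?U + (\<Sum>u\<in>V. card (Q u)))"
    by (intro of_nat_mono order_trans[OF card_Un_le] add_left_mono card_UN_le) auto
  also have "\<dots> \<le> real (card ?U) + (\<Sum>u\<in>V. (real (card (incident E u)) + avg_degree V E) / (4 * 2 ^ T))"
    using Q by (auto intro!: sum_mono)
  also have "(\<Sum>u\<in>V. (real (card (incident E u)) + avg_degree V E) / (4 * 2 ^ T))
      = (2 * real (card E) + real (card V) * avg_degree V E) / (4 * 2 ^ T)"
    by (simp add: sum_divide_distrib[symmetric] sum.distrib sum_card_incident)
  also have "real (card V) * avg_degree V E = 2 * real (card E)"
    using dpos by (auto simp: avg_degree_def)
  finally show ?thesis by (simp add: field_simps)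
qed

end

section \<open>The expected number of loose edges\<close>

lemma measure_PiM_component:
  assumes "\<And>i. i \<in> I \<Longrightarrow> prob_space (M i)" "i \<in> I" "B \<in> sets (M i)"
  shows "measure (PiM I M) {x \<in> space (PiM I M). x i \<in> B} = measure (M i) B"
proof -
  have "measure (M i) B = measure (distr (PiM I M) (M i) (\<lambda>x. x i)) B"
    using assms by (simp add: distr_PiM_component)
  also have "\<dots> = measure (PiM I M) ((\<lambda>x. x i) -` B \<inter> space (PiM I M))"
    using assms by (intro measure_distr) auto
  also have "(\<lambda>x. x i) -` B \<inter> space (PiM I M) = {x \<in> space (PiM I M). x i \<in> B}" by auto
  finally show ?thesis ..
qed

lemma prob_finite_union_le:
  assumes "prob_space M" "finite I" "\<And>i. i \<in> I \<Longrightarrow> A i \<in> sets M" "\<And>i. i \<in> I \<Longrightarrow> measure M (A i) \<le> p"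
    "B \<subseteq> (\<Union>i\<in>I. A i)"
  shows "measure M B \<le> real (card I) * p"
proof -
  interpret prob_space M by fact
  have "measure M B \<le> measure M (\<Union>i\<in>I. A i)"
    using assms by (intro finite_measure_mono) auto
  also have "\<dots> \<le> (\<Sum>i\<in>I. measure M (A i))"
    using assms by (intro measure_UNION_le) auto
  also have "\<dots> \<le> real (card I) * p"
    using assms by (intro sum_bounded_above) auto
  finally show ?thesis .
qed

lemma sum_times_singleton: "(\<Sum>p\<in>A \<times> {s}. g p) = (\<Sum>w\<in>A. g (w, s))"
proof -
  have "A \<times> {s} = (\<lambda>w. (w, s)) ` A" by auto
  then show ?thesis by (simp add: sum.reindex inj_on_def)
qed

lemma prob_space_measure_mono:
  "prob_space M \<Longrightarrow> A \<subseteq> B \<Longrightarrow> B \<in> sets M \<Longrightarrow> measure M A \<le> measure M B"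
  by (simp add: finite_measure.finite_measure_mono prob_space.finite_measure)

context lp_graph
begin

section \<open>The probability space of the algorithm and measurability\<close>

abbreviation "N \<equiv> num_parts V E"
abbreviation "T \<equiv> num_iters V E"
abbreviation "part_space \<equiv> \<Pi>\<^sub>M v\<in>V. measure_pmf (pmf_of_set {1..N})"
abbreviation "threshold_space \<equiv> \<Pi>\<^sub>M p\<in>V \<times> {1..T}. uniform_dist (0.2 * b (fst p)) (0.4 * b (fst p))"

abbreviation "\<Omega> \<equiv> one_round_space V E b"
abbreviation "iteration_space s \<equiv> \<Pi>\<^sub>M p\<in>V \<times> {s}. uniform_dist (0.2 * b (fst p)) (0.4 * b (fst p))"
abbreviation "insert_iteration s \<xi> y \<equiv> merge (V \<times> ({1..T} - {s})) (V \<times> {s}) (\<xi>, y)"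

sublocale parts: product_prob_space "\<lambda>_. measure_pmf (pmf_of_set {1..N})" V
  by (rule product_prob_space_pmf)

sublocale thresholds: product_prob_space "\<lambda>p. uniform_dist (0.2 * b (fst p)) (0.4 * b (fst p))" "V \<times> {1..T}"
  by (rule product_prob_space_uniform_dist)

lemma prob_space_part_space: "prob_space part_space"
  by (intro prob_space_PiM prob_space_measure_pmf)

lemma prob_space_threshold_space: "prob_space threshold_space"
  by (intro prob_space_PiM prob_space_uniform_dist)

lemma one_round_space_eq: "\<Omega> = part_space \<Otimes>\<^sub>M threshold_space"
  by (simp add: one_round_space_def)

lemma prob_space_one_round: "prob_space (\<Omega>)"
proof -
  interpret pair_prob_space part_space threshold_space
    by (intro pair_prob_space.intro pair_sigma_finite.intro prob_space_imp_sigma_finite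
        prob_space_part_space prob_space_threshold_space)
  show ?thesis unfolding one_round_space_eq by (rule prob_space_axioms)
qed

lemma measurable_threshold [measurable]:
  "v \<in> V \<Longrightarrow> 1 \<le> t \<Longrightarrow> t \<le> T \<Longrightarrow> (\<lambda>\<omega>. snd \<omega> (v, t)) \<in> borel_measurable (\<Omega>)"
proof -
  assume "v \<in> V" "1 \<le> t" "t \<le> T"
  then have "(\<lambda>\<theta>. \<theta> (v, t)) \<in> measurable threshold_space
      (uniform_dist (0.2 * b (fst (v, t))) (0.4 * b (fst (v, t))))"
    by (intro measurable_component_singleton) auto
  then show ?thesis unfolding one_round_space_eq
    by (intro measurable_compose[OF measurable_snd]) (simp cong: measurable_cong_sets)
qed

lemma measurable_part [measurable]:
  "v \<in> V \<Longrightarrow> (\<lambda>\<omega>. fst \<omega> v) \<in> measurable (\<Omega>) (count_space UNIV)"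
proof -
  assume v: "v \<in> V"
  have "(\<lambda>i. i v) \<in> measurable part_space (measure_pmf (pmf_of_set {1..N}))"
    by (rule measurable_component_singleton[OF v])
  then show ?thesis unfolding one_round_space_eq
    by (intro measurable_compose[OF measurable_fst]) (simp cong: measurable_cong_sets)
qed

text \<open>Covers both processes: the estimator may itself be random, because the partition is part
  of the outcome.\<close>

lemma measurable_process:
  assumes \<theta>: "\<And>v t. v \<in> V \<Longrightarrow> 1 \<le> t \<Longrightarrow> t \<le> T \<Longrightarrow> (\<lambda>\<omega>. \<theta> \<omega> (v, t)) \<in> borel_measurable M"
    and est: "\<And>X v. (\<And>e. (\<lambda>\<omega>. X \<omega> e) \<in> borel_measurable M) \<Longrightarrow> v \<in> V \<Longrightarrow>
        (\<lambda>\<omega>. est \<omega> (X \<omega>) v) \<in> borel_measurable M"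
    and t: "t \<le> T"
  shows "(\<forall>v. Measurable.pred M (\<lambda>\<omega>. v \<in> act (est \<omega>) (\<theta> \<omega>) t)) \<and>
    (\<forall>e. (\<lambda>\<omega>. xval (est \<omega>) (\<theta> \<omega>) t e) \<in> borel_measurable M)"
  using t
proof (induction t)
  case (Suc t)
  then have [measurable]: "\<And>v. Measurable.pred M (\<lambda>\<omega>. v \<in> act (est \<omega>) (\<theta> \<omega>) t)"
    "\<And>e. (\<lambda>\<omega>. xval (est \<omega>) (\<theta> \<omega>) t e) \<in> borel_measurable M" by auto
  have act [measurable]: "Measurable.pred M (\<lambda>\<omega>. v \<in> act (est \<omega>) (\<theta> \<omega>) (Suc t))" for v
  proof (cases "v \<in> V")
    case True
    have [measurable]: "(\<lambda>\<omega>. est \<omega> (xval (est \<omega>) (\<theta> \<omega>) t) v) \<in> borel_measurable M"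
      using True by (intro est) auto
    have [measurable]: "(\<lambda>\<omega>. \<theta> \<omega> (v, Suc t)) \<in> borel_measurable M"
      using True Suc.prems by (intro \<theta>) auto
    show ?thesis unfolding act_Suc by simp measurable
  next
    case False
    then have "v \<notin> act (est \<omega>) (\<theta> \<omega>) (Suc t)" for \<omega>
      using act_subset by blast
    then show ?thesis by simp
  qed
  have [measurable]: "Measurable.pred M (\<lambda>\<omega>. e \<in> E \<and> e \<subseteq> act (est \<omega>) (\<theta> \<omega>) (Suc t))" for e
  proof (cases "e \<in> E")
    case True
    then have "finite e" by (rule finite_edge)
    then have "Measurable.pred M (\<lambda>\<omega>. \<forall>v\<in>e. v \<in> act (est \<omega>) (\<theta> \<omega>) (Suc t))"
      by (intro pred_intros_finite) auto
    then show ?thesis by (simp add: subset_eq True)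
  qed simp
  have "(\<lambda>\<omega>. xval (est \<omega>) (\<theta> \<omega>) (Suc t) e) \<in> borel_measurable M" for e
    unfolding xval_Suc conj_assoc[symmetric] by measurable
  with act show ?case by auto
qed auto

lemma y_est_eq: "y_est V E i x v =
  (\<Sum>e\<in>incident E v. (real N * of_bool (\<forall>w\<in>e. i w = i v)) * x e)"
proof -
  have "(\<Sum>e\<in>incident E v. (real N * of_bool (\<forall>w\<in>e. i w = i v)) * x e)
      = (\<Sum>e\<in>E_local E i v. real N * x e)"
    by (intro sum.mono_neutral_cong_right) (auto simp: E_local_def)
  then show ?thesis by (simp add: y_est_def sum_distrib_left)
qed

lemma measurable_ideal [measurable]:
  assumes "t \<le> T"
  shows "(\<lambda>\<omega>. ideal_x (snd \<omega>) t e) \<in> borel_measurable (\<Omega>)"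
proof -
  have "(\<forall>v. Measurable.pred (\<Omega>) (\<lambda>\<omega>. v \<in> act load (snd \<omega>) t)) \<and>
    (\<forall>e. (\<lambda>\<omega>. xval load (snd \<omega>) t e) \<in> borel_measurable (\<Omega>))"
    using assms by (intro measurable_process) (auto simp: load_def)
  then show ?thesis by auto
qed

lemma measurable_same_part [measurable]:
  assumes "e \<in> incident E v"
  shows "Measurable.pred (\<Omega>) (\<lambda>\<omega>. \<forall>w\<in>e. fst \<omega> w = fst \<omega> v)"
proof -
  have e: "finite e" "e \<subseteq> V" "v \<in> V"
    using incidentD[OF assms] finite_edge edge_subset by auto
  have "Measurable.pred (\<Omega>) (\<lambda>\<omega>. fst \<omega> w = fst \<omega> v)" if "w \<in> e" for w
  proof -
    have "w \<in> V" using that e by auto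
    then have "Measurable.pred (\<Omega>) (\<lambda>\<omega>. \<exists>k. fst \<omega> w = k \<and> fst \<omega> v = k)"
      using e(3) by (intro pred_intros_countable pred_intros_logic pred_count_space_const1 measurable_part)
    then show ?thesis by (simp add: eq_commute)
  qed
  with e show ?thesis by (intro pred_intros_finite) auto
qed

lemma measurable_actual [measurable]:
  assumes "t \<le> T"
  shows "(\<lambda>\<omega>. xval (y_est V E (fst \<omega>)) (snd \<omega>) t e) \<in> borel_measurable (\<Omega>)"
proof -
  have "(\<forall>v. Measurable.pred (\<Omega>) (\<lambda>\<omega>. v \<in> act (y_est V E (fst \<omega>)) (snd \<omega>) t)) \<and>
    (\<forall>e. (\<lambda>\<omega>. xval (y_est V E (fst \<omega>)) (snd \<omega>) t e) \<in> borel_measurable (\<Omega>))"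
  proof (rule measurable_process[OF _ _ assms])
    fix X :: "outcome \<Rightarrow> nat set \<Rightarrow> real" and v
    assume X [measurable]: "\<And>e. (\<lambda>\<omega>. X \<omega> e) \<in> borel_measurable (\<Omega>)" and "v \<in> V"
    show "(\<lambda>\<omega>. y_est V E (fst \<omega>) (X \<omega>) v) \<in> borel_measurable (\<Omega>)"
      unfolding y_est_eq by measurable
  qed auto
  then show ?thesis by auto
qed

lemma measurable_load:
  "(\<And>e. e \<in> incident E v \<Longrightarrow> (\<lambda>\<omega>. X \<omega> e) \<in> borel_measurable M) \<Longrightarrow> (\<lambda>\<omega>. load (X \<omega>) v) \<in> borel_measurable M"
  unfolding load_def by (rule borel_measurable_sum[of _ "\<lambda>e \<omega>. X \<omega> e"])

lemma measurable_near [measurable]: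
  assumes "v \<in> V" "1 \<le> t" "t \<le> T"
  shows "Measurable.pred (\<Omega>) (\<lambda>\<omega>. near \<epsilon> (snd \<omega>) v t)"
proof -
  have [measurable]: "(\<lambda>\<omega>. load (ideal_x (snd \<omega>) (t - 1)) v) \<in> borel_measurable (\<Omega>)"
    using assms by (intro measurable_load measurable_ideal) auto
  note [measurable] = measurable_threshold[OF assms]
  show ?thesis unfolding near_def by measurable
qed

lemma measurable_clean [measurable]:
  assumes "v \<in> V" "t \<le> T"
  shows "Measurable.pred (\<Omega>) (\<lambda>\<omega>. clean \<epsilon> (snd \<omega>) v t)"
  unfolding clean_def using assms by (intro pred_intros_finite pred_intros_logic measurable_near) auto

lemma measurable_one_round_mpc [measurable]:
  assumes "e \<in> E"
  shows "(\<lambda>\<omega>. one_round_mpc V E b r \<omega> e) \<in> borel_measurable (\<Omega>)"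
proof -
  have eq: "one_round_mpc V E b r \<omega> e = (if \<forall>u\<in>e. load (xval (y_est V E (fst \<omega>)) (snd \<omega>) T) u \<le> b u
      then xval (y_est V E (fst \<omega>)) (snd \<omega>) T e else 0)" for \<omega>
    by (simp add: one_round_mpc_def xval_def load_def one_round_state_eq_process Let_def)
  have [measurable]: "(\<lambda>\<omega>. load (xval (y_est V E (fst \<omega>)) (snd \<omega>) T) u) \<in> borel_measurable (\<Omega>)" for u
    by (intro measurable_load measurable_actual) auto
  have [measurable]: "Measurable.pred (\<Omega>)
      (\<lambda>\<omega>. \<forall>u\<in>e. load (xval (y_est V E (fst \<omega>)) (snd \<omega>) T) u \<le> b u)"
    using finite_edge[OF assms] by (intro pred_intros_finite) auto
  show ?thesis unfolding eq by measurable
qed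

lemma card_E_loose_eq: "real (card (E_loose V E b r x \<alpha>)) =
    (\<Sum>e\<in>E. of_bool (x e < \<alpha> * r e \<and> (\<forall>v\<in>e. load x v < \<alpha> * b v)))"
proof -
  have "E_loose V E b r x \<alpha> = {e \<in> E. x e < \<alpha> * r e \<and> (\<forall>v\<in>e. load x v < \<alpha> * b v)}"
    using edge_subset by (auto simp: E_loose_def V_loose_def load_def)
  then show ?thesis by (simp add: sum.If_cases of_bool_def Int_def)
qed

lemma measurable_card_loose [measurable]:
  "(\<lambda>\<omega>. real (card (E_loose V E b r (one_round_mpc V E b r \<omega>) \<alpha>))) \<in> borel_measurable (\<Omega>)"
proof -
  have "(\<lambda>\<omega>. of_bool (one_round_mpc V E b r \<omega> e < \<alpha> * r e \<and>
      (\<forall>v\<in>e. load (one_round_mpc V E b r \<omega>) v < \<alpha> * b v)) :: real) \<in> borel_measurable (\<Omega>)"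
    if e: "e \<in> E" for e
  proof -
    note [measurable] = measurable_one_round_mpc[OF e]
    have [measurable]: "(\<lambda>\<omega>. load (one_round_mpc V E b r \<omega>) v) \<in> borel_measurable (\<Omega>)" for v
      by (intro measurable_load measurable_one_round_mpc) (auto dest: incidentD)
    have [measurable]: "Measurable.pred (\<Omega>)
        (\<lambda>\<omega>. \<forall>v\<in>e. load (one_round_mpc V E b r \<omega>) v < \<alpha> * b v)"
      using finite_edge[OF e] by (intro pred_intros_finite) auto
    show ?thesis by measurable
  qed
  then show ?thesis unfolding card_E_loose_eq by (intro borel_measurable_sum)
qed

lemma card_loose_le_card: "card (E_loose V E b r x \<alpha>) \<le> card E"
  by (intro card_mono) (auto simp: E_loose_def)

lemma integrable_loose: "integrable (\<Omega>)
  (\<lambda>\<omega>. real (card (E_loose V E b r (one_round_mpc V E b r \<omega>) \<alpha>)) / real (card V))"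
proof -
  interpret prob_space "\<Omega>" by (rule prob_space_one_round)
  show ?thesis
    using card_loose_le_card
    by (intro integrable_const_bound[where B = "real (card E) / real (card V)"] AE_I2)
       (auto intro!: divide_right_mono)
qed

subsection \<open>Probabilities of the exceptional events\<close>

lemma prob_iteration_le:
  assumes s: "s \<in> {1..T}" and A: "A \<in> sets threshold_space"
    and le: "\<And>\<xi>. \<xi> \<in> space (PiM (V \<times> ({1..T} - {s})) (\<lambda>p. uniform_dist (0.2 * b (fst p)) (0.4 * b (fst p)))) \<Longrightarrow>
      measure (iteration_space s)
        {y \<in> space (iteration_space s).
          insert_iteration s \<xi> y \<in> A} \<le> p" and p: "0 \<le> p"
  shows "measure threshold_space A \<le> p"
proof -
  interpret R: product_prob_space "\<lambda>p. uniform_dist (0.2 * b (fst p)) (0.4 * b (fst p))" "V \<times> ({1..T} - {s})"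
    by (rule product_prob_space_uniform_dist)
  have "V \<times> ({1..T} - {s}) \<union> V \<times> {s} = V \<times> {1..T}" using s by auto
  then show ?thesis
    using R.prob_PiM_le_sections[of "V \<times> {s}" A p] A le p by auto
qed

lemma ideal_merge:
  assumes "s \<in> {1..T}"
  shows "ideal_x (insert_iteration s \<xi> y) (s - 1) = ideal_x \<xi> (s - 1)"
  using assms by (intro process_cong[THEN conjunct2]) (auto simp: merge_def)

text \<open>With the other iterations fixed, the ideal load is a constant. So nearness of w says
  that the single coordinate (w, s) hits a fixed interval, and distinct vertices give independent
  events.\<close>

lemma near_merge:
  assumes "s \<in> {1..T}" "w \<in> V"
  shows "near \<epsilon> (insert_iteration s \<xi> y) w s \<longleftrightarrow>
    y (w, s) \<in> {load (ideal_x \<xi> (s - 1)) w - \<epsilon> * 128 ^ (s - 1) * b w..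
      load (ideal_x \<xi> (s - 1)) w + \<epsilon> * 128 ^ (s - 1) * b w}"
proof -
  have "insert_iteration s \<xi> y (w, s) = y (w, s)"
    using assms by (auto simp: merge_def)
  then show ?thesis unfolding near_def ideal_merge[OF assms(1)] by (auto simp: abs_le_iff)
qed

text \<open>The interval has length 2 \<eta> b, the range of the threshold has length 0.2 b.\<close>

lemma prob_interval_le:
  assumes "0 < b w" "0 \<le> \<eta>"
  shows "measure (uniform_dist (0.2 * b w) (0.4 * b w)) {c - \<eta> * b w..c + \<eta> * b w} \<le> 10 * \<eta>"
proof -
  have "measure (uniform_dist (0.2 * b w) (0.4 * b w)) {c - \<eta> * b w..c + \<eta> * b w}
      \<le> ((c + \<eta> * b w) - (c - \<eta> * b w)) / (0.4 * b w - 0.2 * b w)"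
    using assms by (intro measure_uniform_dist_le) auto
  also have "\<dots> = 10 * \<eta>" using assms by (simp add: field_simps)
  finally show ?thesis .
qed

lemma sets_threshold_section:
  assumes "A \<in> sets (\<Omega>)"
  shows "Pair i -` A \<in> sets threshold_space"
  using assms unfolding one_round_space_eq by (rule sets_Pair1)

lemma prob_threshold_event_le:
  assumes A: "A \<in> sets (\<Omega>)"
    and le: "\<And>i. i \<in> space part_space \<Longrightarrow> measure threshold_space (Pair i -` A) \<le> p" and p: "0 \<le> p"
  shows "measure (\<Omega>) A \<le> p"
  using A le p prob_space_part_space prob_space_threshold_space
  unfolding one_round_space_eq by (intro prob_pair_le_sections) auto

lemma prob_near_le:
  assumes v: "v \<in> V" "0 < b v" and s: "s \<in> {1..T}" and \<epsilon>: "0 \<le> \<epsilon>"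
  shows "measure (\<Omega>) {\<omega> \<in> space (\<Omega>). near \<epsilon> (snd \<omega>) v s}
    \<le> 10 * (\<epsilon> * 128 ^ (s - 1))" (is "measure _ ?A \<le> ?p")
proof (rule prob_threshold_event_le)
  show A: "?A \<in> sets (\<Omega>)"
    using v s by (intro predE measurable_near) auto
  show "0 \<le> ?p" using \<epsilon> by simp
  fix i assume i: "i \<in> space part_space"
  show "measure threshold_space (Pair i -` ?A) \<le> ?p"
  proof (rule prob_iteration_le[OF s sets_threshold_section[OF A] _ \<open>0 \<le> ?p\<close>])
    fix \<xi>
    let ?J = "iteration_space s"
    let ?c = "load (ideal_x \<xi> (s - 1)) v"
    interpret J: prob_space ?J by (intro prob_space_PiM prob_space_uniform_dist)
    have "measure ?J {y \<in> space ?J. insert_iteration s \<xi> y \<in> Pair i -` ?A}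
        \<le> measure ?J {y \<in> space ?J. y (v, s) \<in> {?c - \<epsilon> * 128 ^ (s - 1) * b v..?c + \<epsilon> * 128 ^ (s - 1) * b v}}"
      unfolding near_merge[OF s v(1), symmetric]
    proof (rule J.finite_measure_mono)
      show "{y \<in> space ?J. near \<epsilon> (insert_iteration s \<xi> y) v s} \<in> J.events"
        unfolding near_merge[OF s v(1)] using v(1)
        by (intro sets_Collect_single) auto
    qed auto
    also have "\<dots> = measure (uniform_dist (0.2 * b (fst (v, s))) (0.4 * b (fst (v, s))))
        {?c - \<epsilon> * 128 ^ (s - 1) * b v..?c + \<epsilon> * 128 ^ (s - 1) * b v}"
      using v by (intro measure_PiM_component prob_space_uniform_dist) auto
    also have "\<dots> \<le> ?p"
      using prob_interval_le[OF v(2)] \<epsilon> by simp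
    finally show "measure ?J {y \<in> space ?J. insert_iteration s \<xi> y \<in> Pair i -` ?A} \<le> ?p" .
  qed
qed

lemma sum_powers_128: "10 * (\<Sum>s\<in>{1..t}. 128 ^ (s - 1)) \<le> (128::real) ^ t"
proof (induction t)
  case (Suc t)
  have "(0::real) \<le> 128 ^ t" by simp
  with Suc have "10 * (\<Sum>s\<in>{1..t}. 128 ^ (s - 1)) + 10 * 128 ^ t \<le> 128 * (128::real) ^ t"
    by linarith
  then show ?case by simp
qed simp

lemma prob_unclean_le:
  assumes v: "v \<in> V" "0 < b v" and \<epsilon>: "0 \<le> \<epsilon>"
  shows "measure (\<Omega>) {\<omega> \<in> space (\<Omega>). \<not> clean \<epsilon> (snd \<omega>) v T}
    \<le> \<epsilon> * 128 ^ T"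
proof -
  interpret prob_space "\<Omega>" by (rule prob_space_one_round)
  let ?A = "\<lambda>s. {\<omega> \<in> space (\<Omega>). near \<epsilon> (snd \<omega>) v s}"
  have meas: "?A s \<in> events" if "s \<in> {1..T}" for s
    using v that by (intro predE measurable_near) auto
  have "{\<omega> \<in> space (\<Omega>). \<not> clean \<epsilon> (snd \<omega>) v T} = (\<Union>s\<in>{1..T}. ?A s)"
    by (auto simp: clean_def)
  moreover have "prob (\<Union>s\<in>{1..T}. ?A s) \<le> (\<Sum>s\<in>{1..T}. prob (?A s))"
    using meas by (intro measure_UNION_le) auto
  ultimately have "prob {\<omega> \<in> space (\<Omega>). \<not> clean \<epsilon> (snd \<omega>) v T} \<le> (\<Sum>s\<in>{1..T}. prob (?A s))"
    by (simp only:)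
  also have "\<dots> \<le> (\<Sum>s\<in>{1..T}. 10 * (\<epsilon> * 128 ^ (s - 1)))"
    using v \<epsilon> by (intro sum_mono prob_near_le) auto
  also have "\<dots> = \<epsilon> * (10 * (\<Sum>s\<in>{1..T}. 128 ^ (s - 1)))"
    by (simp add: sum_distrib_left mult_ac)
  also have "\<dots> \<le> \<epsilon> * 128 ^ T"
    using \<epsilon> by (intro mult_left_mono sum_powers_128)
  finally show ?thesis .
qed

lemma measurable_few_near [measurable]:
  assumes k: "\<And>u e. u \<in> V \<Longrightarrow> e \<in> incident E u \<Longrightarrow> (\<lambda>\<omega>. k (fst \<omega>) u e) \<in> borel_measurable (\<Omega>)"
    and us: "u \<in> V" "s \<in> {1..T}"
  shows "Measurable.pred (\<Omega>) (\<lambda>\<omega>.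
     (\<Sum>e\<in>incident E u. k (fst \<omega>) u e * ideal_x (snd \<omega>) (s - 1) e * of_bool (\<exists>w\<in>e - {u}. near \<epsilon> (snd \<omega>) w s))
       \<le> 40 * (\<epsilon> * 128 ^ (s - 1)) * (\<Sum>e\<in>incident E u. k (fst \<omega>) u e * ideal_x (snd \<omega>) (s - 1) e) + \<epsilon> * b u)"
proof -
  note [measurable] = k[OF us(1)]
  have [measurable]: "(\<lambda>\<omega>. ideal_x (snd \<omega>) (s - 1) e) \<in> borel_measurable (\<Omega>)" for e
    using us by (intro measurable_ideal) auto
  have [measurable]: "Measurable.pred (\<Omega>) (\<lambda>\<omega>. \<exists>w\<in>e - {u}. near \<epsilon> (snd \<omega>) w s)"
    if "e \<in> incident E u" for e
    using incidentD[OF that] finite_edge edge_subset us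
    by (intro pred_intros_finite measurable_near) auto
  show ?thesis by measurable
qed

text \<open>Given the partition and the thresholds outside iteration s, the weight of u on near
  neighbours is a sum of independent bits of probability at most 10 \<eta>. A weight is at most C =
  N * 2^T * b u / d; after division by C the Chernoff bound applies with excess L, where C * L =
  \<epsilon> * b u. A union bound over u and s follows. The bound N on \<open>k\<close> admits both
  the coefficients of the estimate and the constant 1.\<close>

lemma prob_many_near_le:
  assumes k: "\<And>u e. u \<in> V \<Longrightarrow> e \<in> incident E u \<Longrightarrow> (\<lambda>\<omega>. k (fst \<omega>) u e) \<in> borel_measurable (\<Omega>)"
    "\<And>i u e. u \<in> V \<Longrightarrow> e \<in> incident E u \<Longrightarrow> 0 \<le> k i u e"
    "\<And>i u e. u \<in> V \<Longrightarrow> e \<in> incident E u \<Longrightarrow> k i u e \<le> real N"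
    and \<epsilon>: "0 \<le> \<epsilon>" and d: "0 < avg_degree V E" and N: "0 < N"
  shows "{\<omega> \<in> space (\<Omega>). \<not> few_near (k (fst \<omega>)) \<epsilon> (snd \<omega>) T} \<in> sets (\<Omega>)"
    and "measure (\<Omega>) {\<omega> \<in> space (\<Omega>). \<not> few_near (k (fst \<omega>)) \<epsilon> (snd \<omega>) T}
      \<le> real (card V) * real T * exp (- (\<epsilon> * avg_degree V E / (real N * 2 ^ T)))"
proof -
  let ?L = "\<epsilon> * avg_degree V E / (real N * 2 ^ T)"
  let ?lhs = "\<lambda>u s i \<theta>. \<Sum>e\<in>incident E u. k i u e * ideal_x \<theta> (s - 1) e * of_bool (\<exists>w\<in>e - {u}. near \<epsilon> \<theta> w s)"
  let ?rhs = "\<lambda>u s i \<theta>. 40 * (\<epsilon> * 128 ^ (s - 1)) * (\<Sum>e\<in>incident E u. k i u e * ideal_x \<theta> (s - 1) e) + \<epsilon> * b u"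
  define A where "A = (\<lambda>(u, s). {\<omega> \<in> space (\<Omega>). \<not> ?lhs u s (fst \<omega>) (snd \<omega>) \<le> ?rhs u s (fst \<omega>) (snd \<omega>)})"
  have eq: "{\<omega> \<in> space (\<Omega>). \<not> few_near (k (fst \<omega>)) \<epsilon> (snd \<omega>) T} = (\<Union>p\<in>V \<times> {1..T}. A p)"
    unfolding few_near_def A_def by auto
  have A: "A p \<in> sets (\<Omega>)" if p: "p \<in> V \<times> {1..T}" for p
  proof -
    obtain u s where us: "p = (u, s)" "u \<in> V" "s \<in> {1..T}" using p by blast
    then show ?thesis unfolding A_def us split
      by (intro predE pred_intros_logic measurable_few_near[of k] k)
  qed
  show "{\<omega> \<in> space (\<Omega>). \<not> few_near (k (fst \<omega>)) \<epsilon> (snd \<omega>) T} \<in> sets (\<Omega>)"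
    unfolding eq by (intro sets.finite_UN A) auto
  have "measure (\<Omega>) (A p) \<le> exp (- ?L)" if p: "p \<in> V \<times> {1..T}" for p
  proof -
    obtain u s where us: "p = (u, s)" "u \<in> V" and s: "s \<in> {1..T}" using p by blast
    show ?thesis
    proof (rule prob_threshold_event_le[OF A[OF p]])
      fix i assume i: "i \<in> space part_space"
      show "measure threshold_space (Pair i -` A p) \<le> exp (- ?L)"
      proof (rule prob_iteration_le[OF s sets_threshold_section[OF A[OF p]]])
        fix \<xi>
        let ?D = "\<lambda>p. uniform_dist (0.2 * b (fst p)) (0.4 * b (fst p))"
        let ?J = "PiM (V \<times> {s}) ?D"
        interpret J: product_prob_space ?D "V \<times> {s}" by (rule product_prob_space_uniform_dist)
        have JP: "prob_space ?J" by (intro prob_space_PiM prob_space_uniform_dist)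
        define x where "x = ideal_x \<xi> (s - 1)"
        define \<eta> where "\<eta> = \<epsilon> * 128 ^ (s - 1)"
        have \<eta>: "0 \<le> \<eta>" using \<epsilon> by (simp add: \<eta>_def)
        define I where "I w = {load x w - \<eta> * b w..load x w + \<eta> * b w}" for w
        define f where "f w = (if {u, w} \<in> E then k i u {u, w} * x {u, w} else 0)" for w
        have x_nonneg: "0 \<le> x e" if "e \<in> E" for e using that by (simp add: x_def xval_nonneg)
        have x_le: "x e \<le> 2 ^ T * (b v / avg_degree V E)" if "e \<in> E" "v \<in> e" for e v
          unfolding x_def using that s d by (intro xval_le_b) auto
        have f_nonneg: "0 \<le> f w" for w
          using k(2)[OF us(2), of "{u, w}"] x_nonneg by (auto simp: f_def incident_def)
        have lhs: "?lhs u s i (insert_iteration s \<xi> y)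
            = (\<Sum>p\<in>V \<times> {s}. f (fst p) * indicator (I (fst p)) (y p))" for y
        proof -
          have "?lhs u s i (insert_iteration s \<xi> y)
            = (\<Sum>w\<in>V. if {u, w} \<in> E then k i u {u, w} * x {u, w} *
                of_bool (\<exists>w'\<in>{u, w} - {u}. near \<epsilon> (insert_iteration s \<xi> y) w' s) else 0)"
            unfolding ideal_merge[OF s] x_def[symmetric] by (rule sum_incident_neighbours[OF us(2)])
          also have "\<dots> = (\<Sum>w\<in>V. f w * indicator (I w) (y (w, s)))"
          proof (intro sum.cong refl)
            fix w assume w: "w \<in> V"
            show "(if {u, w} \<in> E then k i u {u, w} * x {u, w} *
                of_bool (\<exists>w'\<in>{u, w} - {u}. near \<epsilon> (insert_iteration s \<xi> y) w' s) else 0)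
                = f w * indicator (I w) (y (w, s))"
            proof (cases "{u, w} \<in> E")
              case True
              then have "w \<noteq> u" using card_edge by fastforce
              then have "{u, w} - {u} = {w}" by auto
              then show ?thesis using True near_merge[OF s w, of \<epsilon> \<xi> y]
                by (simp add: f_def I_def x_def \<eta>_def indicator_def)
            qed (simp add: f_def)
          qed
          also have "\<dots> = (\<Sum>p\<in>V \<times> {s}. f (fst p) * indicator (I (fst p)) (y p))"
            by (simp only: sum_times_singleton fst_conv)
          finally show ?thesis .
        qed
        have row: "(\<Sum>e\<in>incident E u. k i u e * x e) = (\<Sum>p\<in>V \<times> {s}. f (fst p))"
        proof -
          have "(\<Sum>e\<in>incident E u. k i u e * x e) = (\<Sum>w\<in>V. f w)"
            unfolding f_def by (rule sum_incident_neighbours[OF us(2)])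
          also have "\<dots> = (\<Sum>p\<in>V \<times> {s}. f (fst p))"
            by (simp only: sum_times_singleton fst_conv)
          finally show ?thesis .
        qed
        have f_le: "f w \<le> real N * 2 ^ T * b u / avg_degree V E" for w
        proof (cases "{u, w} \<in> E")
          case True
          then have "f w = k i u {u, w} * x {u, w}" by (simp add: f_def)
          also have "\<dots> \<le> real N * (2 ^ T * (b u / avg_degree V E))"
            using True k(2,3)[OF us(2), of "{u, w}"] x_le[of "{u, w}" u] x_nonneg
            by (intro mult_mono) (auto simp: incident_def)
          finally show ?thesis by simp
        qed (use d b_nonneg[OF us(2)] in \<open>auto simp: f_def\<close>)
        have mem: "40 * \<eta> * (\<Sum>p\<in>V \<times> {s}. f (fst p)) + \<epsilon> * b u
            < (\<Sum>p\<in>V \<times> {s}. f (fst p) * indicator (I (fst p)) (y p))"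
          if "(i, insert_iteration s \<xi> y) \<in> A p" for y
        proof -
          have "\<not> ?lhs u s i (insert_iteration s \<xi> y)
              \<le> ?rhs u s i (insert_iteration s \<xi> y)"
            using that unfolding us A_def split mem_Collect_eq fst_conv snd_conv by (rule conjunct2)
          then show ?thesis
            unfolding lhs unfolding ideal_merge[OF s] x_def[symmetric] unfolding row \<eta>_def[symmetric] not_le .
        qed
        show "measure ?J {y \<in> space ?J. insert_iteration s \<xi> y \<in> Pair i -` A p} \<le> exp (- ?L)"
        proof (cases "b u = 0")
          case True
          \<comment> \<open>Without capacity every value at u vanishes, and the strict inequality of
            the bad event becomes 0 < 0.\<close>
          then have "f w = 0" for w using f_le[of w] f_nonneg[of w] by simp
          then have "insert_iteration s \<xi> y \<notin> Pair i -` A p" for y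
            using mem[of y] True by auto
          then show ?thesis by simp
        next
          case False
          then have bu: "0 < b u" using b_nonneg[OF us(2)] by simp
          define C where "C = real N * 2 ^ T * b u / avg_degree V E"
          have C: "0 < C" using bu d N by (simp add: C_def)
          have L: "C * ?L = \<epsilon> * b u" using bu d N by (simp add: C_def)
          have "measure ?J {y \<in> space ?J. insert_iteration s \<xi> y \<in> Pair i -` A p}
              \<le> measure ?J {y \<in> space ?J. 4 * (10 * \<eta>) * (\<Sum>p\<in>V \<times> {s}. f (fst p) / C) + ?L
                < (\<Sum>p\<in>V \<times> {s}. f (fst p) / C * indicator (I (fst p)) (y p))}"
          proof (rule prob_space_measure_mono[OF JP])
            show "{y \<in> space ?J. insert_iteration s \<xi> y \<in> Pair i -` A p} \<subseteq>
              {y \<in> space ?J. 4 * (10 * \<eta>) * (\<Sum>p\<in>V \<times> {s}. f (fst p) / C) + ?L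
                < (\<Sum>p\<in>V \<times> {s}. f (fst p) / C * indicator (I (fst p)) (y p))}"
            proof safe
              fix y assume "(i, insert_iteration s \<xi> y) \<in> A p"
              then have "40 * \<eta> * (\<Sum>p\<in>V \<times> {s}. f (fst p)) + C * ?L
                  < (\<Sum>p\<in>V \<times> {s}. f (fst p) * indicator (I (fst p)) (y p))"
                unfolding L by (rule mem)
              also have "\<dots> = C * (\<Sum>p\<in>V \<times> {s}. f (fst p) / C * indicator (I (fst p)) (y p))"
                using C by (simp add: sum_distrib_left)
              also have "40 * \<eta> * (\<Sum>p\<in>V \<times> {s}. f (fst p)) = C * (4 * (10 * \<eta>) * (\<Sum>p\<in>V \<times> {s}. f (fst p) / C))"
                using C by (simp add: sum_divide_distrib[symmetric])
              finally have "C * (4 * (10 * \<eta>) * (\<Sum>p\<in>V \<times> {s}. f (fst p) / C) + ?L)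
                < C * (\<Sum>p\<in>V \<times> {s}. f (fst p) / C * indicator (I (fst p)) (y p))"
                by (simp only: distrib_left)
              then show "4 * (10 * \<eta>) * (\<Sum>p\<in>V \<times> {s}. f (fst p) / C) + ?L
                < (\<Sum>p\<in>V \<times> {s}. f (fst p) / C * indicator (I (fst p)) (y p))"
                using C by (simp only: mult_less_cancel_left_pos)
            qed
            have [measurable]: "I w \<in> sets borel" for w by (simp add: I_def)
            have "(\<lambda>y. f (fst q) / C * indicator (I (fst q)) (y q)) \<in> borel_measurable ?J" if "q \<in> V \<times> {s}" for q
            proof -
              have "(\<lambda>y. y q) \<in> measurable ?J (?D q)" using that by (rule measurable_component_singleton)
              then have [measurable]: "(\<lambda>y. y q) \<in> borel_measurable ?J" by (simp cong: measurable_cong_sets)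
              show ?thesis by measurable
            qed
            then have [measurable]: "(\<lambda>y. \<Sum>q\<in>V \<times> {s}. f (fst q) / C * indicator (I (fst q)) (y q)) \<in> borel_measurable ?J"
              by (rule borel_measurable_sum)
            show "{y \<in> space ?J. 4 * (10 * \<eta>) * (\<Sum>p\<in>V \<times> {s}. f (fst p) / C) + ?L
                < (\<Sum>p\<in>V \<times> {s}. f (fst p) / C * indicator (I (fst p)) (y p))} \<in> sets ?J"
              by measurable
          qed
          also have "\<dots> \<le> exp (- ?L)"
          proof (rule J.upper_tail_weighted_bits)
            fix q assume q: "q \<in> V \<times> {s}"
            show "f (fst q) / C \<le> 1" using f_le[of "fst q", folded C_def] C by simp
            assume "0 < f (fst q) / C"
            then have fpos: "0 < f (fst q)" using C by (simp add: zero_less_divide_iff)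
            then have ed: "{u, fst q} \<in> E" by (auto simp: f_def split: if_splits)
            \<comment> \<open>A neighbour of capacity 0 forces the edge value 0, so positive weight
              guarantees a proper interval of thresholds.\<close>
            have "b (fst q) \<noteq> 0"
            proof
              assume "b (fst q) = 0"
              then have "x {u, fst q} \<le> 0" using x_le[OF ed, of "fst q"] by simp
              then have "x {u, fst q} = 0" using x_nonneg[OF ed] by simp
              with fpos ed show False by (simp add: f_def)
            qed
            then have "0 < b (fst q)" using b_nonneg[of "fst q"] q by auto
            then show "measure (?D q) (I (fst q)) \<le> 10 * \<eta>"
              unfolding I_def using \<eta> by (intro prob_interval_le)
          qed (use f_nonneg C \<eta> in \<open>auto simp: I_def\<close>)
          finally show ?thesis .
        qed
      qed simp
    qed simp
  qed
  then have "measure (\<Omega>) {\<omega> \<in> space (\<Omega>). \<not> few_near (k (fst \<omega>)) \<epsilon> (snd \<omega>) T}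
      \<le> real (card (V \<times> {1..T})) * exp (- ?L)"
    unfolding eq by (intro prob_finite_union_le[OF prob_space_one_round _ A]) auto
  then show "measure (\<Omega>) {\<omega> \<in> space (\<Omega>). \<not> few_near (k (fst \<omega>)) \<epsilon> (snd \<omega>) T}
      \<le> real (card V) * real T * exp (- ?L)"
    by (simp add: card_cartesian_product)
qed

lemma prob_part_event_le:
  assumes A: "A \<in> sets (\<Omega>)"
    and le: "\<And>\<theta>. \<theta> \<in> space threshold_space \<Longrightarrow> measure part_space ((\<lambda>i. (i, \<theta>)) -` A) \<le> p" and p: "0 \<le> p"
  shows "measure (\<Omega>) A \<le> p"
  using A le p prob_space_part_space prob_space_threshold_space
  unfolding one_round_space_eq by (intro prob_pair_le_sections') auto

lemma prob_out_of_range: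
  "{\<omega> \<in> space (\<Omega>). \<not> in_range T (snd \<omega>)} \<in> sets (\<Omega>)"
  "measure (\<Omega>) {\<omega> \<in> space (\<Omega>). \<not> in_range T (snd \<omega>)} \<le> 0"
proof -
  interpret prob_space "\<Omega>" by (rule prob_space_one_round)
  define A where "A = (\<lambda>(v, t). {\<omega> \<in> space (\<Omega>). \<not> (0.2 * b v \<le> snd \<omega> (v, t) \<and> snd \<omega> (v, t) \<le> 0.4 * b v)})"
  have eq: "{\<omega> \<in> space (\<Omega>). \<not> in_range T (snd \<omega>)} = (\<Union>p\<in>V \<times> {1..T}. A p)"
    by (auto simp: in_range_def A_def)
  have A: "A p \<in> events" if p: "p \<in> V \<times> {1..T}" for p
  proof -
    obtain v t where vt: "p = (v, t)" "v \<in> V" "1 \<le> t" "t \<le> T" using p by auto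
    note [measurable] = measurable_threshold[OF vt(2-)]
    show ?thesis unfolding A_def vt split by measurable
  qed
  show "{\<omega> \<in> space (\<Omega>). \<not> in_range T (snd \<omega>)} \<in> events"
    unfolding eq by (intro sets.finite_UN A) auto
  have "prob (A p) \<le> 0" if p: "p \<in> V \<times> {1..T}" for p
  proof (rule prob_threshold_event_le[OF A[OF p]])
    fix i
    have "measure threshold_space (Pair i -` A p)
        \<le> measure threshold_space {\<theta> \<in> space threshold_space. \<theta> p \<in> - {0.2 * b (fst p)..0.4 * b (fst p)}}"
      using p by (intro prob_space_measure_mono[OF prob_space_threshold_space] sets_Collect_single)
        (auto simp: A_def one_round_space_eq space_pair_measure)
    also have "\<dots> = measure (uniform_dist (0.2 * b (fst p)) (0.4 * b (fst p))) (- {0.2 * b (fst p)..0.4 * b (fst p)})"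
      using p by (intro measure_PiM_component prob_space_uniform_dist) auto
    also have "\<dots> = 1 - measure (uniform_dist (0.2 * b (fst p)) (0.4 * b (fst p))) {0.2 * b (fst p)..0.4 * b (fst p)}"
      using prob_space.prob_compl[OF prob_space_uniform_dist, of "{0.2 * b (fst p)..0.4 * b (fst p)}"] by (simp add: Compl_eq_Diff_UNIV)
    also have "measure (uniform_dist (0.2 * b (fst p)) (0.4 * b (fst p))) {0.2 * b (fst p)..0.4 * b (fst p)} = 1"
    proof (cases "b (fst p) = 0")
      case False
      then have "0 < b (fst p)" using b_nonneg[of "fst p"] p by auto
      then show ?thesis by (simp add: uniform_dist_def measure_uniform_measure)
    qed (simp add: uniform_dist_def measure_return)
    finally show "measure threshold_space (Pair i -` A p) \<le> 0" by simp
  qed simp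
  then have "prob {\<omega> \<in> space (\<Omega>). \<not> in_range T (snd \<omega>)} \<le> real (card (V \<times> {1..T})) * 0"
    unfolding eq by (intro prob_finite_union_le[OF prob_space_one_round _ A]) auto
  then show "prob {\<omega> \<in> space (\<Omega>). \<not> in_range T (snd \<omega>)} \<le> 0" by simp
qed

lemma prob_not_a_part:
  assumes N: "0 < N"
  shows "{\<omega> \<in> space (\<Omega>). \<not> (\<forall>v\<in>V. fst \<omega> v \<in> {1..N})} \<in> sets (\<Omega>)"
  "measure (\<Omega>) {\<omega> \<in> space (\<Omega>). \<not> (\<forall>v\<in>V. fst \<omega> v \<in> {1..N})} \<le> 0"
proof -
  interpret prob_space "\<Omega>" by (rule prob_space_one_round)
  define A where "A v = {\<omega> \<in> space (\<Omega>). fst \<omega> v \<in> - {1..N}}" for v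
  have eq: "{\<omega> \<in> space (\<Omega>). \<not> (\<forall>v\<in>V. fst \<omega> v \<in> {1..N})} = (\<Union>v\<in>V. A v)"
    by (auto simp: A_def)
  have A: "A v \<in> events" if "v \<in> V" for v
    unfolding A_def by (intro predE pred_sets2[OF _ measurable_part[OF that]]) auto
  show "{\<omega> \<in> space (\<Omega>). \<not> (\<forall>v\<in>V. fst \<omega> v \<in> {1..N})} \<in> events"
    unfolding eq by (intro sets.finite_UN A) auto
  have "prob (A v) \<le> 0" if v: "v \<in> V" for v
  proof (rule prob_part_event_le[OF A[OF v]])
    fix \<theta>
    have "measure part_space ((\<lambda>i. (i, \<theta>)) -` A v)
        \<le> measure part_space {i \<in> space part_space. i v \<in> - {1..N}}"
      using v by (intro prob_space_measure_mono[OF prob_space_part_space] sets_Collect_single)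
        (auto simp: A_def one_round_space_eq space_pair_measure)
    also have "\<dots> = measure (measure_pmf (pmf_of_set {1..N})) (- {1..N})"
      using v by (intro measure_PiM_component prob_space_measure_pmf) auto
    also have "\<dots> = 0"
      using N by (subst measure_pmf_of_set) auto
    finally show "measure part_space ((\<lambda>i. (i, \<theta>)) -` A v) \<le> 0" .
  qed simp
  then have "prob {\<omega> \<in> space (\<Omega>). \<not> (\<forall>v\<in>V. fst \<omega> v \<in> {1..N})} \<le> real (card V) * 0"
    unfolding eq by (intro prob_finite_union_le[OF prob_space_one_round _ A]) auto
  then show "prob {\<omega> \<in> space (\<Omega>). \<not> (\<forall>v\<in>V. fst \<omega> v \<in> {1..N})} \<le> 0" by simp
qed

definition concentrated_at where
  "concentrated_at \<epsilon> i \<theta> \<longleftrightarrow> (\<forall>u\<in>V. \<forall>t\<le>T. \<bar>y_est V E i (ideal_x \<theta> t) u - load (ideal_x \<theta> t) u\<bar> \<le> \<epsilon> * b u)"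

text \<open>Given the thresholds, the ideal values are constants and each neighbour lies in part p
  with probability 1 / N. The part of u itself is random; a union bound over all N parts replaces
  conditioning on it. The Chernoff parameter is \<kappa> / b u, and the two conditions on \<kappa>
  are those of \<open>two_sided_tail_weighted_bits\<close> for weights up to 2^T * b u / d and a
  total of at most b u. Thresholds in range provide that total.\<close>

lemma prob_not_concentrated:
  fixes \<kappa> :: real
  assumes \<epsilon>: "0 \<le> \<epsilon>" and d: "0 < avg_degree V E" and N: "0 < N"
    and \<kappa>: "0 < \<kappa>" "\<kappa> * 2 ^ T \<le> avg_degree V E" "\<kappa>\<^sup>2 * 2 ^ T \<le> avg_degree V E * real N"
  defines "B \<equiv> {\<omega> \<in> space (\<Omega>). in_range T (snd \<omega>) \<and> (\<forall>v\<in>V. fst \<omega> v \<in> {1..N}) \<and>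
      \<not> concentrated_at \<epsilon> (fst \<omega>) (snd \<omega>)}"
  shows "B \<in> sets (\<Omega>)"
    "measure (\<Omega>) B \<le> real (card V) * real (T + 1) * real N * (2 * exp (1 - \<kappa> * \<epsilon> / real N))"
proof -
  interpret prob_space "\<Omega>" by (rule prob_space_one_round)
  \<comment> \<open>The ideal load of u from neighbours in part p; if p is the part of u, the
    estimate is N times this.\<close>
  define S where "S i \<theta> u t p = (\<Sum>w\<in>V. (if {u, w} \<in> E then ideal_x \<theta> t {u, w} else 0) * indicator {p} (i w))"
    for i :: "nat \<Rightarrow> nat" and \<theta> u t and p :: nat
  define A where "A = (\<lambda>(u, t, p). {\<omega> \<in> space (\<Omega>). in_range T (snd \<omega>) \<and>
      \<epsilon> * b u / real N < \<bar>S (fst \<omega>) (snd \<omega>) u t p - load (ideal_x (snd \<omega>) t) u / real N\<bar>})"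
  have range_meas: "Measurable.pred (\<Omega>) (\<lambda>\<omega>. in_range T (snd \<omega>))"
  proof -
    have [measurable]: "Measurable.pred (\<Omega>) (\<lambda>\<omega>. \<not> in_range T (snd \<omega>))"
      using prob_out_of_range(1) by (simp add: pred_def)
    have "Measurable.pred (\<Omega>) (\<lambda>\<omega>. \<not> \<not> in_range T (snd \<omega>))" by measurable
    then show ?thesis by simp
  qed
  have A: "A q \<in> events" if q: "q \<in> V \<times> {..T} \<times> {1..N}" for q
  proof -
    obtain u t p where utp: "q = (u, t, p)" "u \<in> V" "t \<le> T" using q by auto
    have [measurable]: "(\<lambda>\<omega>. ideal_x (snd \<omega>) t e) \<in> borel_measurable (\<Omega>)" for e
      by (rule measurable_ideal[OF utp(3)])
    have [measurable]: "(\<lambda>\<omega>. load (ideal_x (snd \<omega>) t) u) \<in> borel_measurable (\<Omega>)"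
      by (intro measurable_load) auto
    have [measurable]: "(\<lambda>\<omega>. S (fst \<omega>) (snd \<omega>) u t p) \<in> borel_measurable (\<Omega>)"
      unfolding S_def
    proof (intro borel_measurable_sum borel_measurable_times)
      fix w assume "w \<in> V"
      show "(\<lambda>\<omega>. indicator {p} (fst \<omega> w)) \<in> borel_measurable (\<Omega>)"
        by (intro measurable_compose[OF measurable_part[OF \<open>w \<in> V\<close>]]) simp
    qed measurable
    note [measurable] = range_meas
    show ?thesis unfolding A_def utp split by measurable
  qed
  have local: "y_est V E i x u = real N * (\<Sum>w\<in>V. (if {u, w} \<in> E then x {u, w} else 0) * indicator {i u} (i w))"
    if u: "u \<in> V" for u i and x :: "nat set \<Rightarrow> real"
  proof -
    have "y_est V E i x u = (\<Sum>w\<in>V. if {u, w} \<in> E then real N * of_bool (\<forall>w'\<in>{u, w}. i w' = i u) * x {u, w} else 0)"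
      unfolding y_est_eq by (rule sum_incident_neighbours[OF u])
    also have "\<dots> = (\<Sum>w\<in>V. real N * ((if {u, w} \<in> E then x {u, w} else 0) * indicator {i u} (i w)))"
      by (intro sum.cong refl) (auto simp: indicator_def)
    finally show ?thesis by (simp only: sum_distrib_left)
  qed
  have eq: "B = {\<omega> \<in> space (\<Omega>). in_range T (snd \<omega>) \<and> (\<forall>v\<in>V. fst \<omega> v \<in> {1..N}) \<and>
      (\<exists>u\<in>V. \<exists>t\<in>{..T}. \<not> \<bar>y_est V E (fst \<omega>) (ideal_x (snd \<omega>) t) u - load (ideal_x (snd \<omega>) t) u\<bar> \<le> \<epsilon> * b u)}"
    unfolding B_def concentrated_at_def by auto
  show "B \<in> events"
    unfolding eq
  proof (intro predE pred_intros_logic range_meas pred_intros_finite finite_V finite_atMost)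
    fix v assume "v \<in> V"
    show "Measurable.pred (\<Omega>) (\<lambda>\<omega>. fst \<omega> v \<in> {1..N})"
      by (intro pred_sets2[OF _ measurable_part[OF \<open>v \<in> V\<close>]]) auto
  next
    fix u t assume u: "u \<in> V" and t: "t \<in> {..T}"
    have [measurable]: "(\<lambda>\<omega>. ideal_x (snd \<omega>) t e) \<in> borel_measurable (\<Omega>)" for e
      using t by (intro measurable_ideal) simp
    have [measurable]: "(\<lambda>\<omega>. load (ideal_x (snd \<omega>) t) u) \<in> borel_measurable (\<Omega>)"
      by (intro measurable_load) auto
    have [measurable]: "(\<lambda>\<omega>. y_est V E (fst \<omega>) (ideal_x (snd \<omega>) t) u) \<in> borel_measurable (\<Omega>)"
      unfolding y_est_eq by measurable
    show "Measurable.pred (\<Omega>) (\<lambda>\<omega>.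
        \<bar>y_est V E (fst \<omega>) (ideal_x (snd \<omega>) t) u - load (ideal_x (snd \<omega>) t) u\<bar> \<le> \<epsilon> * b u)"
      by measurable
  qed
  have sub: "B \<subseteq> (\<Union>q\<in>V \<times> {..T} \<times> {1..N}. A q)"
  proof
    fix \<omega> assume "\<omega> \<in> B"
    then obtain u t where \<omega>: "\<omega> \<in> space (\<Omega>)" "in_range T (snd \<omega>)"
      and p: "\<forall>v\<in>V. fst \<omega> v \<in> {1..N}" and u: "u \<in> V" and t: "t \<le> T"
      and dev: "\<epsilon> * b u < \<bar>y_est V E (fst \<omega>) (ideal_x (snd \<omega>) t) u - load (ideal_x (snd \<omega>) t) u\<bar>"
      unfolding B_def concentrated_at_def by (auto simp: not_le)
    let ?p = "fst \<omega> u"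
    have "\<bar>y_est V E (fst \<omega>) (ideal_x (snd \<omega>) t) u - load (ideal_x (snd \<omega>) t) u\<bar>
        = real N * \<bar>S (fst \<omega>) (snd \<omega>) u t ?p - load (ideal_x (snd \<omega>) t) u / real N\<bar>"
    proof -
      have "y_est V E (fst \<omega>) (ideal_x (snd \<omega>) t) u - load (ideal_x (snd \<omega>) t) u
          = real N * (S (fst \<omega>) (snd \<omega>) u t ?p - load (ideal_x (snd \<omega>) t) u / real N)"
        unfolding local[OF u] S_def using N by (simp add: right_diff_distrib)
      then show ?thesis by (simp add: abs_mult)
    qed
    with dev have "\<epsilon> * b u / real N < \<bar>S (fst \<omega>) (snd \<omega>) u t ?p - load (ideal_x (snd \<omega>) t) u / real N\<bar>"
      using N by (simp add: field_simps)
    then have "\<omega> \<in> A (u, t, ?p)" using \<omega> by (simp add: A_def)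
    moreover have "(u, t, ?p) \<in> V \<times> {..T} \<times> {1..N}" using u t p by auto
    ultimately show "\<omega> \<in> (\<Union>q\<in>V \<times> {..T} \<times> {1..N}. A q)" by blast
  qed
  have "prob (A q) \<le> 2 * exp (1 - \<kappa> * \<epsilon> / real N)" if q: "q \<in> V \<times> {..T} \<times> {1..N}" for q
  proof (rule prob_part_event_le[OF A[OF q]])
    fix \<theta>
    obtain u t p where utp: "q = (u, t, p)" "u \<in> V" "t \<le> T" and p: "p \<in> {1..N}" using q by blast
    define c where "c w = (if {u, w} \<in> E then ideal_x \<theta> t {u, w} else 0)" for w
    have load: "load (ideal_x \<theta> t) u = (\<Sum>w\<in>V. c w)"
      unfolding c_def load_def by (rule sum_incident_neighbours[OF utp(2)])
    have c_nonneg: "0 \<le> c w" for w by (simp add: c_def xval_nonneg)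
    have c_le: "c w \<le> 2 ^ T * (b u / avg_degree V E)" for w
      using d b_nonneg[OF utp(2)] xval_le_b[OF _ _ utp(3) d, of "{u, w}" u] by (simp add: c_def)
    show "measure part_space ((\<lambda>i. (i, \<theta>)) -` A q) \<le> 2 * exp (1 - \<kappa> * \<epsilon> / real N)"
    proof (cases "in_range T \<theta> \<and> b u \<noteq> 0")
      case False
      have "(\<lambda>i. (i, \<theta>)) -` A q = {}"
      proof (cases "in_range T \<theta>")
        case True
        then have bu: "b u = 0" using False by simp
        then have "c w = 0" for w using c_le[of w] c_nonneg[of w] by simp
        then have "S i \<theta> u t p = 0" "load (ideal_x \<theta> t) u = 0" for i
          unfolding S_def load c_def[symmetric] by auto
        then show ?thesis using bu by (auto simp: A_def utp)
      qed (auto simp: A_def utp)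
      then show ?thesis by simp
    next
      case True
      then have bu: "0 < b u" using b_nonneg[OF utp(2)] by simp
      have "measure part_space ((\<lambda>i. (i, \<theta>)) -` A q) \<le> measure part_space {i \<in> space part_space.
          \<epsilon> * b u / real N < \<bar>(\<Sum>w\<in>V. c w * indicator {p} (i w)) - 1 / real N * (\<Sum>w\<in>V. c w)\<bar>}"
      proof (rule prob_space_measure_mono[OF prob_space_part_space])
        show "(\<lambda>i. (i, \<theta>)) -` A q \<subseteq> {i \<in> space part_space.
          \<epsilon> * b u / real N < \<bar>(\<Sum>w\<in>V. c w * indicator {p} (i w)) - 1 / real N * (\<Sum>w\<in>V. c w)\<bar>}"
        proof -
          have "S i \<theta> u t p = (\<Sum>w\<in>V. c w * indicator {p} (i w))" for i
            unfolding S_def c_def ..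
          then show ?thesis by (auto simp: A_def utp load one_round_space_eq space_pair_measure)
        qed
        have [measurable]: "(\<lambda>i. \<Sum>w\<in>V. c w * indicator {p} (i w)) \<in> borel_measurable part_space"
        proof (intro borel_measurable_sum borel_measurable_times)
          fix w assume "w \<in> V"
          then show "(\<lambda>i. indicator {p} (i w)) \<in> borel_measurable part_space"
            by (intro measurable_compose[OF measurable_component_singleton]) auto
        qed simp
        show "{i \<in> space part_space.
          \<epsilon> * b u / real N < \<bar>(\<Sum>w\<in>V. c w * indicator {p} (i w)) - 1 / real N * (\<Sum>w\<in>V. c w)\<bar>} \<in> sets part_space"
          by measurable
      qed
      also have "\<dots> \<le> 2 * exp (1 - (\<kappa> / b u) * (\<epsilon> * b u / real N))"
      proof (rule parts.two_sided_tail_weighted_bits)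
        show "c w \<le> 2 ^ T * (b u / avg_degree V E)" for w by (rule c_le)
        show "measure (measure_pmf (pmf_of_set {1..N})) {p} = 1 / real N"
          by (rule measure_pmf_of_interval[OF p])
        show "\<kappa> / b u * (2 ^ T * (b u / avg_degree V E)) \<le> 1"
          using \<kappa>(2) bu d by (simp add: field_simps)
        have "(\<Sum>w\<in>V. c w) \<le> b u"
          using ideal_load_le[of T \<theta> t u] True utp bu by (simp add: load)
        then have "(\<kappa> / b u)\<^sup>2 * (2 ^ T * (b u / avg_degree V E)) * (1 / real N) * (\<Sum>w\<in>V. c w)
            \<le> (\<kappa> / b u)\<^sup>2 * (2 ^ T * (b u / avg_degree V E)) * (1 / real N) * b u"
          using bu d by (intro mult_left_mono) auto
        also have "\<dots> = \<kappa>\<^sup>2 * 2 ^ T / (avg_degree V E * real N)"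
          using bu d N by (simp add: field_simps power2_eq_square)
        also have "\<dots> \<le> 1" using \<kappa>(3) d N by (simp add: field_simps)
        finally show "(\<kappa> / b u)\<^sup>2 * (2 ^ T * (b u / avg_degree V E)) * (1 / real N) * (\<Sum>w\<in>V. c w) \<le> 1" .
      qed (use c_nonneg bu \<kappa> in auto)
      also have "(\<kappa> / b u) * (\<epsilon> * b u / real N) = \<kappa> * \<epsilon> / real N" using bu by simp
      finally show ?thesis .
    qed
  qed simp
  then have "prob B \<le> real (card (V \<times> {..T} \<times> {1..N})) * (2 * exp (1 - \<kappa> * \<epsilon> / real N))"
    by (intro prob_finite_union_le[OF prob_space_one_round _ A _ sub]) auto
  then show "prob B \<le> real (card V) * real (T + 1) * real N * (2 * exp (1 - \<kappa> * \<epsilon> / real N))"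
    by (simp add: card_cartesian_product algebra_simps)
qed

text \<open>Outside the bad event B the tracked bound applies, inside B all edges are counted.
  Unclean vertices are not excluded by B: the edges at them are counted through the degrees, whose
  sum 2m gives the factor 2 before \<epsilon> * 128^T.\<close>

lemma expected_loose_le:
  fixes \<kappa> \<epsilon> :: real
  assumes m: "0 < card E" and \<epsilon>: "0 \<le> \<epsilon>" "\<epsilon> * 128 ^ T \<le> 0.05"
    and \<kappa>: "0 < \<kappa>" "\<kappa> * 2 ^ T \<le> avg_degree V E" "\<kappa>\<^sup>2 * 2 ^ T \<le> avg_degree V E * real N"
  shows "(\<integral>\<omega>. real (card (E_loose V E b r (one_round_mpc V E b r \<omega>) 0.05)) / real (card V) \<partial>\<Omega>)
    \<le> real (card E) / real (card V) * (1 / 2 ^ T + 2 * (\<epsilon> * 128 ^ T) +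
        (real (card V) * real (T + 1) * real N * (2 * exp (1 - \<kappa> * \<epsilon> / real N)) +
         2 * (real (card V) * real T * exp (- (\<epsilon> * avg_degree V E / (real N * 2 ^ T))))))"
proof -
  interpret prob_space "\<Omega>" by (rule prob_space_one_round)
  let ?M = "\<Omega>"
  have Vne: "V \<noteq> {}"
  proof -
    from m obtain e where "e \<in> E" by (metis card.empty ex_in_conv less_irrefl)
    then show ?thesis using edge_subset card_edge by fastforce
  qed
  have d: "0 < avg_degree V E" using m Vne by (simp add: avg_degree_def card_gt_0_iff)
  have N: "0 < N" using d by (simp add: num_parts_def)
  define k where "k i u e = real N * of_bool (\<forall>w\<in>e. i w = i u)" for i :: "nat \<Rightarrow> nat" and u and e :: "nat set"
  define B1 where "B1 = {\<omega> \<in> space ?M. \<not> in_range T (snd \<omega>)}"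
  define B2 where "B2 = {\<omega> \<in> space ?M. \<not> (\<forall>v\<in>V. fst \<omega> v \<in> {1..N})}"
  define B3 where "B3 = {\<omega> \<in> space ?M. in_range T (snd \<omega>) \<and> (\<forall>v\<in>V. fst \<omega> v \<in> {1..N}) \<and>
      \<not> concentrated_at \<epsilon> (fst \<omega>) (snd \<omega>)}"
  define B4 where "B4 = {\<omega> \<in> space ?M. \<not> few_near (k (fst \<omega>)) \<epsilon> (snd \<omega>) T}"
  define B5 where "B5 = {\<omega> \<in> space ?M. \<not> few_near (\<lambda>_ _. 1) \<epsilon> (snd \<omega>) T}"
  define P4 where "P4 = real (card V) * real T * exp (- (\<epsilon> * avg_degree V E / (real N * 2 ^ T)))"
  define P3 where "P3 = real (card V) * real (T + 1) * real N * (2 * exp (1 - \<kappa> * \<epsilon> / real N))"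
  have kmeas: "(\<lambda>\<omega>. k (fst \<omega>) u e) \<in> borel_measurable ?M" if "u \<in> V" "e \<in> incident E u" for u e
    unfolding k_def using measurable_same_part[OF that(2)] by measurable
  have B1: "B1 \<in> events" "prob B1 \<le> 0" unfolding B1_def by (rule prob_out_of_range)+
  have B2: "B2 \<in> events" "prob B2 \<le> 0" unfolding B2_def by (rule prob_not_a_part[OF N])+
  have B3: "B3 \<in> events" "prob B3 \<le> P3"
    unfolding B3_def P3_def by (rule prob_not_concentrated[OF \<epsilon>(1) d N \<kappa>])+
  have B4: "B4 \<in> events" "prob B4 \<le> P4"
    unfolding B4_def P4_def
    by (rule prob_many_near_le[of k]; use kmeas \<epsilon> d N in \<open>auto simp: k_def\<close>)+
  have B5: "B5 \<in> events" "prob B5 \<le> P4"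
    unfolding B5_def P4_def
    by (rule prob_many_near_le[of "\<lambda>_ _ _. 1"]; use \<epsilon> d N in auto)+
  define B where "B = B1 \<union> B2 \<union> B3 \<union> B4 \<union> B5"
  have B: "B \<in> events" using B1 B2 B3 B4 B5 by (simp add: B_def)
  have "prob B \<le> prob B1 + prob B2 + prob B3 + prob B4 + prob B5"
    unfolding B_def using B1 B2 B3 B4 B5
    by (intro order_trans[OF measure_Un_le] add_mono order_refl sets.Un)
  also have "\<dots> \<le> P3 + 2 * P4" using B1 B2 B3 B4 B5 by simp
  finally have prob_B: "prob B \<le> P3 + 2 * P4" .
  define U where "U v = {\<omega> \<in> space ?M. \<not> clean \<epsilon> (snd \<omega>) v T}" for v
  have U: "U v \<in> events" if "v \<in> V" for v
    unfolding U_def using that by (intro predE pred_intros_logic measurable_clean) auto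
  \<comment> \<open>A majorant linear in indicators, whose expectation needs only the probabilities
    of single events.\<close>
  let ?g = "\<lambda>\<omega>. (real (card E) / 2 ^ T + (\<Sum>v\<in>V. real (card (incident E v)) * (of_bool (0 < b v) * indicator (U v) \<omega>))
      + real (card E) * indicator B \<omega>) / real (card V)"
  have pointwise: "real (card (E_loose V E b r (one_round_mpc V E b r \<omega>) 0.05)) / real (card V) \<le> ?g \<omega>"
    if \<omega>: "\<omega> \<in> space ?M" for \<omega>
  proof (intro divide_right_mono)
    have U_nonneg: "0 \<le> (\<Sum>v\<in>V. real (card (incident E v)) * (of_bool (0 < b v) * indicator (U v) \<omega> :: real))"
      by (intro sum_nonneg) auto
    show "real (card (E_loose V E b r (one_round_mpc V E b r \<omega>) 0.05)) \<le>
      real (card E) / 2 ^ T + (\<Sum>v\<in>V. real (card (incident E v)) * (of_bool (0 < b v) * indicator (U v) \<omega>))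
      + real (card E) * indicator B \<omega>"
    proof (cases "\<omega> \<in> B")
      case True
      have "real (card (E_loose V E b r (one_round_mpc V E b r \<omega>) 0.05)) \<le> real (card E)"
        using card_loose_le_card by simp
      moreover have "0 \<le> real (card E) / 2 ^ T" by simp
      ultimately show ?thesis using U_nonneg unfolding indicator_simps(1)[OF True] by linarith
    next
      case False
      interpret tracked V E b r "k (fst \<omega>)" "y_est V E (fst \<omega>)" \<epsilon> "snd \<omega>" T
      proof
        show "y_est V E (fst \<omega>) x u = (\<Sum>e\<in>incident E u. k (fst \<omega>) u e * x e)" for x u
          unfolding k_def by (rule y_est_eq)
      qed (use False \<omega> \<epsilon> in \<open>auto simp: B_def B1_def B2_def B3_def B4_def B5_def k_def concentrated_at_def\<close>)
      have "out = one_round_mpc V E b r \<omega>"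
        by (simp add: fun_eq_iff out_def one_round_mpc_def Let_def load_def xval_def one_round_state_eq_process)
      then have "real (card (E_loose V E b r (one_round_mpc V E b r \<omega>) 0.05))
        \<le> real (card E) / 2 ^ T + real (card {e \<in> E. \<exists>v\<in>e. 0 < b v \<and> \<not> clean \<epsilon> (snd \<omega>) v T})"
        using card_loose_le[OF m] by simp
      also have "real (card {e \<in> E. \<exists>v\<in>e. 0 < b v \<and> \<not> clean \<epsilon> (snd \<omega>) v T})
          = (\<Sum>e\<in>E. of_bool (\<exists>v\<in>e. 0 < b v \<and> \<not> clean \<epsilon> (snd \<omega>) v T))"
        by (simp add: of_bool_def sum.If_cases Int_def)
      also have "\<dots> \<le> (\<Sum>e\<in>E. \<Sum>v\<in>e. of_bool (0 < b v) * indicator (U v) \<omega>)"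
      proof (rule sum_mono)
        fix e assume e: "e \<in> E"
        show "of_bool (\<exists>v\<in>e. 0 < b v \<and> \<not> clean \<epsilon> (snd \<omega>) v T)
            \<le> (\<Sum>v\<in>e. of_bool (0 < b v) * indicator (U v) \<omega> :: real)"
        proof (cases "\<exists>v\<in>e. 0 < b v \<and> \<not> clean \<epsilon> (snd \<omega>) v T")
          case True
          then obtain v where v: "v \<in> e" "0 < b v" "\<not> clean \<epsilon> (snd \<omega>) v T" by auto
          then have "1 = (of_bool (0 < b v) * indicator (U v) \<omega> :: real)" using \<omega> by (simp add: U_def)
          also have "\<dots> \<le> (\<Sum>v\<in>e. of_bool (0 < b v) * indicator (U v) \<omega>)"
            using v finite_edge[OF e] by (intro member_le_sum) auto
          finally show ?thesis by simp
        next
          case False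
          then have "of_bool (\<exists>v\<in>e. 0 < b v \<and> \<not> clean \<epsilon> (snd \<omega>) v T) = (0::real)" by simp
          then show ?thesis by (simp only:) (auto intro: sum_nonneg)
        qed
      qed
      also have "\<dots> = (\<Sum>v\<in>V. real (card (incident E v)) * (of_bool (0 < b v) * indicator (U v) \<omega>))"
        by (rule sum_endpoints[symmetric])
      finally show ?thesis using False by simp
    qed
  qed simp
  have int_U: "integrable ?M (indicator (U v) :: _ \<Rightarrow> real)" if "v \<in> V" for v
    using U[OF that] by (simp add: integrable_indicator_iff emeasure_eq_measure)
  have int_B: "integrable ?M (indicator B :: _ \<Rightarrow> real)"
    using B by (simp add: integrable_indicator_iff emeasure_eq_measure)
  have "(\<integral>\<omega>. real (card (E_loose V E b r (one_round_mpc V E b r \<omega>) 0.05)) / real (card V) \<partial>?M) \<le> (\<integral>\<omega>. ?g \<omega> \<partial>?M)"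
    using pointwise int_U int_B by (intro integral_mono integrable_loose) auto
  also have "\<dots> = (real (card E) / 2 ^ T + (\<Sum>v\<in>V. real (card (incident E v)) * (of_bool (0 < b v) * prob (U v)))
      + real (card E) * prob B) / real (card V)"
    using int_U int_B U B sets.sets_into_space by (simp add: prob_space Int_absorb2 inf.absorb1)
  also have "\<dots> \<le> (real (card E) / 2 ^ T + 2 * real (card E) * (\<epsilon> * 128 ^ T) + real (card E) * (P3 + 2 * P4)) / real (card V)"
  proof (intro divide_right_mono add_mono order_refl mult_left_mono prob_B)
    have "(\<Sum>v\<in>V. real (card (incident E v)) * (of_bool (0 < b v) * prob (U v)))
        \<le> (\<Sum>v\<in>V. real (card (incident E v)) * (\<epsilon> * 128 ^ T))"
    proof (intro sum_mono mult_left_mono)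
      fix v assume "v \<in> V"
      then show "of_bool (0 < b v) * prob (U v) \<le> \<epsilon> * 128 ^ T"
        using prob_unclean_le[of v \<epsilon>] \<epsilon> by (cases "0 < b v") (auto simp: U_def)
    qed simp
    also have "\<dots> = 2 * real (card E) * (\<epsilon> * 128 ^ T)"
      by (simp add: sum_distrib_right[symmetric] sum_card_incident)
    finally show "(\<Sum>v\<in>V. real (card (incident E v)) * (of_bool (0 < b v) * prob (U v))) \<le> 2 * real (card E) * (\<epsilon> * 128 ^ T)" .
  qed auto
  also have "\<dots> = real (card E) / real (card V) * (1 / 2 ^ T + 2 * (\<epsilon> * 128 ^ T) + (P3 + 2 * P4))"
    by (simp add: field_simps)
  finally show ?thesis unfolding P3_def P4_def .
qed

end

text \<open>Here x stands for N, with \<epsilon> = x^(-0.1), \<kappa> = x^1.4, 2^T <= x^0.001, 128^T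
  <= x^0.007, n <= exp (x^0.2) and d >= x^2 / 4. The first two conditions are those on \<kappa>
  (1.401 = 1.4 + 0.001 and 2.801 = 2 * 1.4 + 0.001); -0.093 = -0.1 + 0.007; the tails have \<kappa>
  \<epsilon> / N = x^0.3 and \<epsilon> d / (N 2^T) >= x^0.899 / 4. The goal x^(-0.0002) is of the
  order d^(-0.0001).\<close>

lemma loose_bound_asymptotics:
  "eventually (\<lambda>x::real. 4 * x powr 1.401 \<le> x\<^sup>2 \<and> 4 * x powr 2.801 \<le> x^3 \<and> x powr (- 0.093) \<le> 0.05 \<and>
     2 * x powr (- 0.001) + 2 * x powr (- 0.093) + (exp (x powr 0.2) * x * x * (2 * exp (1 - x powr 0.3)) +
      2 * (exp (x powr 0.2) * x * exp (- (x powr 0.899 / 4)))) \<le> x powr (- 0.0002)) at_top"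
  by (intro eventually_conj; real_asymp)

lemma nat_ceiling_sqrt_bounds:
  fixes d :: real
  assumes "1 \<le> d"
  shows "d \<le> (real (nat \<lceil>sqrt d\<rceil>))\<^sup>2" "(real (nat \<lceil>sqrt d\<rceil>))\<^sup>2 \<le> 4 * d" "1 \<le> nat \<lceil>sqrt d\<rceil>"
proof -
  let ?N = "nat \<lceil>sqrt d\<rceil>"
  have s: "1 \<le> sqrt d" using assms by simp
  have N: "real ?N = of_int \<lceil>sqrt d\<rceil>" using s by simp
  have lo: "sqrt d \<le> real ?N" unfolding N by linarith
  have hi: "real ?N \<le> 2 * sqrt d" unfolding N using s by linarith
  have "d = (sqrt d)\<^sup>2" using assms by simp
  also have "\<dots> \<le> (real ?N)\<^sup>2" using s by (intro power_mono lo) linarith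
  finally show "d \<le> (real ?N)\<^sup>2" .
  have "(real ?N)\<^sup>2 \<le> (2 * sqrt d)\<^sup>2" by (intro power_mono hi) simp
  also have "\<dots> = 4 * d" using assms by (simp add: power_mult_distrib)
  finally show "(real ?N)\<^sup>2 \<le> 4 * d" .
  show "1 \<le> ?N" using lo s by linarith
qed

lemma num_iters_bounds:
  assumes "1 \<le> num_parts V E"
  shows "2 ^ num_iters V E \<le> real (num_parts V E) powr 0.001"
    "real (num_parts V E) powr 0.001 \<le> 2 * 2 ^ num_iters V E"
    "num_iters V E + 1 \<le> num_parts V E"
proof -
  let ?X = "real (num_parts V E)"
  have X: "1 \<le> ?X" using assms by simp
  have l0: "0 \<le> log 2 ?X / 1000" using X by simp
  have T: "real (num_iters V E) = of_int \<lfloor>log 2 ?X / 1000\<rfloor>" using l0 by (simp add: num_iters_def)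
  have p: "2 powr (log 2 ?X / 1000) = ?X powr 0.001"
  proof -
    have "?X powr 0.001 = (2 powr (log 2 ?X)) powr 0.001" using X by simp
    then show ?thesis by (simp add: powr_powr)
  qed
  have "2 powr real (num_iters V E) \<le> 2 powr (log 2 ?X / 1000)" unfolding T by (intro powr_mono of_int_floor_le) simp
  then show 1: "2 ^ num_iters V E \<le> ?X powr 0.001" by (simp add: p powr_realpow)
  have "2 powr (log 2 ?X / 1000) \<le> 2 powr (1 + real (num_iters V E))" unfolding T by (intro powr_mono) linarith+
  then show "?X powr 0.001 \<le> 2 * 2 ^ num_iters V E" unfolding p by (simp add: powr_add powr_realpow)
  have "real (num_iters V E + 1) \<le> 2 ^ num_iters V E"
    by (metis of_nat_le_iff of_nat_numeral of_nat_power Suc_eq_plus1 Suc_leI less_exp)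
  also note 1
  also have "?X powr 0.001 \<le> ?X powr 1" using X by (intro powr_mono) auto
  finally show "num_iters V E + 1 \<le> num_parts V E" using X by simp
qed

lemma expected_loose_asymptotic:
  "\<exists>n0::nat. \<forall>V E b r. simple_graph V E \<longrightarrow> n0 \<le> card V \<longrightarrow>
     real (card V) * ln (real (card V)) ^ 10 \<le> real (card E) \<longrightarrow>
     (\<forall>v\<in>V. 0 \<le> b v) \<longrightarrow> (\<forall>e\<in>E. 0 \<le> r e) \<longrightarrow>
     (\<integral>\<omega>. real (card (E_loose V E b r (one_round_mpc V E b r \<omega>) 0.05)) / real (card V)
        \<partial>one_round_space V E b) \<le> (real (card E) / real (card V)) powr 0.9999"
proof -
  from loose_bound_asymptotics obtain X0 where X0: "\<And>x::real. X0 \<le> x \<Longrightarrow>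
    4 * x powr 1.401 \<le> x\<^sup>2 \<and> 4 * x powr 2.801 \<le> x^3 \<and> x powr (- 0.093) \<le> 0.05 \<and>
     2 * x powr (- 0.001) + 2 * x powr (- 0.093) + (exp (x powr 0.2) * x * x * (2 * exp (1 - x powr 0.3)) +
      2 * (exp (x powr 0.2) * x * exp (- (x powr 0.899 / 4)))) \<le> x powr (- 0.0002)"
    by (auto simp: eventually_at_top_linorder)
  have "eventually (\<lambda>n::nat. 3 \<le> n \<and> X0 \<le> ln (real n) ^ 5) at_top"
  proof (intro eventually_conj)
    show "eventually (\<lambda>n::nat. X0 \<le> ln (real n) ^ 5) at_top" by real_asymp
  qed (rule eventually_ge_at_top)
  then obtain n0 :: nat where n0: "\<And>n. n0 \<le> n \<Longrightarrow> 3 \<le> n \<and> X0 \<le> ln (real n) ^ 5"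
    by (auto simp: eventually_at_top_linorder)
  show ?thesis
  proof (intro exI[of _ n0] allI impI)
    fix V E b r
    assume graph: "simple_graph V E" and n: "n0 \<le> card V"
      and dense: "real (card V) * ln (real (card V)) ^ 10 \<le> real (card E)"
      and b: "\<forall>v\<in>V. 0 \<le> (b v :: real)" and r: "\<forall>e\<in>E. 0 \<le> (r e :: real)"
    interpret lp_graph V E b r using graph b r by unfold_locales auto
    define n m where "n = card V" and "m = card E"
    have n3: "3 \<le> real n" and X0n: "X0 \<le> ln (real n) ^ 5" using n0[OF n] by (auto simp: n_def)
    have "exp 1 \<le> real n" using n3 exp_le by linarith
    then have ln1: "1 \<le> ln (real n)" using n3 by (subst ln_ge_iff) auto
    define D where "D = real m / real n"
    have D: "ln (real n) ^ 10 \<le> D" using dense n3 by (simp add: D_def n_def m_def field_simps)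
    have D1: "1 \<le> D" using D one_le_power[OF ln1, of 10] by linarith
    have d: "avg_degree V E = 2 * D" by (simp add: avg_degree_def D_def n_def m_def)
    then have d1: "1 \<le> avg_degree V E" using D1 by simp
    define x where "x = real N"
    have x2: "avg_degree V E \<le> x\<^sup>2" "x\<^sup>2 \<le> 4 * avg_degree V E" and x1: "1 \<le> x"
      using nat_ceiling_sqrt_bounds[OF d1, folded num_parts_def] by (auto simp: x_def)
    \<comment> \<open>Density gives (ln n)^10 <= D <= N^2. Thus ln n <= N^0.2, and factors of n are
      absorbed by exp (- N^0.3).\<close>
    have lnx: "ln (real n) ^ 5 \<le> x"
    proof (rule power2_le_imp_le)
      show "(ln (real n) ^ 5)\<^sup>2 \<le> x\<^sup>2" using D D1 x2 d by (simp flip: power_mult)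
    qed (use x1 in simp)
    have "(ln (real n)) = (ln (real n) ^ 5) powr 0.2"
    proof -
      have "(ln (real n) ^ 5) powr 0.2 = (ln (real n) powr 5) powr 0.2" using ln1 by (simp add: powr_numeral)
      also have "\<dots> = ln (real n) powr (5 * 0.2)" by (rule powr_powr)
      finally show ?thesis using ln1 by simp
    qed
    also have "\<dots> \<le> x powr 0.2" using lnx ln1 by (intro powr_mono2) auto
    finally have nx: "real n \<le> exp (x powr 0.2)" using n3 by (subst ln_le_cancel_iff[symmetric]) auto
    have "X0 \<le> x" using X0n lnx by linarith
    note bounds = X0[OF this]
    have T: "2 ^ T \<le> x powr 0.001" "x powr 0.001 \<le> 2 * 2 ^ T" "real (T + 1) \<le> x"
      using num_iters_bounds[OF nat_ceiling_sqrt_bounds(3)[OF d1, folded num_parts_def]] unfolding x_def by (auto simp del: of_nat_add of_nat_Suc)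
    have T128: "128 ^ T \<le> x powr 0.007"
    proof -
      have "(128::real) ^ T = (2 ^ 7) ^ T" by simp
      also have "\<dots> = (2 ^ T) ^ 7" by (metis power_mult mult.commute)
      also have "\<dots> \<le> (x powr 0.001) ^ 7" by (intro power_mono T) auto
      also have "\<dots> = (x powr 0.001) powr real 7" using x1 by (intro powr_realpow[symmetric]) simp
      also have "\<dots> = x powr 0.007" by (simp add: powr_powr)
      finally show ?thesis .
    qed
    define \<epsilon> where "\<epsilon> = x powr (- 0.1)"
    define \<kappa> where "\<kappa> = x powr 1.4"
    have \<epsilon>128: "\<epsilon> * 128 ^ T \<le> x powr (- 0.093)"
    proof -
      have "\<epsilon> * 128 ^ T \<le> \<epsilon> * x powr 0.007" using T128 by (intro mult_left_mono) (auto simp: \<epsilon>_def)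
      also have "\<dots> = x powr (- 0.093)" by (simp add: \<epsilon>_def flip: powr_add)
      finally show ?thesis .
    qed
    have \<kappa>1: "\<kappa> * 2 ^ T \<le> avg_degree V E"
    proof -
      have "\<kappa> * 2 ^ T \<le> \<kappa> * x powr 0.001" using T by (intro mult_left_mono) (auto simp: \<kappa>_def)
      also have "\<dots> = x powr 1.401" by (simp add: \<kappa>_def flip: powr_add)
      finally show ?thesis using bounds x2 by linarith
    qed
    have \<kappa>2: "\<kappa>\<^sup>2 * 2 ^ T \<le> avg_degree V E * real N"
    proof -
      have k2: "\<kappa>\<^sup>2 = x powr 2.8" by (simp add: \<kappa>_def power2_eq_square flip: powr_add)
      have "\<kappa>\<^sup>2 * 2 ^ T \<le> \<kappa>\<^sup>2 * x powr 0.001" using T by (intro mult_left_mono) (auto simp: \<kappa>_def)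
      also have "\<dots> = x powr 2.801" by (simp add: k2 flip: powr_add)
      also have "\<dots> \<le> x^3 / 4" using bounds by linarith
      also have "\<dots> = (x\<^sup>2 / 4) * x" by (simp add: power2_eq_square power3_eq_cube)
      also have "\<dots> \<le> avg_degree V E * x" using x2 x1 by (intro mult_right_mono) auto
      finally show ?thesis by (simp add: x_def)
    qed
    have m0: "0 < card E" using D1 by (auto simp: D_def m_def intro!: Nat.gr0I)
    have "(\<integral>\<omega>. real (card (E_loose V E b r (one_round_mpc V E b r \<omega>) 0.05)) / real (card V) \<partial>one_round_space V E b)
      \<le> real (card E) / real (card V) * (1 / 2 ^ T + 2 * (\<epsilon> * 128 ^ T) +
        (real (card V) * real (T + 1) * real N * (2 * exp (1 - \<kappa> * \<epsilon> / real N)) +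
         2 * (real (card V) * real T * exp (- (\<epsilon> * avg_degree V E / (real N * 2 ^ T))))))"
      using bounds \<epsilon>128 x1 by (intro expected_loose_le[OF m0] \<kappa>1 \<kappa>2) (auto simp: \<epsilon>_def \<kappa>_def)
    also have "\<dots> \<le> D * (2 * x powr (- 0.001) + 2 * x powr (- 0.093) +
        (exp (x powr 0.2) * x * x * (2 * exp (1 - x powr 0.3)) + 2 * (exp (x powr 0.2) * x * exp (- (x powr 0.899 / 4)))))"
      unfolding D_def n_def[symmetric] m_def[symmetric] x_def[symmetric]
    proof (intro mult_left_mono add_mono mult_mono nx T)
      show "1 / 2 ^ T \<le> 2 * x powr (- 0.001)"
        using T(2) x1 by (simp add: powr_minus field_simps)
      have "\<kappa> * \<epsilon> = x powr 1.3" by (simp add: \<kappa>_def \<epsilon>_def flip: powr_add)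
      moreover have "x powr 1.3 / x = x powr 0.3" using x1 powr_diff[of x "1.3" 1] by simp
      ultimately show "exp (1 - \<kappa> * \<epsilon> / x) \<le> exp (1 - x powr 0.3)" by simp
      show "real T \<le> x" using T(3) by simp
      have "x powr 0.899 / 4 = (x powr (- 0.1) * (x\<^sup>2 / 4)) / (x * x powr 0.001)"
      proof -
        have "x powr (- 0.1) * x\<^sup>2 / (x * x powr 0.001) = x powr (- 0.1) * x powr 2 / (x powr 1 * x powr 0.001)"
          using x1 by simp
        also have "\<dots> = x powr ((- 0.1 + 2) - (1 + 0.001))" by (simp only: powr_add powr_diff)
        also have "\<dots> = x powr 0.899" by simp
        finally show ?thesis by simp
      qed
      also have "\<dots> \<le> (\<epsilon> * avg_degree V E) / (x * 2 ^ T)"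
        using x1 x2 T(1) unfolding \<epsilon>_def by (intro frac_le mult_mono mult_left_mono mult_nonneg_nonneg mult_pos_pos) auto
      finally show "exp (- (\<epsilon> * avg_degree V E / (x * 2 ^ T))) \<le> exp (- (x powr 0.899 / 4))" by simp
    qed (use x1 \<epsilon>128 in auto)
    also have "\<dots> \<le> D * x powr (- 0.0002)" using bounds D1 by (intro mult_left_mono) auto
    \<comment> \<open>N^2 is at least the average degree 2 D, which halves the exponent.\<close>
    also have "\<dots> \<le> D * D powr (- 0.0001)"
    proof (rule mult_left_mono)
      have "x powr (- 0.0002) = (x\<^sup>2) powr (- 0.0001)"
        using x1 by (simp add: power2_eq_square powr_mult flip: powr_add)
      also have "\<dots> \<le> D powr (- 0.0001)" using x2 d D1 by (intro powr_mono2') auto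
      finally show "x powr (- 0.0002) \<le> D powr (- 0.0001)" .
    qed (use D1 in simp)
    also have "\<dots> = D powr 0.9999" using D1 powr_add[of D 1 "- 0.0001"] by simp
    finally show "(\<integral>\<omega>. real (card (E_loose V E b r (one_round_mpc V E b r \<omega>) 0.05)) / real (card V) \<partial>one_round_space V E b)
      \<le> (real (card E) / real (card V)) powr 0.9999" by (simp add: D_def n_def m_def)
  qed
qed

section \<open>Record machines\<close>

subsection \<open>Functions computed by algebraic decision trees\<close>

type_synonym rcd = "nat list \<times> real"

text \<open>The discrete key comes first and one real ends the record. The real acts as a
  terminator: the shape of the memory determines where records begin and what their keys
  are.\<close>

definition enc :: "rcd \<Rightarrow> word list" where
  "enc p = map IntW (fst p) @ [RealW (snd p)]"

definition encs :: "rcd list \<Rightarrow> word list" where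
  "encs rs = concat (map enc rs)"

lemma encs_simps [simp]: "encs [] = []" "encs (p # rs) = enc p @ encs rs" "encs (rs @ rs') = encs rs @ encs rs'"
  by (simp_all add: encs_def)

lemma encs_concat: "encs (concat rss) = concat (map encs rss)"
  by (induction rss) auto

lemma encs_map_Pair_Nil: "encs (map (\<lambda>k. ([], f k)) ks) = map (\<lambda>k. RealW (f k)) ks"
  by (induction ks) (auto simp: enc_def)

text \<open>A key contains no real, so the entries \<open>None\<close> of the shape delimit the
  records and the keys can be decoded uniquely.\<close>

lemma shape_encs_inj: "shape (encs rs) = shape (encs rs') \<Longrightarrow> map fst rs = map fst rs'"
proof (induction rs arbitrary: rs')
  case Nil
  then show ?case by (cases rs') (auto simp: shape_def enc_def)
next
  case (Cons p rs)
  obtain p' rs'' where rs': "rs' = p' # rs''"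
    using Cons.prems by (cases rs') (auto simp: shape_def enc_def)
  have split: "map Some ks @ None # xs = map Some ks' @ None # xs' \<Longrightarrow> ks = ks' \<and> xs = xs'"
    for ks ks' :: "nat list" and xs xs'
  proof (induction ks arbitrary: ks')
    case (Cons k ks)
    then show ?case by (cases ks') auto
  qed (case_tac ks', auto)
  have "shape (encs (q # qs)) = map Some (fst q) @ None # shape (encs qs)" for q qs
    by (simp add: shape_def enc_def)
  with Cons.prems rs' have "map Some (fst p) @ None # shape (encs rs) = map Some (fst p') @ None # shape (encs rs'')"
    by metis
  with split have "fst p = fst p'" "shape (encs rs) = shape (encs rs'')" by blast+
  with Cons.IH rs' show ?case by auto
qed

text \<open>Leaves carry arbitrary data rather than messages, which lets trees be composed by
  grafting. They are turned into \<open>Emit\<close> only at the end.\<close>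

datatype 'a dtree = Leaf 'a | Node aexp aexp "'a dtree" "'a dtree"

primrec evalt :: "(nat \<Rightarrow> real) \<Rightarrow> 'a dtree \<Rightarrow> 'a" where
  "evalt s (Leaf a) = a"
| "evalt s (Node a a' l r) = (if aval s a \<le> aval s a' then evalt s l else evalt s r)"

primrec bindt :: "'a dtree \<Rightarrow> ('a \<Rightarrow> 'b dtree) \<Rightarrow> 'b dtree" where
  "bindt (Leaf a) f = f a"
| "bindt (Node a a' l r) f = Node a a' (bindt l f) (bindt r f)"

lemma evalt_bindt [simp]: "evalt s (bindt t f) = evalt s (f (evalt s t))"
  by (induction t) auto

text \<open>The keys \<open>ks\<close> are fixed before the tree is chosen, so the tree may depend
  on them in any way; reals are accessible through \<open>aexp\<close> and comparisons only.
  \<open>I\<close> interprets a leaf in the current registers: as a real, a truth value or a list of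
  records.\<close>

definition dt :: "((nat \<Rightarrow> real) \<Rightarrow> 'l \<Rightarrow> 'v) \<Rightarrow> nat list list \<Rightarrow> (rcd list \<Rightarrow> 'v) \<Rightarrow> bool" where
  "dt I ks f \<longleftrightarrow> (\<exists>t. \<forall>rs. map fst rs = ks \<longrightarrow>
     I (registers (encs rs)) (evalt (registers (encs rs)) t) = f rs)"

abbreviation "dreal \<equiv> dt aval"
abbreviation "dpred \<equiv> dt (\<lambda>_ (p::bool). p)"
abbreviation "drecs \<equiv> dt (\<lambda>s. map (\<lambda>(K :: nat list, a). (K, aval s a)))"

lemma dt_cong: "(\<And>rs. map fst rs = ks \<Longrightarrow> f rs = g rs) \<Longrightarrow> dt I ks f \<longleftrightarrow> dt I ks g"
  unfolding dt_def by (metis (no_types, lifting))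

lemma dt_leaf: "(\<And>s. I s a = v) \<Longrightarrow> dt I ks (\<lambda>_. v)"
  unfolding dt_def by (intro exI[of _ "Leaf a"]) simp

lemma dt_bind2:
  assumes "dt I ks f" "dt J ks g" "\<And>s a b. L s (evalt s (h a b)) = H (I s a) (J s b)"
  shows "dt L ks (\<lambda>rs. H (f rs) (g rs))"
proof -
  obtain t t' where t: "\<And>rs. map fst rs = ks \<Longrightarrow> I (registers (encs rs)) (evalt (registers (encs rs)) t) = f rs"
    and t': "\<And>rs. map fst rs = ks \<Longrightarrow> J (registers (encs rs)) (evalt (registers (encs rs)) t') = g rs"
    using assms(1,2) unfolding dt_def by metis
  show ?thesis unfolding dt_def
    by (intro exI[of _ "bindt t (\<lambda>a. bindt t' (h a))"]) (simp add: assms(3) t t')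
qed

lemma dt_map2:
  assumes "dt I ks f" "dt J ks g" "\<And>s a b. L s (h a b) = H (I s a) (J s b)"
  shows "dt L ks (\<lambda>rs. H (f rs) (g rs))"
  using assms(1,2) by (rule dt_bind2[where h = "\<lambda>a b. Leaf (h a b)"]) (simp add: assms(3))

lemma dt_map1:
  assumes "dt I ks f" "\<And>s a. L s (h a) = H (I s a)"
  shows "dt L ks (\<lambda>rs. H (f rs))"
  using dt_map2[OF assms(1) assms(1), of L "\<lambda>a _. h a" "\<lambda>a _. H a"] assms(2) by simp

lemma dt_if:
  assumes "dpred ks P" "dt I ks f" "dt I ks g"
  shows "dt I ks (\<lambda>rs. if P rs then f rs else g rs)"
proof -
  obtain t t1 t2 where t: "\<And>rs. map fst rs = ks \<Longrightarrow> evalt (registers (encs rs)) t = P rs"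
    and t1: "\<And>rs. map fst rs = ks \<Longrightarrow> I (registers (encs rs)) (evalt (registers (encs rs)) t1) = f rs"
    and t2: "\<And>rs. map fst rs = ks \<Longrightarrow> I (registers (encs rs)) (evalt (registers (encs rs)) t2) = g rs"
    using assms unfolding dt_def by metis
  show ?thesis unfolding dt_def
    by (intro exI[of _ "bindt t (\<lambda>p. if p then t1 else t2)"]) (simp add: t t1 t2)
qed

lemma dpred_const: "dpred ks (\<lambda>_. p)" by (rule dt_leaf) (rule refl)

lemma dpred_conj: "dpred ks P \<Longrightarrow> dpred ks Q \<Longrightarrow> dpred ks (\<lambda>rs. P rs \<and> Q rs)"
  by (rule dt_map2) auto

lemma dpred_not: "dpred ks P \<Longrightarrow> dpred ks (\<lambda>rs. \<not> P rs)"
  by (rule dt_map1) auto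

lemma dpred_le: "dreal ks f \<Longrightarrow> dreal ks g \<Longrightarrow> dpred ks (\<lambda>rs. f rs \<le> g rs)"
  by (rule dt_bind2[where h = "\<lambda>a b. Node a b (Leaf True) (Leaf False)"]) auto

lemma dpred_less: "dreal ks f \<Longrightarrow> dreal ks g \<Longrightarrow> dpred ks (\<lambda>rs. f rs < g rs)"
  unfolding not_le[symmetric] by (intro dpred_not dpred_le)

lemma dpred_eq: "dreal ks f \<Longrightarrow> dreal ks g \<Longrightarrow> dpred ks (\<lambda>rs. f rs = g rs)"
  unfolding eq_iff by (intro dpred_conj dpred_le)

lemma dreal_const: "c \<in> \<rat> \<Longrightarrow> dreal ks (\<lambda>_. c)"
proof -
  assume "c \<in> \<rat>"
  then obtain q where "c = of_rat q" by (rule Rats_cases)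
  then show ?thesis by (intro dt_leaf[of _ "Const q"]) simp
qed

lemma dreal_add: "dreal ks f \<Longrightarrow> dreal ks g \<Longrightarrow> dreal ks (\<lambda>rs. f rs + g rs)"
  by (rule dt_map2[where h = Add]) auto

lemma dreal_mult: "dreal ks f \<Longrightarrow> dreal ks g \<Longrightarrow> dreal ks (\<lambda>rs. f rs * g rs)"
  by (rule dt_map2[where h = Mul]) auto

lemma dreal_divide: "dreal ks f \<Longrightarrow> dreal ks g \<Longrightarrow> dreal ks (\<lambda>rs. f rs / g rs)"
  by (rule dt_map2[where h = Div]) auto

lemma dreal_min: "dreal ks f \<Longrightarrow> dreal ks g \<Longrightarrow> dreal ks (\<lambda>rs. min (f rs) (g rs))"
  unfolding min_def by (intro dt_if dpred_le)

lemma dreal_max: "dreal ks f \<Longrightarrow> dreal ks g \<Longrightarrow> dreal ks (\<lambda>rs. max (f rs) (g rs))"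
  unfolding max_def by (intro dt_if dpred_le)

lemma dreal_of_bool: "dpred ks P \<Longrightarrow> dreal ks (\<lambda>rs. of_bool (P rs))"
  unfolding of_bool_def by (intro dt_if dreal_const) auto

lemma dreal_sum: "(\<And>x. x \<in> A \<Longrightarrow> dreal ks (f x)) \<Longrightarrow> dreal ks (\<lambda>rs. \<Sum>x\<in>A. f x rs)"
proof (induction A rule: infinite_finite_induct)
  case (insert x A)
  then show ?case by (simp add: dreal_add)
qed (simp_all add: dreal_const)

lemma dreal_sum_list: "(\<And>x. x \<in> set xs \<Longrightarrow> dreal ks (f x)) \<Longrightarrow> dreal ks (\<lambda>rs. sum_list (map (\<lambda>x. f x rs) xs))"
  by (induction xs) (simp_all add: dreal_const dreal_add)

lemma drecs_append: "drecs ks f \<Longrightarrow> drecs ks g \<Longrightarrow> drecs ks (\<lambda>rs. f rs @ g rs)"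
  by (rule dt_map2[where h = "(@)"]) auto

lemma drecs_Nil: "drecs ks (\<lambda>_. [])"
  by (rule dt_leaf[of _ "[]"]) simp

lemma drecs_single: "dreal ks f \<Longrightarrow> drecs ks (\<lambda>rs. [(K, f rs)])"
  by (rule dt_map1[where h = "\<lambda>a. [(K, a)]"]) auto

lemma drecs_concat: "(\<And>x. x \<in> set xs \<Longrightarrow> drecs ks (f x)) \<Longrightarrow> drecs ks (\<lambda>rs. concat (map (\<lambda>x. f x rs) xs))"
  by (induction xs) (simp_all add: drecs_Nil drecs_append)

lemma drecs_map:
  assumes "\<And>x. x \<in> set xs \<Longrightarrow> dreal ks (f x)"
  shows "drecs ks (\<lambda>rs. map (\<lambda>x. (K x, f x rs)) xs)"
proof -
  have "drecs ks (\<lambda>rs. concat (map (\<lambda>x. [(K x, f x rs)]) xs))"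
    using assms by (intro drecs_concat drecs_single) auto
  moreover have "concat (map (\<lambda>x. [(K x, f x rs)]) xs) = map (\<lambda>x. (K x, f x rs)) xs" for rs
    by (induction xs) auto
  ultimately show ?thesis by simp
qed

lemma registers_append_right: "registers (ws @ ws') (length ws + k) = registers ws' k"
  by (auto simp: registers_def nth_append)

text \<open>Given the keys, the position of each real in memory is known: the lengths of the earlier
  records plus that of its own key.\<close>

lemma dreal_nth:
  assumes "k < length ks"
  shows "dreal ks (\<lambda>rs. snd (rs ! k))"
proof -
  define pos where "pos = (\<Sum>K\<leftarrow>take k ks. length K + 1) + length (ks ! k)"
  have "registers (encs rs) pos = snd (rs ! k)" if "map fst rs = ks" for rs
    using that assms unfolding pos_def
  proof (induction rs arbitrary: ks k)
    case (Cons p rs)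
    show ?case
    proof (cases k)
      case 0
      then show ?thesis using Cons.prems
        by (auto simp: enc_def registers_def nth_append)
    next
      case (Suc k')
      obtain K ks' where ks: "ks = K # ks'" "K = fst p" "map fst rs = ks'" using Cons.prems by auto
      have len: "length K + 1 = length (enc p)" using ks by (simp add: enc_def)
      have "registers (encs (p # rs)) ((\<Sum>K\<leftarrow>take k ks. length K + 1) + length (ks ! k))
          = registers (enc p @ encs rs) (length (enc p) + ((\<Sum>K\<leftarrow>take k' ks'. length K + 1) + length (ks' ! k')))"
        using len by (simp add: Suc ks add.assoc)
      also have "\<dots> = snd (rs ! k')"
        using Cons.IH[OF ks(3)] Cons.prems Suc ks by (simp add: registers_append_right)
      finally show ?thesis by (simp add: Suc)
    qed
  qed simp
  then show ?thesis unfolding dt_def by (intro exI[of _ "Leaf (Reg pos)"]) auto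
qed

text \<open>Sums all records with key K instead of looking one up. Contributions that several
  machines send under the same key are thereby added on arrival; an absent key counts as 0.\<close>

definition val :: "rcd list \<Rightarrow> nat list \<Rightarrow> real" where
  "val rs K = (\<Sum>p\<leftarrow>rs. if fst p = K then snd p else 0)"

lemma val_simps [simp]: "val [] K = 0" "val (p # rs) K = (if fst p = K then snd p else 0) + val rs K"
  "val (rs @ rs') K = val rs K + val rs' K"
  by (simp_all add: val_def)

lemma val_concat: "val (concat rss) K = (\<Sum>rs\<leftarrow>rss. val rs K)"
  by (induction rss) auto

lemma val_eq_0: "(\<And>p. p \<in> set rs \<Longrightarrow> fst p \<noteq> K) \<Longrightarrow> val rs K = 0"
  by (induction rs) auto

lemma val_map:
  assumes "distinct xs" "inj_on k (set xs)" "x \<in> set xs"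
  shows "val (map (\<lambda>x. (k x, f x)) xs) (k x) = f x"
  using assms
proof (induction xs)
  case (Cons y xs)
  show ?case
  proof (cases "x = y")
    case True
    have "val (map (\<lambda>x. (k x, f x)) xs) (k x) = 0"
      using Cons.prems True by (intro val_eq_0) (auto simp: inj_on_def)
    with True show ?thesis by simp
  next
    case False
    then have "k y \<noteq> k x" using Cons.prems by (auto simp: inj_on_def)
    with False Cons show ?thesis by auto
  qed
qed simp

lemma dreal_val: "dreal ks (\<lambda>rs. val rs K)"
proof -
  have "val rs K = (\<Sum>k<length ks. if ks ! k = K then snd (rs ! k) else 0)" if "map fst rs = ks" for rs
    using that
  proof (induction rs arbitrary: ks)
    case (Cons p rs)
    then obtain ks' where ks: "ks = fst p # ks'" "map fst rs = ks'" by auto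
    with Cons.IH[OF ks(2)] show ?case by (simp add: sum.lessThan_Suc_shift del: sum.lessThan_Suc cong: if_cong)
  qed simp
  moreover have "dreal ks (\<lambda>rs. \<Sum>k<length ks. if ks ! k = K then snd (rs ! k) else 0)"
    by (intro dreal_sum dt_if dpred_const dreal_nth dreal_const) auto
  ultimately show ?thesis by (simp cong: dt_cong)
qed

subsection \<open>Machines operating on records\<close>

definition words :: "rcd list \<Rightarrow> nat" where
  "words rs = length (encs rs)"

lemma words_simps [simp]: "words [] = 0" "words (p # rs) = length (fst p) + 1 + words rs"
  "words (rs @ rs') = words rs + words rs'"
  by (simp_all add: words_def enc_def)

lemma words_map: "(\<And>x. x \<in> set xs \<Longrightarrow> length (k x) = l) \<Longrightarrow> words (map (\<lambda>x. (k x, f x)) xs) = (l + 1) * length xs"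
  by (induction xs) auto

lemma words_concat: "words (concat rss) = (\<Sum>rs\<leftarrow>rss. words rs)"
  by (induction rss) auto

text \<open>A program serves all destinations at once, so the trees for the M destinations are
  merged into one tree with functions as leaves. The leaves then become \<open>Emit\<close>, the
  nodes \<open>IfLe\<close>.\<close>

lemma program_exists:
  assumes "\<And>j. j < M \<Longrightarrow> drecs ks (\<lambda>rs. G rs j)"
  shows "\<exists>p. \<forall>rs. map fst rs = ks \<longrightarrow> (\<forall>j<M. exec (registers (encs rs)) p j = encs (G rs j))"
proof -
  let ?I = "\<lambda>M s (f :: nat \<Rightarrow> (nat list \<times> aexp) list). \<lambda>j. if j < M then map (\<lambda>(K, a). (K, aval s a)) (f j) else []"
  have "dt (?I M) ks (\<lambda>rs j. if j < M then G rs j else [])"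
    using assms
  proof (induction M)
    case 0
    have "dt (?I 0) ks (\<lambda>rs j. [])" by (rule dt_leaf[of _ "\<lambda>_. []"]) simp
    then show ?case by simp
  next
    case (Suc M)
    have 1: "dt (?I M) ks (\<lambda>rs j. if j < M then G rs j else [])" using Suc by simp
    have 2: "drecs ks (\<lambda>rs. G rs M)" using Suc.prems by simp
    have "dt (?I (Suc M)) ks (\<lambda>rs. (\<lambda>f g. f(M := g)) (\<lambda>j. if j < M then G rs j else []) (G rs M))"
      using 1 2 by (rule dt_map2[where h = "\<lambda>f g. f(M := g)"]) (auto simp: fun_eq_iff)
    moreover have "(\<lambda>j. if j < M then G rs j else [])(M := G rs M) = (\<lambda>j. if j < Suc M then G rs j else [])" for rs
      by (auto simp: fun_eq_iff less_Suc_eq)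
    ultimately show ?case by simp
  qed
  then obtain t where t: "\<And>rs. map fst rs = ks \<Longrightarrow>
      ?I M (registers (encs rs)) (evalt (registers (encs rs)) t) = (\<lambda>j. if j < M then G rs j else [])"
    unfolding dt_def by blast
  define emit where "emit = (\<lambda>ps :: (nat list \<times> aexp) list. concat (map (\<lambda>(K, a). map OutInt K @ [OutReal a]) ps))"
  have emit: "map (out_val s) (emit ps) = encs (map (\<lambda>(K, a). (K, aval s a)) ps)" for s ps
    unfolding emit_def by (induction ps) (auto simp: enc_def)
  have "\<exists>p. \<forall>s j. exec s p j = map (out_val s) (emit (evalt s t j))"
  proof (induction t)
    case (Leaf f)
    show ?case by (intro exI[of _ "Emit (\<lambda>j. emit (f j))"]) simp
  next
    case (Node a a' l r)
    then obtain p q where "\<forall>s j. exec s p j = map (out_val s) (emit (evalt s l j))"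
      "\<forall>s j. exec s q j = map (out_val s) (emit (evalt s r j))" by auto
    then show ?case by (intro exI[of _ "IfLe a a' p q"]) simp
  qed
  then obtain p where p: "\<And>s j. exec s p j = encs (map (\<lambda>(K, a). (K, aval s a)) (evalt s t j))"
    by (auto simp: emit)
  show ?thesis
  proof (intro exI[of _ p] allI impI)
    fix rs :: "rcd list" and j assume "map fst rs = ks" "j < M"
    with fun_cong[OF t, of rs j] show "exec (registers (encs rs)) p j = encs (G rs j)" by (simp add: p)
  qed
qed

text \<open>A machine sees the shape, which fixes the keys, and runs some program that is right for
  every content of this shape. If the step is computed by decision trees,
  \<open>program_exists\<close> ensures that \<open>SOME\<close> has a witness.\<close>

definition record_mpc ::
  "nat \<Rightarrow> nat \<Rightarrow> (nat \<Rightarrow> nat \<Rightarrow> nat) \<Rightarrow> (nat \<Rightarrow> nat \<Rightarrow> rcd list \<Rightarrow> nat \<Rightarrow> rcd list) \<Rightarrow> mpc" where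
  "record_mpc M R fresh G = \<lparr>mpc_machines = M, mpc_rounds = R, mpc_fresh = fresh,
     mpc_step = (\<lambda>t i sh. SOME p. \<forall>rs. shape (encs rs) = sh \<longrightarrow>
       (\<forall>j<M. exec (registers (encs rs)) p j = encs (G t i rs j)))\<rparr>"

definition fresh_records :: "(nat \<Rightarrow> nat \<Rightarrow> nat) \<Rightarrow> tape \<Rightarrow> nat \<Rightarrow> nat \<Rightarrow> rcd list" where
  "fresh_records fresh \<rho> t i = map (\<lambda>k. ([], \<rho> (t, i, k))) [0..<fresh t i]"

primrec record_mem ::
  "nat \<Rightarrow> (nat \<Rightarrow> nat \<Rightarrow> nat) \<Rightarrow> (nat \<Rightarrow> nat \<Rightarrow> rcd list \<Rightarrow> nat \<Rightarrow> rcd list) \<Rightarrow> (nat \<Rightarrow> rcd list) \<Rightarrow> tape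
    \<Rightarrow> nat \<Rightarrow> nat \<Rightarrow> rcd list" where
  "record_mem M fresh G input \<rho> 0 = input"
| "record_mem M fresh G input \<rho> (Suc t) = (\<lambda>j. concat (map (\<lambda>i.
      G t i (record_mem M fresh G input \<rho> t i @ fresh_records fresh \<rho> t i) j) [0..<M]))"

context
  fixes M R :: nat and fresh :: "nat \<Rightarrow> nat \<Rightarrow> nat" and G :: "nat \<Rightarrow> nat \<Rightarrow> rcd list \<Rightarrow> nat \<Rightarrow> rcd list"
    and input :: "nat \<Rightarrow> rcd list" and \<rho> :: tape
  assumes G: "\<And>t i j ks. t < R \<Longrightarrow> i < M \<Longrightarrow> j < M \<Longrightarrow> drecs ks (\<lambda>rs. G t i rs j)"
begin

abbreviation "rmach \<equiv> record_mpc M R fresh G"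
abbreviation "rmem \<equiv> record_mem M fresh G input \<rho>"
abbreviation "rwork t i \<equiv> rmem t i @ fresh_records fresh \<rho> t i"

lemma record_step:
  assumes "t < R" "i < M" "j < M"
  shows "exec (registers (encs rs)) (mpc_step rmach t i (shape (encs rs))) j = encs (G t i rs j)"
proof -
  let ?Q = "\<lambda>p. \<forall>rs'. shape (encs rs') = shape (encs rs) \<longrightarrow>
       (\<forall>j<M. exec (registers (encs rs')) p j = encs (G t i rs' j))"
  obtain p where "\<forall>rs'. map fst rs' = map fst rs \<longrightarrow> (\<forall>j<M. exec (registers (encs rs')) p j = encs (G t i rs' j))"
    using program_exists[of M "map fst rs" "G t i"] G assms by blast
  then have "?Q p" using shape_encs_inj by blast
  then have "?Q (SOME p. ?Q p)" by (rule someI)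
  then show ?thesis using assms by (simp add: record_mpc_def)
qed

text \<open>Transfers the semantics from words to records; later arguments about the run speak of
  record lists.\<close>

lemma record_mem_correct:
  assumes "t \<le> R" "j < M"
  shows "mpc_mem rmach (\<lambda>j. encs (input j)) \<rho> t j = encs (rmem t j)"
    and "mpc_work rmach \<rho> t (mpc_mem rmach (\<lambda>j. encs (input j)) \<rho> t) j = encs (rwork t j)"
proof -
  have work: "mpc_work rmach \<rho> t mem j = encs (rwork t j)" if "mem j = encs (rmem t j)" for t mem j
    using that by (simp add: mpc_work_def fresh_records_def encs_map_Pair_Nil record_mpc_def)
  show mem: "mpc_mem rmach (\<lambda>j. encs (input j)) \<rho> t j = encs (rmem t j)"
    using assms
  proof (induction t arbitrary: j)
    case (Suc t)
    have "mpc_sent rmach \<rho> t (mpc_mem rmach (\<lambda>j. encs (input j)) \<rho> t) i j = encs (G t i (rwork t i) j)" if "i < M" for i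
    proof -
      have "mpc_work rmach \<rho> t (mpc_mem rmach (\<lambda>j. encs (input j)) \<rho> t) i = encs (rwork t i)"
        using Suc that by (intro work) auto
      then show ?thesis unfolding mpc_sent_def Let_def using Suc.prems that by (simp only: record_step Suc_le_eq)
    qed
    then show ?case
      by (auto simp: encs_concat record_mpc_def comp_def intro!: arg_cong[where f = concat])
  qed simp
  show "mpc_work rmach \<rho> t (mpc_mem rmach (\<lambda>j. encs (input j)) \<rho> t) j = encs (rwork t j)"
    by (rule work) (rule mem)
qed

lemma record_sent:
  assumes "t < R" "i < M" "j < M"
  shows "mpc_sent rmach \<rho> t (mpc_mem rmach (\<lambda>j. encs (input j)) \<rho> t) i j = encs (G t i (rwork t i) j)"
proof -
  have "mpc_work rmach \<rho> t (mpc_mem rmach (\<lambda>j. encs (input j)) \<rho> t) i = encs (rwork t i)"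
    using assms by (intro record_mem_correct) auto
  then show ?thesis unfolding mpc_sent_def Let_def using assms by (simp only: record_step)
qed

lemma record_respects_memory:
  assumes "\<And>t j. t \<le> R \<Longrightarrow> j < M \<Longrightarrow> words (rmem t j) \<le> S"
    and "\<And>t j. t < R \<Longrightarrow> j < M \<Longrightarrow> words (rwork t j) \<le> S"
    and "\<And>t i. t < R \<Longrightarrow> i < M \<Longrightarrow> (\<Sum>j<M. words (G t i (rwork t i) j)) \<le> S"
    and "\<And>t j p k. t \<le> R \<Longrightarrow> j < M \<Longrightarrow> p \<in> set (rmem t j) \<Longrightarrow> k \<in> set (fst p) \<Longrightarrow> k \<le> B"
  shows "mpc_respects_memory rmach S B (\<lambda>j. encs (input j)) \<rho>"
proof -
  have int: "k \<le> B" if t: "t \<le> R" "j < M" "IntW k \<in> set (encs (rmem t j))" for t j k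
  proof -
    from t(3) obtain p where "p \<in> set (rmem t j)" "IntW k \<in> set (enc p)" by (auto simp: encs_def)
    then show ?thesis using assms(4)[OF t(1,2), of p k] by (auto simp: enc_def)
  qed
  have [simp]: "mpc_machines rmach = M" "mpc_rounds rmach = R" by (simp_all add: record_mpc_def)
  show ?thesis unfolding mpc_respects_memory_def
  proof (intro conjI allI impI)
    fix t j assume "t \<le> mpc_rounds rmach" "j < mpc_machines rmach"
    then have tj: "t \<le> R" "j < M" by simp_all
    show "length (mpc_mem rmach (\<lambda>j. encs (input j)) \<rho> t j) \<le> S"
      using assms(1)[OF tj] by (simp add: record_mem_correct(1)[OF tj] words_def)
    show "k \<le> B" if "IntW k \<in> set (mpc_mem rmach (\<lambda>j. encs (input j)) \<rho> t j)" for k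
      using int[OF tj] that by (simp add: record_mem_correct(1)[OF tj])
  next
    fix t i assume "t < mpc_rounds rmach" "i < mpc_machines rmach"
    then have ti: "t < R" "i < M" by simp_all
    show "length (mpc_work rmach \<rho> t (mpc_mem rmach (\<lambda>j. encs (input j)) \<rho> t) i) \<le> S"
      using assms(2)[OF ti] ti record_mem_correct(2)[of t i] by (simp add: words_def)
    show "(\<Sum>j<mpc_machines rmach. length (mpc_sent rmach \<rho> t (mpc_mem rmach (\<lambda>j. encs (input j)) \<rho> t) i j)) \<le> S"
      using assms(3)[OF ti] by (simp add: record_sent[OF ti] words_def)
  qed
qed

end

section \<open>The law of the random choices\<close>

lemma distr_PiM_map:
  assumes I: "finite I" and M: "\<And>i. i \<in> I \<Longrightarrow> prob_space (M i)"
    and f: "\<And>i. i \<in> I \<Longrightarrow> f i \<in> measurable (M i) (M' i)"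
  shows "distr (PiM I M) (PiM I M') (\<lambda>x. \<lambda>i\<in>I. f i (x i)) = PiM I (\<lambda>i. distr (M i) (M' i) (f i))"
proof -
  \<comment> \<open>\<open>product_prob_space\<close> demands a probability measure at every index,
    hence the point masses off I.\<close>
  define N where "N i = (if i \<in> I then M i else return (count_space UNIV) undefined)" for i
  define N' where "N' i = (if i \<in> I then distr (M i) (M' i) (f i) else return (count_space UNIV) undefined)" for i
  interpret N: product_prob_space N I
    by (rule product_prob_spaceI) (auto simp: N_def intro!: prob_space_return M)
  interpret N': product_prob_space N' I
    by (rule product_prob_spaceI) (auto simp: N'_def intro!: prob_space_return prob_space.prob_space_distr M f)
  have NM: "PiM I N = PiM I M" by (intro PiM_cong) (auto simp: N_def)
  have NM': "PiM I N' = PiM I (\<lambda>i. distr (M i) (M' i) (f i))" by (intro PiM_cong) (auto simp: N'_def)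
  have sets': "sets (PiM I N') = sets (PiM I M')" by (intro sets_PiM_cong) (auto simp: N'_def)
  have meas: "(\<lambda>x. \<lambda>i\<in>I. f i (x i)) \<in> measurable (PiM I M) (PiM I M')"
    using f by (intro measurable_restrict measurable_compose[OF measurable_component_singleton]) auto
  have "distr (PiM I M) (PiM I M') (\<lambda>x. \<lambda>i\<in>I. f i (x i)) = PiM I N'"
  proof (rule N'.PiM_eqI[OF I])
    show "sets (distr (PiM I M) (PiM I M') (\<lambda>x. \<lambda>i\<in>I. f i (x i))) = sets (PiM I N')"
      using sets' by simp
    fix A assume A: "\<And>i. i \<in> I \<Longrightarrow> A i \<in> sets (N' i)"
    then have A': "A i \<in> sets (M' i)" if "i \<in> I" for i using that by (auto simp: N'_def)
    have "Pi\<^sub>E I A \<in> sets (PiM I M')" using A' I by (intro sets_PiM_I_finite) auto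
    then have "emeasure (distr (PiM I M) (PiM I M') (\<lambda>x. \<lambda>i\<in>I. f i (x i))) (Pi\<^sub>E I A)
        = emeasure (PiM I M) ((\<lambda>x. \<lambda>i\<in>I. f i (x i)) -` Pi\<^sub>E I A \<inter> space (PiM I M))"
      by (rule emeasure_distr[OF meas])
    also have "(\<lambda>x. \<lambda>i\<in>I. f i (x i)) -` Pi\<^sub>E I A \<inter> space (PiM I M) = Pi\<^sub>E I (\<lambda>i. f i -` A i \<inter> space (M i))"
      by (auto simp: space_PiM PiE_iff)
    also have "emeasure (PiM I M) \<dots> = emeasure (PiM I N) (Pi\<^sub>E I (\<lambda>i. f i -` A i \<inter> space (M i)))"
      by (simp add: NM)
    also have "\<dots> = (\<Prod>i\<in>I. emeasure (N i) (f i -` A i \<inter> space (M i)))"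
      using I f A' by (intro N.emeasure_PiM) (auto simp: N_def)
    also have "\<dots> = (\<Prod>i\<in>I. emeasure (N' i) (A i))"
      using f A' by (intro prod.cong refl) (auto simp: N_def N'_def emeasure_distr)
    finally show "emeasure (distr (PiM I M) (PiM I M') (\<lambda>x. \<lambda>i\<in>I. f i (x i))) (Pi\<^sub>E I A)
      = (\<Prod>i\<in>I. emeasure (N' i) (A i))" .
  qed
  then show ?thesis by (simp add: NM')
qed

lemma distr_PiM_split:
  assumes "finite A" "finite B" "A \<inter> B = {}" and M: "product_prob_space M"
  shows "distr (PiM (A \<union> B) M) (PiM A M \<Otimes>\<^sub>M PiM B M) (\<lambda>x. (restrict x A, restrict x B)) = PiM A M \<Otimes>\<^sub>M PiM B M"
proof -
  interpret product_prob_space M "A \<union> B" by fact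
  have meas [measurable]: "(\<lambda>x. (restrict x A, restrict x B)) \<in> measurable (PiM (A \<union> B) M) (PiM A M \<Otimes>\<^sub>M PiM B M)"
    by (intro measurable_Pair measurable_restrict_subset) auto
  have "distr (PiM (A \<union> B) M) (PiM A M \<Otimes>\<^sub>M PiM B M) (\<lambda>x. (restrict x A, restrict x B))
      = distr (distr (PiM A M \<Otimes>\<^sub>M PiM B M) (PiM (A \<union> B) M) (merge A B)) (PiM A M \<Otimes>\<^sub>M PiM B M)
          (\<lambda>x. (restrict x A, restrict x B))"
    using assms by (simp add: distr_merge)
  also have "\<dots> = distr (PiM A M \<Otimes>\<^sub>M PiM B M) (PiM A M \<Otimes>\<^sub>M PiM B M) ((\<lambda>x. (restrict x A, restrict x B)) \<circ> merge A B)"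
    by (intro distr_distr) measurable
  also have "\<dots> = distr (PiM A M \<Otimes>\<^sub>M PiM B M) (PiM A M \<Otimes>\<^sub>M PiM B M) (\<lambda>x. x)"
    using assms(3) by (intro distr_cong refl)
      (auto simp: space_pair_measure space_PiM PiE_iff restrict_def merge_def fun_eq_iff extensional_def)
  finally show ?thesis by (simp add: distr_id)
qed

text \<open>This is the ceiling of N u, clamped to {1..N}. Counting comparisons keeps it within
  reach of a decision tree, which has no rounding.\<close>

definition part_of :: "nat \<Rightarrow> real \<Rightarrow> nat" where
  "part_of N u = 1 + card {k \<in> {1..<N}. real k < real N * u}"

lemma part_of_range: "0 < N \<Longrightarrow> part_of N u \<in> {1..N}"
proof -
  assume "0 < N"
  have "card {k \<in> {1..<N}. real k < real N * u} \<le> card {1..<N}" by (intro card_mono) auto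
  with \<open>0 < N\<close> show ?thesis by (simp add: part_of_def)
qed

lemma real_part_of: "real (part_of N u) = 1 + (\<Sum>k\<in>{1..<N}. of_bool (real k < real N * u))"
  by (simp add: part_of_def Int_def)

lemma measurable_part_of [measurable]: "part_of N \<in> measurable borel (count_space UNIV)"
proof -
  have eq: "part_of N u = 1 + (\<Sum>k\<in>{1..<N}. if real k < real N * u then 1 else 0)" for u
    by (simp add: part_of_def sum.If_cases Int_def)
  show ?thesis unfolding eq by measurable
qed

lemma part_of_eqI:
  assumes "k \<in> {1..N}" "(real k - 1) / real N < u" "u \<le> real k / real N"
  shows "part_of N u = k"
proof -
  have N: "0 < real N" using assms by simp
  have "real k - 1 < real N * u" "real N * u \<le> real k"
    using assms N by (simp_all add: field_simps)
  then have "{j \<in> {1..<N}. real j < real N * u} = {1..<k}"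
    using assms(1) by auto
  then show ?thesis using assms(1) by (simp add: part_of_def)
qed

lemma emeasure_uniform_01: "A \<in> sets borel \<Longrightarrow> emeasure (uniform_dist 0 1) A = emeasure lborel ({0..1} \<inter> A)"
  by (simp add: uniform_dist_def divide_ennreal_def)

text \<open>Only the lower bound 1 / N is computed for each part. As the N masses add up to at most
  1, all these bounds are equalities.\<close>

lemma distr_part_of:
  assumes N: "0 < N"
  shows "distr (uniform_dist 0 1) (measure_pmf (pmf_of_set {1..N})) (part_of N) = measure_pmf (pmf_of_set {1..N})"
    (is "?D = ?P")
proof -
  interpret U: prob_space "uniform_dist 0 1" by (rule prob_space_uniform_dist)
  have meas: "part_of N \<in> measurable (uniform_dist 0 1) ?P"
    by (simp cong: measurable_cong_sets)
  interpret D: prob_space ?D by (rule U.prob_space_distr[OF meas])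
  have ge: "1 / real N \<le> measure ?D {k}" if k: "k \<in> {1..N}" for k
  proof -
    have "ennreal (1 / real N) = emeasure lborel {(real k - 1) / real N<..real k / real N}"
      using N by (subst emeasure_lborel_Ioc) (auto simp: field_simps)
    also have "\<dots> \<le> emeasure (uniform_dist 0 1) (part_of N -` {k})"
    proof (subst emeasure_uniform_01)
      show "part_of N -` {k} \<in> sets borel"
        using measurable_sets[OF measurable_part_of, of "{k}" N] by simp
      then show "emeasure lborel {(real k - 1) / real N<..real k / real N} \<le> emeasure lborel ({0..1} \<inter> part_of N -` {k})"
      proof (intro emeasure_mono)
        show "{(real k - 1) / real N<..real k / real N} \<subseteq> {0..1} \<inter> part_of N -` {k}"
        proof
          fix u assume u: "u \<in> {(real k - 1) / real N<..real k / real N}"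
          have "0 \<le> (real k - 1) / real N" "real k / real N \<le> 1" using k N by auto
          with u have "0 \<le> u" "u \<le> 1" unfolding greaterThanAtMost_iff by linarith+
          with u k show "u \<in> {0..1} \<inter> part_of N -` {k}" by (auto intro!: part_of_eqI)
        qed
      qed auto
    qed
    also have "\<dots> = emeasure ?D {k}" using meas by (subst emeasure_distr) auto
    finally show ?thesis unfolding D.emeasure_eq_measure by (subst (asm) ennreal_le_iff) auto
  qed
  have sum1: "(\<Sum>k\<in>{1..N}. measure ?D {k}) \<le> 1"
  proof -
    have "(\<Sum>k\<in>{1..N}. measure ?D {k}) = measure ?D {1..N}"
      by (intro D.finite_measure_eq_sum_singleton[symmetric]) auto
    also have "\<dots> \<le> 1" by (rule D.prob_le_1)
    finally show ?thesis .
  qed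
  have eq: "measure ?D {k} = 1 / real N" if k: "k \<in> {1..N}" for k
  proof (rule antisym[OF _ ge[OF k]])
    have "measure ?D {k} + (\<Sum>j\<in>{1..N} - {k}. 1 / real N) \<le> measure ?D {k} + (\<Sum>j\<in>{1..N} - {k}. measure ?D {j})"
      using ge by (intro add_left_mono sum_mono) auto
    also have "\<dots> = (\<Sum>j\<in>{1..N}. measure ?D {j})" using k by (subst (2) sum.remove) auto
    also have "\<dots> \<le> 1" by (rule sum1)
    finally have "measure ?D {k} + (real N - 1) * (1 / real N) \<le> 1"
      using k N by (simp add: of_nat_diff)
    then show "measure ?D {k} \<le> 1 / real N" using N by (simp add: field_simps)
  qed
  show ?thesis
  proof (rule measure_eqI_countable[of _ UNIV])
    fix k :: nat
    show "emeasure ?D {k} = emeasure ?P {k}"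
    proof (cases "k \<in> {1..N}")
      case True
      then show ?thesis
        unfolding D.emeasure_eq_measure measure_pmf.emeasure_eq_measure eq[OF True] measure_pmf_of_interval[OF True] by simp
    next
      case False
      have "part_of N -` {k} = {}" using part_of_range[OF N] False by auto
      then have "emeasure ?D {k} = 0" using meas by (subst emeasure_distr) auto
      moreover have "emeasure ?P {k} = 0"
        using False N by (subst emeasure_pmf_of_set) auto
      ultimately show ?thesis by simp
    qed
  qed auto
qed

lemma distr_threshold:
  assumes b: "0 \<le> b"
  shows "distr (uniform_dist 0 1) borel (\<lambda>u. 0.2 * b + 0.2 * b * u) = uniform_dist (0.2 * b) (0.4 * b)"
proof (cases "b = 0")
  case True
  interpret U: prob_space "uniform_dist 0 1" by (rule prob_space_uniform_dist)
  have "distr (uniform_dist 0 1) borel (\<lambda>u. 0 :: real) = return borel 0"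
    by (rule U.distr_const) simp
  then show ?thesis using True by (simp add: uniform_dist_def)
next
  case False
  define c where "c = 0.2 * b"
  have c: "0 < c" "0.2 * b = c" "0.4 * b = 2 * c" using False b by (auto simp: c_def)
  show ?thesis unfolding c
  proof (rule measure_eqI)
    fix A assume "A \<in> sets (distr (uniform_dist 0 1) borel (\<lambda>u. c + c * u))"
    then have A [measurable]: "A \<in> sets borel" by simp
    let ?f = "\<lambda>u. c + c * u"
    have [measurable]: "?f -` X \<in> sets borel" if "X \<in> sets borel" for X
      using measurable_sets[of ?f borel borel X] that by simp
    have aff: "emeasure lborel B = ennreal c * emeasure lborel (?f -` B)" if B: "B \<in> sets borel" for B
    proof -
      have "emeasure lborel B = emeasure (density (distr lborel borel ?f) (\<lambda>_. ennreal \<bar>c\<bar>)) B"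
        using lborel_real_affine[of c c] c(1) by simp
      also have "\<dots> = ennreal c * emeasure (distr lborel borel ?f) B"
        using B c(1) by (subst emeasure_density_const) auto
      also have "emeasure (distr lborel borel ?f) B = emeasure lborel (?f -` B)"
        using B by (subst emeasure_distr) auto
      finally show ?thesis .
    qed
    have pre: "?f -` ({c..2 * c} \<inter> A) = {0..1} \<inter> ?f -` A"
      using c(1) by (auto simp: zero_le_mult_iff)
    have "emeasure (distr (uniform_dist 0 1) borel ?f) A = emeasure (uniform_dist 0 1) (?f -` A)"
      by (subst emeasure_distr) auto
    also have "\<dots> = emeasure lborel ({0..1} \<inter> ?f -` A)" by (intro emeasure_uniform_01) measurable
    also have "\<dots> = ennreal c * emeasure lborel ({0..1} \<inter> ?f -` A) / ennreal c"
    proof -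
      have "x = ennreal c * x / ennreal c" for x
        using c(1) ennreal_mult_divide_eq[of "ennreal c" x] by (simp add: mult.commute)
      then show ?thesis .
    qed
    also have "\<dots> = emeasure lborel ({c..2 * c} \<inter> A) / ennreal c"
      using aff[of "{c..2 * c} \<inter> A"] pre by simp
    also have "\<dots> = emeasure (uniform_dist c (2 * c)) A"
      using c(1) by (simp add: uniform_dist_def)
    finally show "emeasure (distr (uniform_dist 0 1) borel ?f) A = emeasure (uniform_dist c (2 * c)) A" .
  qed simp
qed

text \<open>Tape cell \<open>idx (v, 0)\<close> yields the part of v, and \<open>idx (v, t)\<close>
  with t >= 1 its threshold in iteration t. The layout of the cells is left open; independence
  follows once \<open>idx\<close> is injective.\<close>

definition choices :: "nat set \<Rightarrow> (nat \<Rightarrow> real) \<Rightarrow> nat \<Rightarrow> nat \<Rightarrow> (nat \<times> nat \<Rightarrow> 'k) \<Rightarrow> ('k \<Rightarrow> real) \<Rightarrow> outcome" where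
  "choices V b N T idx \<rho> =
     (\<lambda>v\<in>V. part_of N (\<rho> (idx (v, 0))), \<lambda>p\<in>V \<times> {1..T}. 0.2 * b (fst p) + 0.2 * b (fst p) * \<rho> (idx p))"

text \<open>The map is a composition of steps with known laws: selecting distinct cells, splitting
  them into parts and thresholds, renaming (v, 0) to v, and transforming each coordinate
  separately.\<close>

lemma distr_choices:
  assumes V: "finite V" and b: "\<And>v. v \<in> V \<Longrightarrow> 0 \<le> b v" and N: "0 < N"
    and inj: "inj_on idx (V \<times> {0..T})"
  defines "\<Omega> \<equiv> (\<Pi>\<^sub>M v\<in>V. measure_pmf (pmf_of_set {1..N})) \<Otimes>\<^sub>M
     (\<Pi>\<^sub>M p\<in>V \<times> {1..T}. uniform_dist (0.2 * b (fst p)) (0.4 * b (fst p)))"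
  shows "choices V b N T idx \<in> measurable (\<Pi>\<^sub>M p\<in>UNIV. uniform_dist 0 1) \<Omega>"
    and "distr (\<Pi>\<^sub>M p\<in>UNIV. uniform_dist 0 1) \<Omega> (choices V b N T idx) = \<Omega>"
proof -
  let ?U = "\<lambda>_. uniform_dist 0 1"
  let ?W = "PiM UNIV ?U"
  let ?A = "V \<times> {0::nat}" and ?B = "V \<times> {1..T}"
  let ?Q = "\<lambda>v. measure_pmf (pmf_of_set {1..N})"
  let ?R = "\<lambda>p. uniform_dist (0.2 * b (fst p)) (0.4 * b (fst p))"
  have AB: "?A \<union> ?B = V \<times> {0..T}" by auto
  define f1 where "f1 = (\<lambda>\<rho>. \<lambda>p\<in>V \<times> {0..T}. \<rho> (idx p) :: real)"
  define f2 where "f2 = (\<lambda>x :: nat \<times> nat \<Rightarrow> real. (restrict x ?A, restrict x ?B))"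
  define g1 where "g1 = (\<lambda>x :: nat \<times> nat \<Rightarrow> real. \<lambda>v\<in>V. x (v, 0))"
  define g2 where "g2 = (\<lambda>x :: nat \<Rightarrow> real. \<lambda>v\<in>V. part_of N (x v))"
  define g3 where "g3 = (\<lambda>x :: nat \<times> nat \<Rightarrow> real. \<lambda>p\<in>?B. 0.2 * b (fst p) + 0.2 * b (fst p) * x p)"
  have m1: "f1 \<in> measurable ?W (PiM (V \<times> {0..T}) ?U)"
    unfolding f1_def by (intro measurable_restrict measurable_component_singleton) auto
  have m2: "f2 \<in> measurable (PiM (V \<times> {0..T}) ?U) (PiM ?A ?U \<Otimes>\<^sub>M PiM ?B ?U)"
    unfolding f2_def by (intro measurable_Pair measurable_restrict_subset) auto
  have n1: "g1 \<in> measurable (PiM ?A ?U) (PiM V ?U)"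
    unfolding g1_def by (intro measurable_restrict measurable_component_singleton) auto
  have n2: "g2 \<in> measurable (PiM V ?U) (PiM V ?Q)"
    unfolding g2_def
    by (intro measurable_restrict measurable_compose[OF measurable_component_singleton]) (auto cong: measurable_cong_sets)
  have n3: "g3 \<in> measurable (PiM ?B ?U) (PiM ?B ?R)"
    unfolding g3_def
  proof (rule measurable_restrict)
    fix p assume "p \<in> ?B"
    then show "(\<lambda>x. 0.2 * b (fst p) + 0.2 * b (fst p) * x p) \<in> measurable (PiM ?B ?U) (?R p)"
      by (intro measurable_compose[OF measurable_component_singleton]) (auto cong: measurable_cong_sets)
  qed
  have d1: "distr ?W (PiM (V \<times> {0..T}) ?U) f1 = PiM (V \<times> {0..T}) ?U"
    unfolding f1_def using inj by (intro distr_PiM_reindex prob_space_uniform_dist) auto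
  have d2: "distr (PiM (V \<times> {0..T}) ?U) (PiM ?A ?U \<Otimes>\<^sub>M PiM ?B ?U) f2 = PiM ?A ?U \<Otimes>\<^sub>M PiM ?B ?U"
    unfolding f2_def AB[symmetric] using V
    by (intro distr_PiM_split product_prob_space_uniform_dist) auto
  have e1: "distr (PiM ?A ?U) (PiM V ?U) g1 = PiM V ?U"
    unfolding g1_def using distr_PiM_reindex[of ?A ?U "\<lambda>v. (v, 0)" V]
    by (auto simp: inj_on_def prob_space_uniform_dist)
  have e2: "distr (PiM V ?U) (PiM V ?Q) g2 = PiM V ?Q"
    unfolding g2_def using V N
    by (subst distr_PiM_map)
       (simp_all only: distr_part_of[OF N], auto simp: prob_space_uniform_dist cong: measurable_cong_sets)
  have e3: "distr (PiM ?B ?U) (PiM ?B ?R) g3 = PiM ?B ?R"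
  proof -
    have "distr (PiM ?B ?U) (PiM ?B ?R) g3 = PiM ?B (\<lambda>p. distr (uniform_dist 0 1) (?R p) (\<lambda>u. 0.2 * b (fst p) + 0.2 * b (fst p) * u))"
      unfolding g3_def using V
      by (intro distr_PiM_map) (auto simp: prob_space_uniform_dist cong: measurable_cong_sets)
    also have "\<dots> = PiM ?B ?R"
    proof (rule PiM_cong[OF refl])
      fix p assume "p \<in> ?B"
      then have "0 \<le> b (fst p)" using b by auto
      have "distr (uniform_dist 0 1) (?R p) (\<lambda>u. 0.2 * b (fst p) + 0.2 * b (fst p) * u)
          = distr (uniform_dist 0 1) borel (\<lambda>u. 0.2 * b (fst p) + 0.2 * b (fst p) * u)"
        by (rule distr_cong) auto
      also have "\<dots> = ?R p" by (rule distr_threshold) fact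
      finally show "distr (uniform_dist 0 1) (?R p) (\<lambda>u. 0.2 * b (fst p) + 0.2 * b (fst p) * u) = ?R p" .
    qed
    finally show ?thesis .
  qed
  let ?g = "\<lambda>(x, y). ((g2 \<circ> g1) x, g3 y)"
  have mg: "?g \<in> measurable (PiM ?A ?U \<Otimes>\<^sub>M PiM ?B ?U) \<Omega>"
  proof -
    have [measurable]: "g2 \<circ> g1 \<in> measurable (PiM ?A ?U) (PiM V ?Q)" using n1 n2 by (rule measurable_comp)
    note [measurable] = n3
    show ?thesis unfolding \<Omega>_def by measurable
  qed
  have dg: "distr (PiM ?A ?U \<Otimes>\<^sub>M PiM ?B ?U) \<Omega> ?g = \<Omega>"
  proof -
    have "distr (PiM ?A ?U) (PiM V ?Q) (g2 \<circ> g1) = distr (distr (PiM ?A ?U) (PiM V ?U) g1) (PiM V ?Q) g2"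
      by (rule distr_distr[OF n2 n1, symmetric])
    also have "\<dots> = PiM V ?Q" by (simp only: e1 e2)
    finally have 1: "distr (PiM ?A ?U) (PiM V ?Q) (g2 \<circ> g1) = PiM V ?Q" .
    have "sigma_finite_measure (distr (PiM ?B ?U) (PiM ?B ?R) g3)"
      unfolding e3 by (intro prob_space_imp_sigma_finite prob_space_PiM prob_space_uniform_dist)
    from pair_measure_distr[OF measurable_comp[OF n1 n2] n3 this]
    show ?thesis unfolding 1 e3 \<Omega>_def by simp
  qed
  have eq: "choices V b N T idx = ?g \<circ> (f2 \<circ> f1)"
    by (auto simp: choices_def f1_def f2_def g1_def g2_def g3_def fun_eq_iff)
  have m12: "f2 \<circ> f1 \<in> measurable ?W (PiM ?A ?U \<Otimes>\<^sub>M PiM ?B ?U)"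
    using m1 m2 by (rule measurable_comp)
  show "choices V b N T idx \<in> measurable ?W \<Omega>"
    unfolding eq using m12 mg by (rule measurable_comp)
  have "distr ?W \<Omega> (choices V b N T idx) = distr (distr (distr ?W (PiM (V \<times> {0..T}) ?U) f1) (PiM ?A ?U \<Otimes>\<^sub>M PiM ?B ?U) f2) \<Omega> ?g"
    unfolding eq distr_distr[OF m2 m1] by (rule distr_distr[OF mg m12, symmetric])
  then show "distr ?W \<Omega> (choices V b N T idx) = \<Omega>"
    by (simp only: d1 d2 dg)
qed

section \<open>The MPC program\<close>

text \<open>Replays the history of an edge. \<tau> will be the smaller number of active iterations
  of the endpoints; as activity is never regained, both endpoints are active in iteration t exactly
  for t <= \<tau>. \<open>c\<close> stands for the capacity r of the edge.\<close>

primrec edge_val :: "real \<Rightarrow> real \<Rightarrow> real \<Rightarrow> nat \<Rightarrow> real" where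
  "edge_val x0 c \<tau> 0 = x0"
| "edge_val x0 c \<tau> (Suc t) =
     (if real (Suc t) \<le> \<tau> \<and> edge_val x0 c \<tau> t \<le> c / 2 then 2 * edge_val x0 c \<tau> t else edge_val x0 c \<tau> t)"

definition table_records :: "nat list \<Rightarrow> nat list \<Rightarrow> (nat \<Rightarrow> nat \<Rightarrow> real) \<Rightarrow> rcd list" where
  "table_records vs tags f = map (\<lambda>p. ([fst p, snd p], f (fst p) (snd p))) (List.product vs tags)"

text \<open>
  Every machine keeps its edges, with both endpoints packed into one word, and a table of vertex
  data with keys \<open>[v, tag]\<close>. The tags are 0: capacity, 1: degree, \<open>2 + k\<close>: \<open>k\<close>-th random number of \<open>v\<close>
  (\<open>k = 0\<close> for the part, \<open>k = t\<close> for the threshold of iteration \<open>t\<close>), \<open>T + 3\<close>: number of iterations in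
  which \<open>v\<close> is active, \<open>T + 4\<close>: final load. A table entry is computed by gathering contributions of all
  machines at machine \<open>v mod M\<close>, which broadcasts the sum. Keys of length 3 mark the copies of the
  edges that are local to a part.
\<close>

locale one_round_program =
  fixes n m M N T :: nat
begin

text \<open>Input edges have keys of length 2, the length that later belongs to table entries; from
  round 1 on an edge is one packed word. Packing shortens an edge record from three words to two,
  which frees a third of the local memory for the table even if the input fills it.\<close>

definition edge_keys :: "nat \<Rightarrow> nat list list \<Rightarrow> (nat \<times> nat) list" where
  "edge_keys t ks = (if t = 0 then map (\<lambda>K. (K ! 0, K ! 1)) (filter (\<lambda>K. length K = 2) ks)
     else map (\<lambda>K. (K ! 0 div n, K ! 0 mod n)) (filter (\<lambda>K. length K = 1) ks))"

definition edge_key :: "nat \<Rightarrow> nat \<times> nat \<Rightarrow> nat list" where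
  "edge_key t p = (if t = 0 then [fst p, snd p] else [fst p * n + snd p])"

definition local_keys :: "nat list list \<Rightarrow> (nat \<times> nat) set" where
  "local_keys ks = {p. [fst p, snd p, 0] \<in> set ks}"

definition part_val :: "(nat \<Rightarrow> nat \<Rightarrow> real) \<Rightarrow> nat \<Rightarrow> real" where
  "part_val tab v = real (part_of N (tab v 2))"

definition q_tab :: "(nat \<Rightarrow> nat \<Rightarrow> real) \<Rightarrow> nat \<Rightarrow> real" where
  "q_tab tab v = 0.8 * tab v 0 / max (tab v 1) (2 * real m / real n)"

definition threshold :: "(nat \<Rightarrow> nat \<Rightarrow> real) \<Rightarrow> nat \<Rightarrow> nat \<Rightarrow> real" where
  "threshold tab v t = 0.2 * tab v 0 + 0.2 * tab v 0 * tab v (2 + t)"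

definition start_val :: "(nat \<Rightarrow> nat \<Rightarrow> real) \<Rightarrow> real \<Rightarrow> nat \<times> nat \<Rightarrow> real" where
  "start_val tab c p = min c (min (q_tab tab (fst p)) (q_tab tab (snd p)))"

definition final_val :: "(nat \<Rightarrow> nat \<Rightarrow> real) \<Rightarrow> real \<Rightarrow> nat \<times> nat \<Rightarrow> real" where
  "final_val tab c p = edge_val (start_val tab c p) c (min (tab (fst p) (T + 3)) (tab (snd p) (T + 3))) T"

primrec sim :: "(nat \<Rightarrow> nat \<Rightarrow> real) \<Rightarrow> (nat \<times> nat) set \<Rightarrow> (nat \<times> nat \<Rightarrow> real) \<Rightarrow> nat \<Rightarrow>
    (nat \<Rightarrow> bool) \<times> (nat \<times> nat \<Rightarrow> real)" where
  "sim tab L c 0 = (\<lambda>v. True, \<lambda>p. start_val tab (c p) p)"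
| "sim tab L c (Suc t) =
     (let (A, x) = sim tab L c t;
          A' = (\<lambda>v. A v \<and> real N * (\<Sum>p\<in>{p \<in> L. v = fst p \<or> v = snd p}. x p) \<le> threshold tab v (Suc t))
      in (A', \<lambda>p. if A' (fst p) \<and> A' (snd p) \<and> x p \<le> c p / 2 then 2 * x p else x p))"

lemma sim_Suc:
  "fst (sim tab L c (Suc t)) v \<longleftrightarrow> fst (sim tab L c t) v \<and>
     real N * (\<Sum>p\<in>{p \<in> L. v = fst p \<or> v = snd p}. snd (sim tab L c t) p) \<le> threshold tab v (Suc t)"
  "snd (sim tab L c (Suc t)) p = (if fst (sim tab L c (Suc t)) (fst p) \<and> fst (sim tab L c (Suc t)) (snd p) \<and>
     snd (sim tab L c t) p \<le> c p / 2 then 2 * snd (sim tab L c t) p else snd (sim tab L c t) p)"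
  by (simp_all add: Let_def split: prod.split)

definition table :: "rcd list \<Rightarrow> nat \<Rightarrow> nat \<Rightarrow> real" where
  "table rs v tag = val rs [v, tag]"

text \<open>With \<open>gather\<close> and \<open>bcast\<close> this is the schedule: capacities and
  degrees are gathered in step 0 and broadcast in step 1 together with the random numbers; local
  edges are copied in step 2; activity counts take steps 3 and 4, final loads steps 5 and 6; step 7
  outputs. The step that broadcasts a tag does not carry it: as \<open>val\<close> adds up, the
  owner would count it twice.\<close>

definition carry :: "nat \<Rightarrow> nat list" where
  "carry t = (if t \<in> {2, 3, 4} then [0..<T + 3] else if t \<in> {5, 6} then [0..<T + 4] else [])"

definition gather :: "nat \<Rightarrow> nat list" where
  "gather t = (if t = 0 then [0, 1] else if t = 3 then [T + 3] else if t = 5 then [T + 4] else [])"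

definition bcast :: "nat \<Rightarrow> nat list" where
  "bcast t = (if t = 1 then [0..<T + 3] else if t = 4 then [T + 3] else if t = 6 then [T + 4] else [])"

definition owned :: "nat \<Rightarrow> nat list" where
  "owned j = filter (\<lambda>v. v mod M = j) [0..<n]"

text \<open>An owner has at most n div M + 1 vertices, each with T + 1 random numbers.\<close>

definition fresh :: "nat \<Rightarrow> nat \<Rightarrow> nat" where
  "fresh t i = (if t = 1 then (n div M + 1) * (T + 1) else 0)"

definition at_vertex :: "nat \<Rightarrow> (nat \<times> nat) list \<Rightarrow> (nat \<times> nat) list" where
  "at_vertex v = filter (\<lambda>p. v = fst p \<or> v = snd p)"

text \<open>In step 0 only the machine with the vertex record finds a capacity, the others add 0. In
  step 3 only the machine whose number is the part of v reports a count. So the wanted quantity is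
  always the sum over all machines.\<close>

definition contribution :: "nat \<Rightarrow> nat \<Rightarrow> nat list list \<Rightarrow> rcd list \<Rightarrow> nat \<Rightarrow> nat \<Rightarrow> real" where
  "contribution t i ks rs v tag =
     (if t = 0 then (if tag = 0 then val rs [v] else real (length (at_vertex v (edge_keys 0 ks))))
      else if t = 3 then
        (if part_val (table rs) v = real i then
          (\<Sum>s\<in>{1..T}. of_bool (fst (sim (table rs) (local_keys ks) (\<lambda>p. val rs [fst p, snd p, 0]) s) v)) else 0)
      else (\<Sum>p\<leftarrow>at_vertex v (edge_keys t ks). final_val (table rs) (val rs (edge_key t p)) p))"

definition random_index :: "nat \<Rightarrow> nat \<Rightarrow> nat" where
  "random_index v k = v div M * (T + 1) + k"

text \<open>The random words are the last records of the memory, so they are addressed relative to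
  its length. \<open>fresh 1 0\<close> serves for every machine since the number of words does not
  depend on the machine.\<close>

definition bcast_val :: "nat \<Rightarrow> nat list list \<Rightarrow> rcd list \<Rightarrow> nat \<Rightarrow> nat \<Rightarrow> real" where
  "bcast_val t ks rs v tag =
     (if t = 1 \<and> 2 \<le> tag then
       (let k = length ks - fresh 1 0 + random_index v (tag - 2) in if k < length ks then snd (rs ! k) else 0)
      else val rs [v, tag])"

definition output_val :: "nat list list \<Rightarrow> rcd list \<Rightarrow> nat \<times> nat \<Rightarrow> real" where
  "output_val ks rs p =
     (if table rs (fst p) (T + 4) \<le> table rs (fst p) 0 \<and> table rs (snd p) (T + 4) \<le> table rs (snd p) 0
      then final_val (table rs) (val rs (edge_key 7 p)) p else 0)"

definition kept :: "nat \<Rightarrow> nat list list \<Rightarrow> rcd list \<Rightarrow> rcd list" where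
  "kept t ks rs = map (\<lambda>p. (edge_key 1 p, val rs (edge_key t p))) (edge_keys t ks)"

definition local_copies :: "nat \<Rightarrow> nat list list \<Rightarrow> rcd list \<Rightarrow> nat \<Rightarrow> rcd list" where
  "local_copies t ks rs j = concat (map (\<lambda>p.
     if part_val (table rs) (fst p) = real j \<and> part_val (table rs) (snd p) = real j
     then [([fst p, snd p, 0], val rs (edge_key t p))] else []) (edge_keys t ks))"

text \<open>The key list is a separate argument so that it can be held fixed when a decision tree
  for the records is built.\<close>

definition step' :: "nat \<Rightarrow> nat \<Rightarrow> nat list list \<Rightarrow> rcd list \<Rightarrow> nat \<Rightarrow> rcd list" where
  "step' t i ks rs j =
     (if t = 7 then (if j = i then map (\<lambda>p. ([fst p, snd p], output_val ks rs p)) (edge_keys 7 ks) else [])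
      else (if j = i then kept t ks rs @ table_records [0..<n] (carry t) (\<lambda>v tag. val rs [v, tag]) else []) @
        table_records (owned j) (gather t) (contribution t i ks rs) @
        table_records (owned i) (bcast t) (bcast_val t ks rs) @
        (if t = 2 then local_copies t ks rs j else []))"

definition step :: "nat \<Rightarrow> nat \<Rightarrow> rcd list \<Rightarrow> nat \<Rightarrow> rcd list" where
  "step t i rs j = step' t i (map fst rs) rs j"

section \<open>Each step is computed by decision trees\<close>

lemma dreal_table: "dreal ks (\<lambda>rs. table rs v tag)"
  unfolding table_def by (rule dreal_val)

lemma dreal_part_val: "dreal ks (\<lambda>rs. part_val (table rs) v)"
  unfolding part_val_def real_part_of
  by (intro dreal_add dreal_const dreal_sum dreal_of_bool dpred_less dreal_mult dreal_table) auto

lemma dreal_start_val: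
  assumes "dreal ks c"
  shows "dreal ks (\<lambda>rs. start_val (table rs) (c rs) p)"
  unfolding start_val_def q_tab_def
  by (intro dreal_min assms dreal_divide dreal_mult dreal_max dreal_const dreal_table) auto

lemma dreal_final_val:
  assumes "dreal ks c"
  shows "dreal ks (\<lambda>rs. final_val (table rs) (c rs) p)"
proof -
  have "dreal ks (\<lambda>rs. edge_val (start_val (table rs) (c rs) p) (c rs)
      (min (table rs (fst p) (T + 3)) (table rs (snd p) (T + 3))) t)" for t
  proof (induction t)
    case 0
    show ?case using assms by (simp add: dreal_start_val)
  next
    case (Suc t)
    then show ?case unfolding edge_val.simps
      by (intro dt_if dpred_conj dpred_le dreal_const dreal_min dreal_table dreal_divide dreal_mult assms) auto
  qed
  then show ?thesis unfolding final_val_def .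
qed

lemma dt_sim:
  assumes "\<And>p. dreal ks (\<lambda>rs. c rs p)"
  shows "(\<forall>v. dpred ks (\<lambda>rs. fst (sim (table rs) L (c rs) t) v)) \<and>
    (\<forall>p. dreal ks (\<lambda>rs. snd (sim (table rs) L (c rs) t) p))"
proof (induction t)
  case 0
  show ?case using assms by (auto intro: dpred_const dreal_start_val)
next
  case (Suc t)
  have IH: "dpred ks (\<lambda>rs. fst (sim (table rs) L (c rs) t) v)" "dreal ks (\<lambda>rs. snd (sim (table rs) L (c rs) t) p)" for v p
    using Suc by blast+
  have act: "dpred ks (\<lambda>rs. fst (sim (table rs) L (c rs) (Suc t)) v)" for v
    unfolding sim_Suc(1) threshold_def
    by (intro dpred_conj dpred_le dreal_mult dreal_add dreal_const dreal_sum dreal_table IH) auto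
  have "dreal ks (\<lambda>rs. snd (sim (table rs) L (c rs) (Suc t)) p)" for p
    unfolding sim_Suc(2)
    by (intro dt_if dpred_conj dpred_le act dreal_mult dreal_divide dreal_const assms IH) auto
  with act show ?case by blast
qed

lemma dreal_contribution: "dreal ks (\<lambda>rs. contribution t i ks rs v tag)"
proof -
  have "dpred ks (\<lambda>rs. fst (sim (table rs) (local_keys ks) (\<lambda>p. val rs [fst p, snd p, 0]) s) v)" for s
    using dt_sim[of ks "\<lambda>rs p. val rs [fst p, snd p, 0]" "local_keys ks" s] dreal_val by auto
  then show ?thesis unfolding contribution_def
    by (intro dt_if dpred_const dreal_val dreal_const dpred_eq dreal_part_val dreal_sum dreal_of_bool
        dreal_sum_list dreal_final_val) auto
qed

lemma dreal_bcast_val: "dreal ks (\<lambda>rs. bcast_val t ks rs v tag)"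
proof -
  let ?k = "length ks - fresh 1 0 + random_index v (tag - 2)"
  have "dreal ks (\<lambda>rs. if ?k < length ks then snd (rs ! ?k) else 0)"
    by (cases "?k < length ks") (auto intro: dreal_nth dreal_const)
  then show ?thesis unfolding bcast_val_def Let_def by (rule dt_if[OF dpred_const _ dreal_val])
qed

lemma drecs_table_records:
  assumes "\<And>v tag. dreal ks (\<lambda>rs. f rs v tag)"
  shows "drecs ks (\<lambda>rs. table_records vs tags (f rs))"
  unfolding table_records_def using assms by (intro drecs_map) auto

lemma drecs_step: "drecs ks (\<lambda>rs. step t i rs j)"
proof -
  have "drecs ks (\<lambda>rs. step' t i ks rs j)"
    unfolding step'_def kept_def local_copies_def output_val_def
    by (intro dt_if dpred_const drecs_append drecs_map drecs_Nil drecs_concat drecs_single drecs_table_records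
        dpred_conj dpred_le dpred_eq dreal_table dreal_val dreal_contribution dreal_bcast_val dreal_const
        dreal_final_val dreal_part_val) auto
  moreover have "drecs ks (\<lambda>rs. step t i rs j) \<longleftrightarrow> drecs ks (\<lambda>rs. step' t i ks rs j)"
    by (rule dt_cong) (simp add: step_def)
  ultimately show ?thesis by simp
qed

lemma val_table_records:
  assumes "distinct vs" "distinct tags"
  shows "val (table_records vs tags f) [v, tag] = (if v \<in> set vs \<and> tag \<in> set tags then f v tag else 0)"
proof (cases "v \<in> set vs \<and> tag \<in> set tags")
  case True
  then have "val (table_records vs tags f) ((\<lambda>p. [fst p, snd p]) (v, tag)) = f (fst (v, tag)) (snd (v, tag))"
    unfolding table_records_def using assms by (intro val_map) (auto simp: distinct_product inj_on_def)
  with True show ?thesis by simp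
qed (auto simp: table_records_def intro!: val_eq_0)

lemma words_table_records: "words (table_records vs tags f) = 3 * (length vs * length tags)"
  unfolding table_records_def by (subst words_map[where l = 2]) (auto simp: length_product)

lemma fst_table_records: "p \<in> set (table_records vs tags f) \<Longrightarrow> \<exists>v\<in>set vs. \<exists>tag\<in>set tags. fst p = [v, tag]"
  by (auto simp: table_records_def)

end

lemma sum_list_concat_upt: "(\<Sum>x\<leftarrow>concat (map g [0..<k]). f x) = (\<Sum>j<k. \<Sum>x\<leftarrow>g j. f x)"
  by (induction k) auto

lemma sum_list_upt: "(\<Sum>i\<leftarrow>[0..<k]. f i) = (\<Sum>i<k. f i)"
  by (induction k) auto

lemma concat_map_single:
  assumes "j < k" "\<And>i. i < k \<Longrightarrow> i \<noteq> j \<Longrightarrow> f i = []"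
  shows "concat (map f [0..<k]) = f j"
  using assms
proof (induction k)
  case (Suc k)
  show ?case
  proof (cases "j = k")
    case True
    have "concat (map f [0..<k]) = []" using Suc.prems True by auto
    with True show ?thesis by simp
  next
    case False
    with Suc show ?thesis by simp
  qed
qed simp

text \<open>N < M lets machine p simulate part p for each p in {1..N}; machines are numbered from
  0.\<close>

locale one_round_run = lp_graph V E b r +
    one_round_program "card V" "card E" M "num_parts V E" "num_iters V E"
  for V E b r and M :: nat +
  fixes lab :: "nat \<Rightarrow> nat" and place :: "nat \<Rightarrow> (nat + nat set) list" and \<rho> :: tape
  assumes lab: "bij_betw lab V {..<card V}" and place: "distributes M place (V <+> E)"
    and parts: "0 < N" "N < M"
begin

section \<open>Labels, placement of the edges and invariants of the memory\<close>

abbreviation "n \<equiv> card V"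

definition "unlab l = inv_into V lab l"

definition "pr e = (Min (lab ` e), Max (lab ` e))"

lemma inj_lab: "inj_on lab V" using lab by (rule bij_betw_imp_inj_on)

lemma lab_less: "v \<in> V \<Longrightarrow> lab v < n"
  using lab by (auto simp: bij_betw_def)

lemma unlab_lab [simp]: "v \<in> V \<Longrightarrow> unlab (lab v) = v"
  unfolding unlab_def by (rule inv_into_f_f[OF inj_lab])

lemma unlab: "l < n \<Longrightarrow> unlab l \<in> V" "l < n \<Longrightarrow> lab (unlab l) = l"
  using lab unfolding unlab_def bij_betw_def by (auto intro: inv_into_into f_inv_into_f)

lemma pr_cases:
  assumes "e \<in> E"
  obtains u v where "e = {u, v}" "u \<in> V" "v \<in> V" "lab u < lab v" "pr e = (lab u, lab v)"
proof -
  obtain x where "x \<in> e" using card_edge[OF assms] by fastforce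
  then obtain y where e: "e = {x, y}" "y \<noteq> x" "y \<in> V" using edge_eq_pair[OF assms] by metis
  have x: "x \<in> V" using \<open>x \<in> e\<close> edge_subset[OF assms] by auto
  have "lab x \<noteq> lab y" using inj_lab x e by (auto simp: inj_on_def)
  then consider "lab x < lab y" | "lab y < lab x" by linarith
  then show ?thesis
  proof cases
    case 1
    then have "pr e = (lab x, lab y)" by (simp add: pr_def e(1))
    with 1 x e that show ?thesis by blast
  next
    case 2
    then have "pr e = (lab y, lab x)" by (simp add: pr_def e(1))
    moreover have "e = {y, x}" using e by auto
    ultimately show ?thesis using 2 x e that by blast
  qed
qed

lemma pr_less: "e \<in> E \<Longrightarrow> fst (pr e) < n" "e \<in> E \<Longrightarrow> snd (pr e) < n"
  by (erule pr_cases, simp add: lab_less)+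

lemma pr_endpoint: "e \<in> E \<Longrightarrow> v \<in> V \<Longrightarrow> lab v = fst (pr e) \<or> lab v = snd (pr e) \<longleftrightarrow> v \<in> e"
  using inj_lab by (elim pr_cases) (auto simp: inj_on_def)

lemma pr_endpoint': "e \<in> E \<Longrightarrow> l < n \<Longrightarrow> l = fst (pr e) \<or> l = snd (pr e) \<longleftrightarrow> unlab l \<in> e"
  using pr_endpoint[of e "unlab l"] unlab[of l] by simp

lemma inj_pr: "inj_on pr E"
proof (rule inj_onI)
  fix e e' assume e: "e \<in> E" "e' \<in> E" and eq: "pr e = pr e'"
  have "v \<in> e \<longleftrightarrow> v \<in> e'" if "v \<in> V" for v
    using pr_endpoint[OF e(1) that] pr_endpoint[OF e(2) that] eq by simp
  then show "e = e'" using edge_subset[OF e(1)] edge_subset[OF e(2)] by blast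
qed

definition "edges_at j = map projr (filter (\<lambda>x. \<not> isl x) (place j))"

lemma all_records: "distinct (concat (map place [0..<M]))" "set (concat (map place [0..<M])) = V <+> E"
  using place by (auto simp: distributes_def)

lemma concat_edges_at:
  "concat (map edges_at [0..<k]) = map projr (filter (\<lambda>x. \<not> isl x) (concat (map place [0..<k])))"
  by (induction k) (auto simp: edges_at_def)

lemma distributes_edges: "distributes M edges_at E"
proof -
  have "inj_on projr {x. \<not> isl x}" by (intro inj_onI sum.expand) auto
  then have "distinct (concat (map edges_at [0..<M]))"
    unfolding concat_edges_at distinct_map using all_records(1) by (auto intro: inj_on_subset)
  moreover have "set (concat (map edges_at [0..<M])) = E"
  proof -
    have "set (concat (map edges_at [0..<M])) = projr ` {x \<in> V <+> E. \<not> isl x}"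
      unfolding concat_edges_at using all_records(2) by auto
    also have "\<dots> = E" by (force simp: image_iff)
    finally show ?thesis .
  qed
  ultimately show ?thesis by (simp add: distributes_def)
qed

lemma sum_edges_at:
  fixes f :: "nat set \<Rightarrow> real"
  shows "(\<Sum>j<M. \<Sum>e\<leftarrow>edges_at j. f e) = (\<Sum>e\<in>E. f e)"
  using distributes_edges sum_list_distinct_conv_sum_set[of "concat (map edges_at [0..<M])" f]
  by (simp add: distributes_def flip: sum_list_concat_upt)

lemma place_at:
  assumes "j < M"
  shows "distinct (place j)" "set (place j) \<subseteq> V <+> E" "distinct (edges_at j)" "set (edges_at j) \<subseteq> E"
proof -
  have j: "place j \<in> set (map place [0..<M])" "edges_at j \<in> set (map edges_at [0..<M])" using assms by auto
  show "distinct (place j)" "distinct (edges_at j)"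
    using j all_records(1) distributes_edges by (auto simp: distributes_def distinct_concat_iff)
  have "set (place j) \<subseteq> set (concat (map place [0..<M]))" using assms by auto
  then show "set (place j) \<subseteq> V <+> E" by (simp only: all_records(2))
  show "set (edges_at j) \<subseteq> E"
    using assms distributes_edges by (auto simp: distributes_def)
qed

definition "input_key x = case_sum (\<lambda>v. [lab v]) (\<lambda>e. [fst (pr e), snd (pr e)]) x"
definition "input_val x = case_sum b r x"
definition "rinput j = map (\<lambda>x. (input_key x, input_val x)) (place j)"

lemma mpc_input_eq: "mpc_input lab b r place = (\<lambda>j. encs (rinput j))"
proof
  fix j
  show "mpc_input lab b r place j = encs (rinput j)"
    by (auto simp: mpc_input_def rinput_def encs_def comp_def vertex_record_def edge_record_def enc_def
        input_key_def input_val_def pr_def intro!: arg_cong[where f = concat] split: sum.splits)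
qed

abbreviation "mem \<equiv> record_mem M fresh step rinput \<rho>"
definition "work t j = mem t j @ fresh_records fresh \<rho> t j"

lemma mem_Suc: "mem (Suc t) j = concat (map (\<lambda>i. step t i (work t i) j) [0..<M])"
  by (simp add: work_def)

declare record_mem.simps(2) [simp del]

lemma fst_fresh: "p \<in> set (fresh_records fresh \<rho> t j) \<Longrightarrow> fst p = []"
  by (auto simp: fresh_records_def)

lemma val_work: "K \<noteq> [] \<Longrightarrow> val (work t j) K = val (mem t j) K"
  unfolding work_def val_simps using val_eq_0[of "fresh_records fresh \<rho> t j" K] fst_fresh by fastforce

lemma table_work: "table (work t j) v tag = val (mem t j) [v, tag]"
  by (simp add: table_def val_work)

lemma filter_length_fresh: "l \<noteq> 0 \<Longrightarrow> filter (\<lambda>K. length K = l) (map fst (fresh_records fresh \<rho> t j)) = []"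
  using fst_fresh by (auto simp: filter_empty_conv)

lemma edge_keys_work: "edge_keys s (map fst (work t j)) = edge_keys s (map fst (mem t j))"
  by (simp add: edge_keys_def work_def filter_length_fresh)

lemma local_keys_work: "local_keys (map fst (work t j)) = local_keys (map fst (mem t j))"
  using fst_fresh[of _ t j] by (fastforce simp: local_keys_def work_def)

lemma local_copies_alt: "local_copies t ks rs j = map (\<lambda>p. ([fst p, snd p, 0], val rs (edge_key t p)))
   (filter (\<lambda>p. part_val (table rs) (fst p) = real j \<and> part_val (table rs) (snd p) = real j) (edge_keys t ks))"
proof -
  have "concat (map (\<lambda>p. if Q p then [f p] else []) ps) = map f (filter Q ps)" for Q f and ps :: "(nat \<times> nat) list"
    by (induction ps) auto
  then show ?thesis by (simp add: local_copies_def)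
qed

lemma filter_length_table_records:
  "l \<noteq> 2 \<Longrightarrow> filter (\<lambda>K. length K = l) (map fst (table_records vs tags f)) = []"
  by (auto simp: filter_empty_conv dest: fst_table_records)

lemma filter_length_local_copies:
  "l \<noteq> 3 \<Longrightarrow> filter (\<lambda>K. length K = l) (map fst (local_copies t ks rs j)) = []"
  by (auto simp: filter_empty_conv local_copies_alt)

lemma val_table_other: "length K \<noteq> 2 \<Longrightarrow> val (table_records vs tags f) K = 0"
  by (auto intro!: val_eq_0 dest: fst_table_records)

lemma val_local_other: "length K \<noteq> 3 \<Longrightarrow> val (local_copies t ks rs j) K = 0"
  by (auto intro!: val_eq_0 simp: local_copies_alt)

lemma decode_pair: "snd p < n \<Longrightarrow> ((fst p * n + snd p) div n, (fst p * n + snd p) mod n) = p"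
  using div_mult_self3[of n "snd p" "fst p"] by (cases "n = 0") (auto simp: prod_eq_iff)

lemma edge_key_eq_iff: "snd p < n \<Longrightarrow> snd p' < n \<Longrightarrow> edge_key t p = edge_key t p' \<longleftrightarrow> p = p'"
proof -
  assume p: "snd p < n" "snd p' < n"
  show ?thesis
  proof (cases "t = 0")
    case False
    have "p = p'" if "fst p * n + snd p = fst p' * n + snd p'"
      using decode_pair[OF p(1)] decode_pair[OF p(2)] that by metis
    then show ?thesis using False by (auto simp: edge_key_def)
  qed (auto simp: edge_key_def prod_eq_iff)
qed

lemma inj_input_key: "inj_on input_key (V <+> E)"
proof (rule inj_onI)
  fix x y assume x: "x \<in> V <+> E" and y: "y \<in> V <+> E" and eq: "input_key x = input_key y"
  show "x = y"
    using x y eq inj_onD[OF inj_lab] inj_onD[OF inj_pr]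
    by (cases x; cases y) (auto simp: input_key_def prod_eq_iff)
qed

text \<open>Edges never move and keep their order, so the keys at machine j always list the same
  edges. The values r survive the change to packed keys in the first step.\<close>

lemma edge_invariant:
  assumes "t \<le> 7" "j < M"
  shows "edge_keys t (map fst (mem t j)) = map pr (edges_at j) \<and>
    (\<forall>e\<in>set (edges_at j). val (mem t j) (edge_key t (pr e)) = r e)"
  using assms
proof (induction t arbitrary: j)
  case 0
  have "filter (\<lambda>K. length K = 2) (map input_key xs)
      = map (\<lambda>e. [fst (pr e), snd (pr e)]) (map projr (filter (\<lambda>x. \<not> isl x) xs))" for xs
    by (induction xs) (auto simp: input_key_def split: sum.splits)
  then have "edge_keys 0 (map fst (rinput j)) = map pr (edges_at j)"
    by (simp add: edge_keys_def rinput_def comp_def edges_at_def)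
  moreover have "val (rinput j) (edge_key 0 (pr e)) = r e" if e: "e \<in> set (edges_at j)" for e
  proof -
    have "Inr e \<in> set (place j)" using e by (auto simp: edges_at_def)
    then have "val (rinput j) (input_key (Inr e)) = input_val (Inr e)"
      unfolding rinput_def using place_at[OF 0(2)] by (intro val_map inj_on_subset[OF inj_input_key])
    then show ?thesis by (simp add: input_key_def input_val_def edge_key_def)
  qed
  ultimately show ?case by simp
next
  case (Suc t)
  have IH: "edge_keys t (map fst (mem t j)) = map pr (edges_at j)"
    "\<And>e. e \<in> set (edges_at j) \<Longrightarrow> val (mem t j) (edge_key t (pr e)) = r e"
    using Suc by auto
  have t: "t \<noteq> 7" using Suc by simp
  have small: "snd p < n" if "p \<in> set (map pr (edges_at j))" for p
    using that place_at(4)[OF Suc.prems(2)] pr_less by auto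
  have len1: "length (edge_key 1 p) = 1" for p by (simp add: edge_key_def)
  have "filter (\<lambda>K. length K = 1) (map fst (step t i (work t i) j))
      = (if i = j then map (edge_key 1) (map pr (edges_at j)) else [])" for i
    using t IH(1) len1
    by (auto simp: step_def step'_def kept_def filter_length_table_records filter_length_local_copies edge_keys_work comp_def
        simp del: One_nat_def)
  then have "filter (\<lambda>K. length K = 1) (map fst (mem (Suc t) j)) = map (edge_key 1) (map pr (edges_at j))"
    unfolding mem_Suc filter_map filter_concat map_concat map_map
    using concat_map_single[OF Suc.prems(2), of "\<lambda>i. filter (\<lambda>K. length K = 1) (map fst (step t i (work t i) j))"]
    by (simp add: filter_map comp_def)
  then have keys: "edge_keys (Suc t) (map fst (mem (Suc t) j)) = map pr (edges_at j)"
    using small decode_pair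
    by (simp add: edge_keys_def comp_def edge_key_def[of 1] del: One_nat_def)
  have "val (mem (Suc t) j) (edge_key (Suc t) (pr e)) = r e" if e: "e \<in> set (edges_at j)" for e
  proof -
    let ?K = "edge_key 1 (pr e)"
    let ?ps = "map pr (edges_at j)"
    have "val (step t i (work t i) j) ?K = (if i = j then val (kept t (map fst (work t j)) (work t j)) ?K else 0)" for i
      using t by (auto simp: step_def step'_def val_table_other val_local_other len1 simp del: One_nat_def)
    then have "val (mem (Suc t) j) ?K = val (kept t (map fst (work t j)) (work t j)) ?K"
      unfolding mem_Suc val_concat map_map comp_def sum_list_upt using Suc.prems(2) by simp
    also have "\<dots> = val (work t j) (edge_key t (pr e))"
      unfolding kept_def edge_keys_work IH(1)
    proof (rule val_map)
      show "distinct ?ps"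
        using place_at(3,4)[OF Suc.prems(2)] by (auto simp: distinct_map intro: inj_on_subset[OF inj_pr])
      show "inj_on (edge_key 1) (set ?ps)"
        by (rule inj_onI) (use small edge_key_eq_iff in blast)
    qed (use e in auto)
    also have "\<dots> = r e" using IH(2)[OF e] by (subst val_work) (auto simp: edge_key_def)
    finally show ?thesis by (simp add: edge_key_def)
  qed
  with keys show ?case by blast
qed

lemma edge_keys_inv: "t \<le> 7 \<Longrightarrow> j < M \<Longrightarrow> edge_keys t (map fst (work t j)) = map pr (edges_at j)"
  using edge_invariant edge_keys_work by simp

lemma edge_val_inv: "t \<le> 7 \<Longrightarrow> j < M \<Longrightarrow> e \<in> set (edges_at j) \<Longrightarrow> val (work t j) (edge_key t (pr e)) = r e"
  using edge_invariant by (subst val_work) (auto simp: edge_key_def)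

lemma distinct_tags: "distinct (carry t)" "distinct (gather t)" "distinct (bcast t)" "distinct (owned j)"
  by (auto simp: carry_def gather_def bcast_def owned_def)

lemma set_owned: "set (owned j) = {v. v < n \<and> v mod M = j}"
  by (auto simp: owned_def)

text \<open>A table entry has three sources: the copy carried along, contributions summed at the
  owner, and the broadcast of the owner. The schedule lets at most one of them be present for a
  tag.\<close>

lemma val_mem_Suc:
  assumes t: "t < 7" and j: "j < M" and l: "l < n"
  shows "val (mem (Suc t) j) [l, tag] =
    (if tag \<in> set (carry t) then val (mem t j) [l, tag] else 0) +
    (if l mod M = j \<and> tag \<in> set (gather t)
     then \<Sum>i<M. contribution t i (map fst (work t i)) (work t i) l tag else 0) +
    (if tag \<in> set (bcast t) then bcast_val t (map fst (work t (l mod M))) (work t (l mod M)) l tag else 0)"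
proof -
  have "val (step t i (work t i) j) [l, tag] =
    (if i = j then (if tag \<in> set (carry t) then val (mem t j) [l, tag] else 0) else 0) +
    (if l mod M = j \<and> tag \<in> set (gather t) then contribution t i (map fst (work t i)) (work t i) l tag else 0) +
    (if i = l mod M then (if tag \<in> set (bcast t) then bcast_val t (map fst (work t (l mod M))) (work t (l mod M)) l tag else 0) else 0)"
    for i
  proof -
    have "val (kept t (map fst (work t i)) (work t i)) [l, tag] = 0"
      by (auto simp: kept_def edge_key_def intro!: val_eq_0)
    then show ?thesis
      using t l by (auto simp: step_def step'_def val_table_records distinct_tags set_owned val_local_other val_work)
  qed
  then have "val (mem (Suc t) j) [l, tag] = (\<Sum>i<M.
    (if i = j then (if tag \<in> set (carry t) then val (mem t j) [l, tag] else 0) else 0) +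
    (if l mod M = j \<and> tag \<in> set (gather t) then contribution t i (map fst (work t i)) (work t i) l tag else 0) +
    (if i = l mod M then (if tag \<in> set (bcast t) then bcast_val t (map fst (work t (l mod M))) (work t (l mod M)) l tag else 0) else 0))"
    unfolding mem_Suc val_concat map_map comp_def sum_list_upt by simp
  moreover have "l mod M < M" using parts by simp
  ultimately show ?thesis using j
    by (cases "l mod M = j"; cases "tag \<in> set (gather t)") (simp_all add: sum.distrib)
qed

subsection \<open>Correctness of the program\<close>

definition idx :: "nat \<times> nat \<Rightarrow> nat \<times> nat \<times> nat" where
  "idx p = (1, lab (fst p) mod M, random_index (lab (fst p)) (snd p))"

definition "\<omega> = choices V b N T idx \<rho>"

abbreviation "A t \<equiv> act (y_est V E (fst \<omega>)) (snd \<omega>) t"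
abbreviation "X t \<equiv> xval (y_est V E (fst \<omega>)) (snd \<omega>) t"

definition active_count :: "nat \<Rightarrow> nat" where
  "active_count v = card {s \<in> {1..T}. v \<in> A s}"

text \<open>The intended content of the complete table for the outcome encoded by the tape; the run
  fills in growing initial segments of the tags.\<close>

definition TAB :: "nat \<Rightarrow> nat \<Rightarrow> real" where
  "TAB l tag = (if tag = 0 then b (unlab l) else if tag = 1 then real (card (incident E (unlab l)))
     else if tag < T + 3 then \<rho> (idx (unlab l, tag - 2))
     else if tag = T + 3 then real (active_count (unlab l)) else load (X T) (unlab l))"

lemma part_omega: "v \<in> V \<Longrightarrow> fst \<omega> v = part_of N (\<rho> (idx (v, 0)))"
  by (simp add: \<omega>_def choices_def)

lemma threshold_omega: "v \<in> V \<Longrightarrow> t \<in> {1..T} \<Longrightarrow> snd \<omega> (v, t) = 0.2 * b v + 0.2 * b v * \<rho> (idx (v, t))"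
  by (simp add: \<omega>_def choices_def)

lemma part_omega_range: "v \<in> V \<Longrightarrow> fst \<omega> v \<in> {1..N}"
  using part_omega part_of_range[OF parts(1)] by simp

text \<open>Each edge is stored on exactly one machine, so the partial sums of the machines cover
  each edge at l once.\<close>

lemma sum_at_vertex:
  fixes f :: "nat \<times> nat \<Rightarrow> real"
  assumes l: "l < n"
  shows "(\<Sum>i<M. \<Sum>p\<leftarrow>at_vertex l (map pr (edges_at i)). f p) = (\<Sum>e\<in>incident E (unlab l). f (pr e))"
proof -
  have "(\<Sum>p\<leftarrow>at_vertex l (map pr es). f p) = (\<Sum>e\<leftarrow>es. if l = fst (pr e) \<or> l = snd (pr e) then f (pr e) else 0)" for es
    by (induction es) (auto simp: at_vertex_def)
  then have "(\<Sum>i<M. \<Sum>p\<leftarrow>at_vertex l (map pr (edges_at i)). f p)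
      = (\<Sum>e\<in>E. if l = fst (pr e) \<or> l = snd (pr e) then f (pr e) else 0)"
    by (simp add: sum_edges_at)
  also have "\<dots> = (\<Sum>e\<in>incident E (unlab l). f (pr e))"
    using l by (intro sum.mono_neutral_cong_right) (auto simp: incident_def pr_endpoint')
  finally show ?thesis .
qed

section \<open>Contents of the vertex table after each step\<close>

lemma table_1:
  assumes j: "j < M" and l: "l < n" "l mod M = j" and tag: "tag < 2"
  shows "val (mem 1 j) [l, tag] = TAB l tag"
proof -
  have "val (mem 1 j) [l, tag] = (\<Sum>i<M. contribution 0 i (map fst (work 0 i)) (work 0 i) l tag)"
    using val_mem_Suc[of 0 j l tag] j l tag by (simp add: carry_def gather_def bcast_def less_2_cases_iff)
  also have "\<dots> = TAB l tag"
  proof (cases "tag = 0")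
    case True
    have "(\<Sum>i<M. val (mem 0 i) [l]) = val (concat (map rinput [0..<M])) [l]"
      by (simp add: val_concat comp_def sum_list_upt)
    also have "concat (map rinput [0..<M]) = map (\<lambda>x. (input_key x, input_val x)) (concat (map place [0..<M]))"
      by (simp add: rinput_def[abs_def] map_concat comp_def)
    also have "val \<dots> [l] = val (map (\<lambda>x. (input_key x, input_val x)) (concat (map place [0..<M]))) (input_key (Inl (unlab l)))"
      using unlab[OF l(1)] by (simp add: input_key_def)
    also have "\<dots> = input_val (Inl (unlab l))"
      using all_records unlab[OF l(1)] inj_input_key by (intro val_map) auto
    finally show ?thesis using True by (simp add: contribution_def val_work TAB_def input_val_def)
  next
    case False
    have "(\<Sum>i<M. real (length (at_vertex l (map pr (edges_at i))))) = (\<Sum>i<M. \<Sum>p\<leftarrow>at_vertex l (map pr (edges_at i)). 1)"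
      by (simp add: sum_list_triv)
    also have "\<dots> = real (card (incident E (unlab l)))"
      using sum_at_vertex[OF l(1), of "\<lambda>_. 1"] by simp
    finally show ?thesis using False tag by (simp add: contribution_def edge_keys_inv TAB_def)
  qed
  finally show ?thesis .
qed

lemma random_index_less:
  assumes "l < n" "k \<le> T"
  shows "random_index l k < fresh 1 i"
proof -
  have "l div M \<le> n div M" using assms by (intro div_le_mono) simp
  then have "l div M * (T + 1) \<le> n div M * (T + 1)" by (rule mult_right_mono) simp
  then show ?thesis using assms(2) by (simp add: random_index_def fresh_def)
qed

lemma table_2:
  assumes j: "j < M" and l: "l < n" and tag: "tag < T + 3"
  shows "val (mem 2 j) [l, tag] = TAB l tag"
proof -
  let ?o = "l mod M"
  have o: "?o < M" using parts by simp
  have "val (mem (Suc 1) j) [l, tag] = bcast_val 1 (map fst (work 1 ?o)) (work 1 ?o) l tag"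
    using j l tag by (subst val_mem_Suc) (auto simp: carry_def gather_def bcast_def)
  also have "\<dots> = TAB l tag"
  proof (cases "tag < 2")
    case True
    then show ?thesis using table_1[OF o l refl True] by (simp add: bcast_val_def val_work)
  next
    case False
    let ?q = "random_index l (tag - 2)"
    have q: "?q < fresh 1 ?o" using random_index_less[OF l, of "tag - 2"] tag by simp
    have f: "fresh 1 0 = fresh 1 ?o" by (simp add: fresh_def)
    have len: "length (work 1 ?o) = length (mem 1 ?o) + fresh 1 ?o"
      by (simp add: work_def fresh_records_def)
    have "work 1 ?o ! (length (mem 1 ?o) + ?q) = ([], \<rho> (1, ?o, ?q))"
      using q by (simp add: work_def nth_append fresh_records_def)
    then have "bcast_val 1 (map fst (work 1 ?o)) (work 1 ?o) l tag = \<rho> (1, ?o, ?q)"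
      using False q len f by (simp add: bcast_val_def Let_def)
    then show ?thesis using False tag unlab[OF l] by (simp add: TAB_def idx_def)
  qed
  finally show ?thesis by (simp add: numeral_2_eq_2)
qed

lemma carry_step:
  assumes "t < 7" "j < M" "l < n" "tag \<in> set (carry t)" "tag \<notin> set (gather t)" "tag \<notin> set (bcast t)"
  shows "val (mem (Suc t) j) [l, tag] = val (mem t j) [l, tag]"
  using assms by (subst val_mem_Suc) auto

lemma table_3:
  assumes "j < M" "l < n" "tag < T + 3"
  shows "val (mem 3 j) [l, tag] = TAB l tag"
proof -
  have "val (mem (Suc 2) j) [l, tag] = val (mem 2 j) [l, tag]"
    using assms by (intro carry_step) (auto simp: carry_def gather_def bcast_def)
  then show ?thesis using table_2[OF assms] by simp
qed

lemma part_val_table: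
  assumes "tab l 2 = TAB l 2" "l < n"
  shows "part_val tab l = real (fst \<omega> (unlab l))"
  using assms unlab[OF assms(2)] by (simp add: part_val_def TAB_def part_omega)

definition "part_edges j = {e \<in> E. \<forall>u\<in>e. fst \<omega> u = j}"

lemma local_test:
  assumes "j < M" "i < M" "e \<in> set (edges_at i)"
  shows "part_val (table (work 2 i)) (fst (pr e)) = real j \<and> part_val (table (work 2 i)) (snd (pr e)) = real j
    \<longleftrightarrow> e \<in> part_edges j"
proof -
  have e: "e \<in> E" using assms place_at(4) by auto
  have "part_val (table (work 2 i)) l = real (fst \<omega> (unlab l))" if "l < n" for l
    using that assms by (intro part_val_table) (auto simp: table_work table_2)
  then have "part_val (table (work 2 i)) (fst (pr e)) = real (fst \<omega> (unlab (fst (pr e))))"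
    "part_val (table (work 2 i)) (snd (pr e)) = real (fst \<omega> (unlab (snd (pr e))))"
    using pr_less[OF e] by auto
  moreover obtain u v where "e = {u, v}" "u \<in> V" "v \<in> V" "pr e = (lab u, lab v)" using pr_cases[OF e] by metis
  ultimately show ?thesis using e by (auto simp: part_edges_def)
qed

lemma local_copies_eq:
  assumes "j < M" "i < M"
  shows "local_copies 2 (map fst (work 2 i)) (work 2 i) j =
    map (\<lambda>e. ([fst (pr e), snd (pr e), 0], r e)) (filter (\<lambda>e. e \<in> part_edges j) (edges_at i))"
proof -
  have "filter (\<lambda>p. part_val (table (work 2 i)) (fst p) = real j \<and> part_val (table (work 2 i)) (snd p) = real j)
      (edge_keys 2 (map fst (work 2 i))) = map pr (filter (\<lambda>e. e \<in> part_edges j) (edges_at i))"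
    using local_test[OF assms] assms by (auto simp: edge_keys_inv filter_map comp_def intro!: arg_cong[where f = "map pr"] filter_cong)
  then show ?thesis
    unfolding local_copies_alt using assms by (auto simp: edge_val_inv)
qed

lemma step_2_keys3:
  assumes "j < M" "i < M"
  shows "filter (\<lambda>p. length (fst p) = 3) (step 2 i (work 2 i) j) =
    map (\<lambda>e. ([fst (pr e), snd (pr e), 0], r e)) (filter (\<lambda>e. e \<in> part_edges j) (edges_at i))"
proof -
  have "filter (\<lambda>p. length (fst p) = 3) (table_records vs tags f) = []" for vs tags f
    by (auto simp: filter_empty_conv dest: fst_table_records)
  moreover have "filter (\<lambda>p. length (fst p) = 3) (kept t ks rs) = []" for t ks rs
    by (auto simp: filter_empty_conv kept_def edge_key_def)
  ultimately show ?thesis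
    by (simp add: step_def step'_def local_copies_eq[OF assms] filter_map comp_def)
qed

text \<open>Keys of length 3 come from \<open>local_copies\<close> alone, so filtering by length
  isolates the edges of part j, each received once.\<close>

lemma mem_3_local:
  assumes j: "j < M"
  shows "local_keys (map fst (mem 3 j)) = pr ` part_edges j"
    and "e \<in> part_edges j \<Longrightarrow> val (mem 3 j) [fst (pr e), snd (pr e), 0] = r e"
proof -
  let ?k = "\<lambda>e. [fst (pr e), snd (pr e), 0]"
  define es where "es = filter (\<lambda>e. e \<in> part_edges j) (concat (map edges_at [0..<M]))"
  have mem3: "mem 3 j = concat (map (\<lambda>i. step 2 i (work 2 i) j) [0..<M])"
    using mem_Suc[of 2 j] by simp
  have "filter (\<lambda>p. length (fst p) = 3) (mem 3 j)
      = concat (map (\<lambda>i. map (\<lambda>e. (?k e, r e)) (filter (\<lambda>e. e \<in> part_edges j) (edges_at i))) [0..<M])"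
    unfolding mem3 filter_concat map_map comp_def
    by (intro arg_cong[where f = concat] map_cong refl) (simp add: step_2_keys3[OF j])
  also have "\<dots> = map (\<lambda>e. (?k e, r e)) es"
    by (simp add: es_def filter_concat map_concat comp_def)
  finally have flt: "filter (\<lambda>p. length (fst p) = 3) (mem 3 j) = map (\<lambda>e. (?k e, r e)) es" .
  have es: "set es = part_edges j" "distinct es"
    using distributes_edges by (auto simp: es_def distributes_def part_edges_def)
  have filter_key: "K \<in> set (map fst xs) \<longleftrightarrow> K \<in> fst ` set (filter (\<lambda>p. length (fst p) = 3) xs)"
    if "length K = 3" for K and xs :: "rcd list"
    using that by (induction xs) auto
  have "[fst p, snd p, 0] \<in> set (map fst (mem 3 j)) \<longleftrightarrow> p \<in> pr ` part_edges j" for p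
  proof -
    have "[fst p, snd p, 0] \<in> set (map fst (mem 3 j)) \<longleftrightarrow>
        [fst p, snd p, 0] \<in> fst ` set (filter (\<lambda>p. length (fst p) = 3) (mem 3 j))"
      using filter_key[of "[fst p, snd p, 0]" "mem 3 j"] by simp
    also have "\<dots> \<longleftrightarrow> p \<in> pr ` part_edges j"
      unfolding flt by (auto simp: es image_iff prod_eq_iff)
    finally show ?thesis .
  qed
  then show "local_keys (map fst (mem 3 j)) = pr ` part_edges j"
    by (auto simp: local_keys_def)
  assume e: "e \<in> part_edges j"
  have "val (filter (\<lambda>p. length (fst p) = 3) rs) K = val rs K" if "length K = 3" for rs K
    using that by (induction rs) auto
  from this[of "?k e" "mem 3 j"] have "val (mem 3 j) (?k e) = val (map (\<lambda>e. (?k e, r e)) es) (?k e)"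
    unfolding flt by simp
  also have "\<dots> = r e"
  proof (rule val_map[where k = ?k])
    show "inj_on ?k (set es)"
      unfolding es by (intro inj_onI inj_onD[OF inj_pr]) (auto simp: part_edges_def prod_eq_iff)
  qed (use es e in auto)
  finally show "val (mem 3 j) [fst (pr e), snd (pr e), 0] = r e" .
qed

lemma q_tab_eq:
  assumes "l < n" "tab l 0 = TAB l 0" "tab l 1 = TAB l 1"
  shows "q_tab tab l = q_val V E b (unlab l)"
  using assms by (simp add: q_tab_def q_val_def TAB_def avg_degree_def)

lemma start_val_eq:
  assumes e: "e \<in> E" and tab: "\<And>l tag. l < n \<Longrightarrow> tag < T + 3 \<Longrightarrow> tab l tag = TAB l tag"
  shows "start_val tab (r e) (pr e) = x_init V E b r e"
proof -
  obtain u v where "e = {u, v}" "u \<in> V" "v \<in> V" "pr e = (lab u, lab v)" using pr_cases[OF e] by metis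
  then show ?thesis using tab by (simp add: start_val_def q_tab_eq lab_less x_init_def)
qed

text \<open>The estimate of v uses only edges inside the part of v, and both endpoints of these lie
  in that part. So a part evolves autonomously given its edges and the table; nothing is claimed
  about other vertices.\<close>

lemma sim_correct:
  assumes tab: "\<And>l tag. l < n \<Longrightarrow> tag < T + 3 \<Longrightarrow> tab l tag = TAB l tag"
    and c: "\<And>e. e \<in> part_edges j \<Longrightarrow> c (pr e) = r e" and t: "t \<le> T"
  shows "(\<forall>v\<in>V. fst \<omega> v = j \<longrightarrow> (fst (sim tab (pr ` part_edges j) c t) (lab v) \<longleftrightarrow> v \<in> A t)) \<and>
    (\<forall>e\<in>part_edges j. snd (sim tab (pr ` part_edges j) c t) (pr e) = X t e)"
  using t
proof (induction t)
  case 0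
  show ?case using c by (auto simp: part_edges_def start_val_eq[OF _ tab])
next
  case (Suc t)
  let ?L = "pr ` part_edges j"
  have IH: "\<And>v. v \<in> V \<Longrightarrow> fst \<omega> v = j \<Longrightarrow> fst (sim tab ?L c t) (lab v) \<longleftrightarrow> v \<in> A t"
    "\<And>e. e \<in> part_edges j \<Longrightarrow> snd (sim tab ?L c t) (pr e) = X t e" using Suc by auto
  have act: "fst (sim tab ?L c (Suc t)) (lab v) \<longleftrightarrow> v \<in> A (Suc t)" if v: "v \<in> V" "fst \<omega> v = j" for v
  proof -
    let ?F = "E_local E (fst \<omega>) v"
    have sub: "?F \<subseteq> part_edges j"
      using v by (simp add: part_edges_def E_local_def incident_def subset_eq)
    have "{p \<in> ?L. lab v = fst p \<or> lab v = snd p} = pr ` ?F"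
    proof (intro equalityI subsetI)
      fix p assume "p \<in> {p \<in> ?L. lab v = fst p \<or> lab v = snd p}"
      then obtain e where e: "e \<in> part_edges j" "p = pr e" "lab v = fst (pr e) \<or> lab v = snd (pr e)" by blast
      then have "e \<in> E" by (simp add: part_edges_def)
      then have "v \<in> e" using pr_endpoint v(1) e(3) by blast
      then have "e \<in> ?F" using e(1) v(2) unfolding part_edges_def E_local_def incident_def by simp
      then show "p \<in> pr ` ?F" using e(2) by blast
    next
      fix p assume "p \<in> pr ` ?F"
      then obtain e where e: "e \<in> ?F" "p = pr e" by blast
      then have "e \<in> E" "v \<in> e" by (simp_all add: E_local_def incident_def)
      then have "lab v = fst (pr e) \<or> lab v = snd (pr e)" using pr_endpoint v(1) by blast
      then show "p \<in> {p \<in> ?L. lab v = fst p \<or> lab v = snd p}" using e sub by blast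
    qed
    moreover have "(\<Sum>p\<in>pr ` ?F. snd (sim tab ?L c t) p) = (\<Sum>e\<in>?F. snd (sim tab ?L c t) (pr e))"
    proof (rule sum.reindex[unfolded comp_def], rule inj_on_subset[OF inj_pr])
      show "?F \<subseteq> E" by (simp add: E_local_def incident_def subset_eq)
    qed
    moreover have "(\<Sum>e\<in>?F. snd (sim tab ?L c t) (pr e)) = (\<Sum>e\<in>?F. X t e)"
      by (rule sum.cong[OF refl]) (rule IH(2)[OF subsetD[OF sub]])
    ultimately have "(\<Sum>p\<in>{p \<in> ?L. lab v = fst p \<or> lab v = snd p}. snd (sim tab ?L c t) p) = (\<Sum>e\<in>?F. X t e)"
      by (simp only:)
    moreover have "threshold tab (lab v) (Suc t) = snd \<omega> (v, Suc t)"
      using v Suc.prems tab[OF lab_less[OF v(1)]]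
      by (simp add: threshold_def threshold_omega TAB_def)
    ultimately show ?thesis
      unfolding sim_Suc(1) act_Suc using IH(1)[OF v] by (simp add: y_est_def)
  qed
  have "snd (sim tab ?L c (Suc t)) (pr e) = X (Suc t) e" if e: "e \<in> part_edges j" for e
  proof -
    have eE: "e \<in> E" and ej: "\<And>u. u \<in> e \<Longrightarrow> fst \<omega> u = j" using e by (auto simp: part_edges_def)
    obtain u v where uv: "e = {u, v}" "u \<in> V" "v \<in> V" "pr e = (lab u, lab v)" using pr_cases[OF eE] by metis
    have "fst (sim tab ?L c (Suc t)) (lab u) \<longleftrightarrow> u \<in> A (Suc t)" "fst (sim tab ?L c (Suc t)) (lab v) \<longleftrightarrow> v \<in> A (Suc t)"
      using act uv ej by auto
    then show ?thesis unfolding sim_Suc(2) xval_Suc using IH(2)[OF e] c[OF e] eE uv by simp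
  qed
  with act show ?case by blast
qed

text \<open>The active sets decrease, so the iterations in which v is active form an initial
  segment, determined by its length.\<close>

lemma active_iff:
  assumes "s \<in> {1..T}"
  shows "v \<in> A s \<longleftrightarrow> s \<le> active_count v"
proof -
  let ?S = "{s \<in> {1..T}. v \<in> A s}"
  have fin: "finite ?S" by simp
  show ?thesis
  proof
    assume v: "v \<in> A s"
    have "{1..s} \<subseteq> ?S"
    proof
      fix x assume x: "x \<in> {1..s}"
      then have "A s \<subseteq> A x" by (intro act_antimono) simp
      with x v assms show "x \<in> ?S" by auto
    qed
    then have "card {1..s} \<le> card ?S" using fin by (intro card_mono)
    then show "s \<le> active_count v" by (simp add: active_count_def)
  next
    assume s: "s \<le> active_count v"
    show "v \<in> A s"
    proof (rule ccontr)
      assume v: "v \<notin> A s"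
      have "?S \<subseteq> {1..<s}"
      proof
        fix x assume x: "x \<in> ?S"
        then have "\<not> s \<le> x" using v act_antimono[of s x] by blast
        with x show "x \<in> {1..<s}" by simp
      qed
      then have "card ?S \<le> card {1..<s}" by (intro card_mono) auto
      then show False using s assms by (auto simp: active_count_def)
    qed
  qed
qed

lemma table_4:
  assumes j: "j < M" and l: "l < n"
  shows "tag < T + 3 \<Longrightarrow> val (mem 4 j) [l, tag] = TAB l tag"
    "l mod M = j \<Longrightarrow> val (mem 4 j) [l, T + 3] = TAB l (T + 3)"
proof -
  have mem4: "mem 4 = mem (Suc 3)" by simp
  show "val (mem 4 j) [l, tag] = TAB l tag" if "tag < T + 3"
    unfolding mem4 using assms that
    by (subst carry_step) (auto simp: carry_def gather_def bcast_def table_3)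
  assume lj: "l mod M = j"
  let ?v = "unlab l"
  have v: "?v \<in> V" "lab ?v = l" using unlab[OF l] by auto
  have "val (mem 4 j) [l, T + 3] = (\<Sum>i<M. contribution 3 i (map fst (work 3 i)) (work 3 i) l (T + 3))"
    unfolding mem4 using j l lj by (subst val_mem_Suc) (auto simp: carry_def gather_def bcast_def)
  \<comment> \<open>Only the machine simulating the part of the vertex contributes; its number is
    below M because N < M.\<close>
  also have "\<dots> = (\<Sum>i<M. if i = fst \<omega> ?v then real (active_count ?v) else 0)"
  proof (rule sum.cong[OF refl])
    fix i assume "i \<in> {..<M}"
    then have i: "i < M" by simp
    have "part_val (table (work 3 i)) l = real (fst \<omega> ?v)"
      using l i by (intro part_val_table) (auto simp: table_work table_3)
    moreover have "(\<Sum>s\<in>{1..T}. of_bool (fst (sim (table (work 3 i)) (local_keys (map fst (work 3 i)))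
        (\<lambda>p. val (work 3 i) [fst p, snd p, 0]) s) l)) = real (active_count ?v)" if "fst \<omega> ?v = i"
    proof -
      have "fst (sim (table (work 3 i)) (local_keys (map fst (work 3 i)))
        (\<lambda>p. val (work 3 i) [fst p, snd p, 0]) s) l \<longleftrightarrow> ?v \<in> A s" if s: "s \<in> {1..T}" for s
      proof -
        have "(\<forall>v\<in>V. fst \<omega> v = i \<longrightarrow> (fst (sim (table (work 3 i)) (pr ` part_edges i)
            (\<lambda>p. val (work 3 i) [fst p, snd p, 0]) s) (lab v) \<longleftrightarrow> v \<in> A s)) \<and>
            (\<forall>e\<in>part_edges i. snd (sim (table (work 3 i)) (pr ` part_edges i)
            (\<lambda>p. val (work 3 i) [fst p, snd p, 0]) s) (pr e) = X s e)"
          using s i by (intro sim_correct) (auto simp: table_work table_3 val_work mem_3_local)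
        then have "fst (sim (table (work 3 i)) (pr ` part_edges i)
            (\<lambda>p. val (work 3 i) [fst p, snd p, 0]) s) (lab ?v) \<longleftrightarrow> ?v \<in> A s"
          using v(1) \<open>fst \<omega> ?v = i\<close> by blast
        then show ?thesis by (simp only: v(2) local_keys_work mem_3_local(1)[OF i])
      qed
      then have "(\<Sum>s\<in>{1..T}. of_bool (fst (sim (table (work 3 i)) (local_keys (map fst (work 3 i)))
        (\<lambda>p. val (work 3 i) [fst p, snd p, 0]) s) l)) = (\<Sum>s\<in>{1..T}. of_bool (?v \<in> A s) :: real)"
        by (intro sum.cong refl) (simp only:)
      also have "\<dots> = real (active_count ?v)" by (simp add: active_count_def Int_def)
      finally show ?thesis .
    qed
    ultimately show "contribution 3 i (map fst (work 3 i)) (work 3 i) l (T + 3)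
        = (if i = fst \<omega> ?v then real (active_count ?v) else 0)"
      by (cases "fst \<omega> ?v = i") (simp_all add: contribution_def)
  qed
  also have "\<dots> = TAB l (T + 3)"
    using part_omega_range[OF v(1)] parts by (simp add: TAB_def)
  finally show "val (mem 4 j) [l, T + 3] = TAB l (T + 3)" .
qed

lemma table_5:
  assumes j: "j < M" and l: "l < n" and tag: "tag < T + 4"
  shows "val (mem 5 j) [l, tag] = TAB l tag"
proof -
  have mem5: "mem 5 = mem (Suc 4)" by simp
  have o: "l mod M < M" using parts by simp
  show ?thesis
  proof (cases "tag = T + 3")
    case True
    have "val (mem 5 j) [l, T + 3] = val (mem 4 (l mod M)) [l, T + 3]"
      unfolding mem5 using j l by (subst val_mem_Suc) (simp_all add: carry_def gather_def bcast_def bcast_val_def val_work)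
    also have "\<dots> = TAB l (T + 3)" by (rule table_4(2)[OF o l refl])
    finally show ?thesis unfolding True .
  next
    case False
    then have tag': "tag < T + 3" using tag by simp
    have "val (mem (Suc 4) j) [l, tag] = val (mem 4 j) [l, tag]"
      using tag' by (intro carry_step j l) (auto simp: carry_def gather_def bcast_def)
    also have "\<dots> = TAB l tag" by (rule table_4(1)[OF j l tag'])
    finally show ?thesis unfolding mem5 .
  qed
qed

lemma edge_val_eq:
  assumes e: "e \<in> E" "e = {u, v}" and t: "t \<le> T"
  shows "edge_val (x_init V E b r e) (r e) (min (real (active_count u)) (real (active_count v))) t = X t e"
  using t
proof (induction t)
  case (Suc t)
  have s: "Suc t \<in> {1..T}" using Suc.prems by simp
  have "real (Suc t) \<le> min (real (active_count u)) (real (active_count v)) \<longleftrightarrow> e \<subseteq> A (Suc t)"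
    unfolding e(2) min.bounded_iff of_nat_le_iff active_iff[OF s, symmetric] by blast
  then show ?case unfolding edge_val.simps xval_Suc using Suc e(1) by simp
qed simp

lemma final_val_eq:
  assumes e: "e \<in> E" and tab: "\<And>l tag. l < n \<Longrightarrow> tag < T + 4 \<Longrightarrow> tab l tag = TAB l tag"
  shows "final_val tab (r e) (pr e) = X T e"
proof -
  obtain u v where uv: "e = {u, v}" "u \<in> V" "v \<in> V" "pr e = (lab u, lab v)" using pr_cases[OF e] by metis
  have "start_val tab (r e) (pr e) = x_init V E b r e"
    using tab by (intro start_val_eq[OF e]) simp
  moreover have "tab (lab w) (T + 3) = real (active_count w)" if "w \<in> V" for w
    using tab lab_less[OF that] that by (simp add: TAB_def)
  ultimately show ?thesis
    unfolding final_val_def using edge_val_eq[OF e uv(1) order_refl] uv(2-4) by simp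
qed

lemma table_6:
  assumes j: "j < M" and l: "l < n"
  shows "tag < T + 4 \<Longrightarrow> val (mem 6 j) [l, tag] = TAB l tag"
    "l mod M = j \<Longrightarrow> val (mem 6 j) [l, T + 4] = TAB l (T + 4)"
proof -
  have mem6: "mem 6 = mem (Suc 5)" by simp
  show "val (mem 6 j) [l, tag] = TAB l tag" if "tag < T + 4"
    unfolding mem6 using assms that
    by (subst carry_step) (auto simp: carry_def gather_def bcast_def table_5)
  assume lj: "l mod M = j"
  have "val (mem 6 j) [l, T + 4] = (\<Sum>i<M. contribution 5 i (map fst (work 5 i)) (work 5 i) l (T + 4))"
    unfolding mem6 using j l lj by (subst val_mem_Suc) (auto simp: carry_def gather_def bcast_def)
  \<comment> \<open>Machines sum over label pairs; \<open>inv_into E pr\<close> recovers the edges,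
    so that \<open>sum_at_vertex\<close> applies.\<close>
  also have "\<dots> = (\<Sum>i<M. \<Sum>p\<leftarrow>at_vertex l (map pr (edges_at i)). X T (inv_into E pr p))"
  proof (rule sum.cong[OF refl])
    fix i assume "i \<in> {..<M}"
    then have i: "i < M" by simp
    have "final_val (table (work 5 i)) (val (work 5 i) (edge_key 5 p)) p = X T (inv_into E pr p)"
      if p: "p \<in> set (at_vertex l (map pr (edges_at i)))" for p
    proof -
      obtain e where e: "e \<in> set (edges_at i)" "p = pr e" using p by (auto simp: at_vertex_def)
      then have eE: "e \<in> E" using place_at(4)[OF i] by auto
      have "final_val (table (work 5 i)) (r e) (pr e) = X T e"
        using i by (intro final_val_eq[OF eE]) (simp add: table_work table_5)
      then show ?thesis using e i eE by (simp add: edge_val_inv inv_into_f_f[OF inj_pr])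
    qed
    then show "contribution 5 i (map fst (work 5 i)) (work 5 i) l (T + 4)
        = (\<Sum>p\<leftarrow>at_vertex l (map pr (edges_at i)). X T (inv_into E pr p))"
      using i by (simp add: contribution_def edge_keys_inv cong: map_cong)
  qed
  also have "\<dots> = (\<Sum>e\<in>incident E (unlab l). X T e)"
    unfolding sum_at_vertex[OF l] by (intro sum.cong refl) (auto simp: inv_into_f_f[OF inj_pr] dest: incidentD)
  also have "\<dots> = TAB l (T + 4)" by (simp add: TAB_def load_def)
  finally show "val (mem 6 j) [l, T + 4] = TAB l (T + 4)" .
qed

lemma table_7:
  assumes j: "j < M" and l: "l < n" and tag: "tag < T + 5"
  shows "val (mem 7 j) [l, tag] = TAB l tag"
proof -
  have mem7: "mem 7 = mem (Suc 6)" by simp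
  have o: "l mod M < M" using parts by simp
  show ?thesis
  proof (cases "tag = T + 4")
    case True
    have "val (mem 7 j) [l, T + 4] = val (mem 6 (l mod M)) [l, T + 4]"
      unfolding mem7 using j l by (subst val_mem_Suc) (simp_all add: carry_def gather_def bcast_def bcast_val_def val_work)
    also have "\<dots> = TAB l (T + 4)" by (rule table_6(2)[OF o l refl])
    finally show ?thesis unfolding True .
  next
    case False
    then have tag': "tag < T + 4" using tag by simp
    have "val (mem (Suc 6) j) [l, tag] = val (mem 6 j) [l, tag]"
      using tag' by (intro carry_step j l) (auto simp: carry_def gather_def bcast_def)
    also have "\<dots> = TAB l tag" by (rule table_6(1)[OF j l tag'])
    finally show ?thesis unfolding mem7 .
  qed
qed

lemma mem_8:
  assumes j: "j < M"
  shows "mem 8 j = map (\<lambda>e. ([fst (pr e), snd (pr e)], one_round_mpc V E b r \<omega> e)) (edges_at j)"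
proof -
  have out: "one_round_mpc V E b r \<omega> e = (if \<forall>u\<in>e. load (X T) u \<le> b u then X T e else 0)" for e
    by (simp add: one_round_mpc_def xval_def load_def one_round_state_eq_process Let_def)
  have "output_val (map fst (work 7 j)) (work 7 j) (pr e) = one_round_mpc V E b r \<omega> e"
    if e: "e \<in> set (edges_at j)" for e
  proof -
    have eE: "e \<in> E" using e place_at(4)[OF j] by auto
    obtain u v where uv: "e = {u, v}" "u \<in> V" "v \<in> V" "pr e = (lab u, lab v)" using pr_cases[OF eE] by metis
    have fv: "final_val (table (work 7 j)) (r e) (pr e) = X T e"
      using j by (intro final_val_eq[OF eE]) (simp add: table_work table_7)
    have tab: "table (work 7 j) (lab w) (T + 4) = load (X T) w" "table (work 7 j) (lab w) 0 = b w" if "w \<in> V" for w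
      using table_7[OF j lab_less[OF that]] that by (simp_all add: table_work TAB_def)
    have "edge_key 7 (pr e) \<noteq> []" by (simp add: edge_key_def)
    then show ?thesis unfolding output_val_def out using fv tab[OF uv(2)] tab[OF uv(3)] uv edge_val_inv[OF _ j e, of 7]
      by (simp add: fv)
  qed
  then have step7: "step 7 i (work 7 i) j = (if i = j then
      map (\<lambda>e. ([fst (pr e), snd (pr e)], one_round_mpc V E b r \<omega> e)) (edges_at j) else [])" for i
    using j by (auto simp: step_def step'_def edge_keys_inv)
  have "mem 8 j = concat (map (\<lambda>i. step 7 i (work 7 i) j) [0..<M])"
    using mem_Suc[of 7 j] by simp
  also have "\<dots> = step 7 j (work 7 j) j"
    using j by (intro concat_map_single) (auto simp: step7)
  finally show ?thesis by (simp add: step7)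
qed

lemma outputs_correct:
  "mpc_outputs (record_mpc M 8 fresh step) lab E (mpc_input lab b r place) \<rho> (one_round_mpc V E b r \<omega>)"
  unfolding mpc_outputs_def
proof (intro exI[of _ edges_at] conjI allI impI)
  show "distributes (mpc_machines (record_mpc M 8 fresh step)) edges_at E"
    using distributes_edges by (simp add: record_mpc_def)
  fix j assume "j < mpc_machines (record_mpc M 8 fresh step)"
  then have j: "j < M" by (simp add: record_mpc_def)
  have "mpc_mem (record_mpc M 8 fresh step) (mpc_input lab b r place) \<rho> 8 j = encs (mem 8 j)"
    unfolding mpc_input_eq using j by (intro record_mem_correct drecs_step) auto
  also have "\<dots> = concat (map (edge_record lab (one_round_mpc V E b r \<omega>)) (edges_at j))"
    unfolding mem_8[OF j] by (simp add: encs_def comp_def enc_def edge_record_def[abs_def] pr_def)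
  finally show "mpc_mem (record_mpc M 8 fresh step) (mpc_input lab b r place) \<rho> (mpc_rounds (record_mpc M 8 fresh step)) j
      = concat (map (edge_record lab (one_round_mpc V E b r \<omega>)) (edges_at j))"
    by (simp add: record_mpc_def)
qed

end

subsection \<open>Memory\<close>

context one_round_run
begin

lemma words_const: "(\<And>p. p \<in> set rs \<Longrightarrow> length (fst p) = l) \<Longrightarrow> words rs = (l + 1) * length rs"
  by (induction rs) auto

lemma length_owned: "length (owned j) \<le> n div M + 1"
proof -
  have "inj_on (\<lambda>v. v div M) (set (owned j))"
  proof (rule inj_onI)
    fix u v assume "u \<in> set (owned j)" "v \<in> set (owned j)" "u div M = v div M"
    then show "u = v" unfolding set_owned using div_mult_mod_eq[of u M] div_mult_mod_eq[of v M] by auto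
  qed
  moreover have "(\<lambda>v. v div M) ` set (owned j) \<subseteq> {..n div M}"
    by (auto simp: set_owned intro: div_le_mono)
  ultimately have "card (set (owned j)) \<le> card {..n div M}"
    by (intro card_inj_on_le[of "\<lambda>v. v div M"]) auto
  then show ?thesis using distinct_tags(4)[of j] by (simp add: distinct_card)
qed

lemma sum_length_owned: "(\<Sum>j<M. length (owned j)) = n"
proof -
  have "(\<Sum>j<M. length (owned j)) = (\<Sum>j<M. card {v \<in> {..<n}. v mod M = j})"
    by (intro sum.cong refl) (simp add: distinct_card[OF distinct_tags(4), symmetric] set_owned)
  also have "\<dots> = card (\<Union>j<M. {v \<in> {..<n}. v mod M = j})"
    by (subst card_UN_disjoint) auto
  also have "(\<Union>j<M. {v \<in> {..<n}. v mod M = j}) = {..<n}" using parts by auto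
  finally show ?thesis by simp
qed

lemma words_kept:
  assumes "t \<le> 7" "i < M"
  shows "words (kept t (map fst (work t i)) (work t i)) = 2 * length (edges_at i)"
  unfolding kept_def using assms
  by (subst words_map[where l = 1]) (auto simp: edge_key_def edge_keys_inv)

definition "local_count j i = length (filter (\<lambda>e. e \<in> part_edges j) (edges_at i))"

lemma words_step:
  assumes "t < 7" "i < M" "j < M"
  shows "words (step t i (work t i) j) =
    (if i = j then 2 * length (edges_at i) + 3 * (n * length (carry t)) else 0) +
    3 * (length (owned j) * length (gather t)) + 3 * (length (owned i) * length (bcast t)) +
    (if t = 2 then 4 * local_count j i else 0)"
proof -
  have "words (local_copies 2 (map fst (work 2 i)) (work 2 i) j) = 4 * local_count j i"
    unfolding local_copies_eq[OF assms(3,2)] local_count_def by (subst words_map[where l = 3]) auto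
  then show ?thesis using assms by (auto simp: step_def step'_def words_kept words_table_records)
qed

lemma words_mem_Suc: "words (mem (Suc t) j) = (\<Sum>i<M. words (step t i (work t i) j))"
  unfolding mem_Suc words_concat by (simp add: comp_def sum_list_upt)

lemma disjoint_parts:
  assumes "e \<in> E" shows "(\<Sum>j<M. of_bool (e \<in> part_edges j)) \<le> (of_bool (\<exists>j. e \<in> part_edges j) :: nat)"
proof -
  have "e \<noteq> {}" using card_edge[OF assms] by fastforce
  then obtain u where u: "u \<in> e" by blast
  have eq: "j = fst \<omega> u" if "e \<in> part_edges j" for j
    using that u by (auto simp: part_edges_def)
  show ?thesis
  proof (cases "\<exists>j. e \<in> part_edges j")
    case True
    have "(\<Sum>j<M. of_bool (e \<in> part_edges j) :: nat) \<le> (\<Sum>j<M. if j = fst \<omega> u then 1 else 0)"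
    proof (rule sum_mono)
      fix j
      show "(of_bool (e \<in> part_edges j) :: nat) \<le> (if j = fst \<omega> u then 1 else 0)"
        using eq[of j] by (cases "e \<in> part_edges j") simp_all
    qed
    also have "\<dots> \<le> 1" by simp
    finally show ?thesis using True by (simp only: of_bool_eq)
  next
    case False
    then have "e \<notin> part_edges j" for j by blast
    then show ?thesis by (simp only: of_bool_eq sum.neutral_const order_refl)
  qed
qed

lemma sum_local_count_sent:
  assumes "i < M"
  shows "(\<Sum>j<M. local_count j i) \<le> length (filter (\<lambda>e. \<exists>j. e \<in> part_edges j) (edges_at i))"
proof -
  have "(\<Sum>j<M. length (filter (\<lambda>e. e \<in> part_edges j) es)) \<le> length (filter (\<lambda>e. \<exists>j. e \<in> part_edges j) es)"
    if "set es \<subseteq> E" for es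
    using that
  proof (induction es)
    case (Cons e es)
    have "(\<Sum>j<M. length (filter (\<lambda>e. e \<in> part_edges j) (e # es)))
        = (\<Sum>j<M. of_bool (e \<in> part_edges j)) + (\<Sum>j<M. length (filter (\<lambda>e. e \<in> part_edges j) es))"
      unfolding sum.distrib[symmetric] by (intro sum.cong refl) simp
    also have "\<dots> \<le> of_bool (\<exists>j. e \<in> part_edges j) + length (filter (\<lambda>e. \<exists>j. e \<in> part_edges j) es)"
      using Cons by (intro add_mono disjoint_parts) auto
    also have "\<dots> = length (filter (\<lambda>e. \<exists>j. e \<in> part_edges j) (e # es))"
      by (cases "\<exists>j. e \<in> part_edges j") (simp_all only: filter.simps if_True if_False of_bool_eq list.size)
    finally show ?case .
  qed simp
  then show ?thesis using place_at(4)[OF assms] by (simp add: local_count_def)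
qed

lemma sum_local_count_received: "(\<Sum>i<M. local_count j i) = card (part_edges j)"
proof -
  have "(\<Sum>i<k. local_count j i) = length (filter (\<lambda>e. e \<in> part_edges j) (concat (map edges_at [0..<k])))" for k
    unfolding local_count_def by (induction k) auto
  then have "(\<Sum>i<M. local_count j i) = length (filter (\<lambda>e. e \<in> part_edges j) (concat (map edges_at [0..<M])))" .
  also have "\<dots> = card (set (filter (\<lambda>e. e \<in> part_edges j) (concat (map edges_at [0..<M]))))"
    using distributes_edges unfolding distributes_def by (subst distinct_card) auto
  also have "set (filter (\<lambda>e. e \<in> part_edges j) (concat (map edges_at [0..<M]))) = part_edges j"
    using distributes_edges by (auto simp: distributes_def part_edges_def)
  finally show ?thesis by simp
qed

lemma length_tags:
  "length (carry t) \<le> T + 4" "length (gather t) \<le> 2" "length (bcast t) \<le> T + 3"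
  by (auto simp: carry_def gather_def bcast_def)

lemma length_edges_at:
  assumes "words (rinput j) \<le> 3 * s0"
  shows "length (edges_at j) \<le> s0"
proof -
  have "3 * length (map projr (filter (\<lambda>x. \<not> isl x) xs)) \<le> words (map (\<lambda>x. (input_key x, input_val x)) xs)" for xs
    by (induction xs) (auto simp: input_key_def split: sum.splits)
  from this[of "place j"] show ?thesis using assms by (simp add: edges_at_def rinput_def)
qed

text \<open>3 * s0 is the local memory, of which packed edges take at most 2 * s0. \<open>Lc\<close>
  bounds the edges sent by one machine and those received for one part. In \<open>budget\<close>, 9
  of the 11 units n * (T + 4) suffice for the table traffic and 2 for the fresh random
  words.\<close>

context
  fixes s0 Lc :: nat
  assumes input_fits: "\<And>j. j < M \<Longrightarrow> words (rinput j) \<le> 3 * s0"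
    and M_le: "M \<le> n"
    and sent_local: "\<And>i. i < M \<Longrightarrow> length (filter (\<lambda>e. \<exists>j. e \<in> part_edges j) (edges_at i)) \<le> Lc"
    and received_local: "\<And>j. j < M \<Longrightarrow> card (part_edges j) \<le> Lc"
    and budget: "11 * (n * (T + 4)) + 4 * Lc \<le> s0"
    and tags: "T + 4 \<le> n ^ 2"
begin

lemma edges_le: "j < M \<Longrightarrow> length (edges_at j) \<le> s0"
  using length_edges_at input_fits by blast

text \<open>The data of each owned vertex are received from, or sent to, all M machines; M <= n
  keeps this at 2 n records per tag.\<close>

lemma owned_M: "M * length (owned j) \<le> 2 * n"
proof -
  have "M * length (owned j) \<le> M * (n div M + 1)" by (intro mult_left_mono length_owned) simp
  also have "\<dots> = n div M * M + M" by (simp add: algebra_simps)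
  also have "\<dots> \<le> n + M" by (simp add: div_times_less_eq_dividend)
  finally show ?thesis using M_le by simp
qed

lemma words_sent:
  assumes "t < 8" "i < M"
  shows "(\<Sum>j<M. words (step t i (work t i) j)) \<le> 3 * s0"
proof (cases "t = 7")
  case True
  have "words (step 7 i (work 7 i) j) = (if i = j then 3 * length (edges_at i) else 0)" for j
  proof (cases "i = j")
    case True
    have "words (step 7 i (work 7 i) j) = (2 + 1) * length (step 7 i (work 7 i) j)"
      by (rule words_const) (auto simp: step_def step'_def)
    then show ?thesis using True assms by (simp add: step_def step'_def edge_keys_inv)
  qed (simp add: step_def step'_def)
  then show ?thesis using True assms edges_le by simp
next
  case False
  then have t: "t < 7" using assms by simp
  have "(\<Sum>j<M. words (step t i (work t i) j)) = (\<Sum>j<M.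
    (if i = j then 2 * length (edges_at i) + 3 * (n * length (carry t)) else 0) +
    3 * (length (owned j) * length (gather t)) + 3 * (length (owned i) * length (bcast t)) +
    (if t = 2 then 4 * local_count j i else 0))"
    by (intro sum.cong refl words_step t assms) simp
  also have "\<dots> = 2 * length (edges_at i) + 3 * (n * length (carry t)) +
      3 * ((\<Sum>j<M. length (owned j)) * length (gather t)) + 3 * (M * length (owned i) * length (bcast t)) +
      (if t = 2 then 4 * (\<Sum>j<M. local_count j i) else 0)"
    using assms by (simp add: sum.distrib sum_distrib_left sum_distrib_right mult.assoc)
  also have "\<dots> \<le> 2 * s0 + 3 * (n * (T + 4)) + 3 * (n * 2) + 3 * (2 * n * (T + 3)) + 4 * Lc"
  proof -
    have "n * length (carry t) \<le> n * (T + 4)" by (intro mult_left_mono length_tags) simp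
    moreover have "(\<Sum>j<M. length (owned j)) * length (gather t) \<le> n * 2"
      unfolding sum_length_owned by (intro mult_left_mono length_tags) simp
    moreover have "M * length (owned i) * length (bcast t) \<le> 2 * n * (T + 3)"
      by (rule mult_mono[OF owned_M length_tags(3)]) auto
    moreover have "(if t = 2 then 4 * (\<Sum>j<M. local_count j i) else 0) \<le> 4 * Lc"
      using sum_local_count_sent[OF assms(2)] sent_local[OF assms(2)] by simp
    ultimately show ?thesis using edges_le[OF assms(2)] by linarith
  qed
  also have "\<dots> \<le> 3 * s0" using budget by (simp add: algebra_simps)
  finally show ?thesis .
qed

lemma words_mem:
  assumes "0 < t" "t < 8" "j < M"
  shows "words (mem t j) \<le> 2 * s0 + 9 * (n * (T + 4)) + 4 * Lc"
proof -
  obtain t' where t': "t = Suc t'" "t' < 7" using assms by (cases t) auto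
  have "words (mem t j) = (\<Sum>i<M.
    (if i = j then 2 * length (edges_at j) + 3 * (n * length (carry t')) else 0) +
    3 * (length (owned j) * length (gather t')) + 3 * (length (owned i) * length (bcast t')) +
    (if t' = 2 then 4 * local_count j i else 0))"
    unfolding t' words_mem_Suc using t' assms by (intro sum.cong refl) (auto simp: words_step)
  also have "\<dots> = 2 * length (edges_at j) + 3 * (n * length (carry t')) +
      3 * (M * length (owned j) * length (gather t')) + 3 * ((\<Sum>i<M. length (owned i)) * length (bcast t')) +
      (if t' = 2 then 4 * (\<Sum>i<M. local_count j i) else 0)"
    using assms by (simp add: sum.distrib sum_distrib_left sum_distrib_right mult.assoc)
  also have "\<dots> \<le> 2 * s0 + 3 * (n * (T + 4)) + 3 * (2 * n * 2) + 3 * (n * (T + 3)) + 4 * Lc"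
  proof -
    have "n * length (carry t') \<le> n * (T + 4)" by (intro mult_left_mono length_tags) simp
    moreover have "(\<Sum>i<M. length (owned i)) * length (bcast t') \<le> n * (T + 3)"
      unfolding sum_length_owned by (intro mult_left_mono length_tags) simp
    moreover have "M * length (owned j) * length (gather t') \<le> 2 * n * 2"
      by (rule mult_mono[OF owned_M length_tags(2)]) auto
    moreover have "(if t' = 2 then 4 * (\<Sum>i<M. local_count j i) else 0) \<le> 4 * Lc"
      using sum_local_count_received received_local[OF assms(3)] by simp
    ultimately show ?thesis using edges_le[OF assms(3)] by linarith
  qed
  also have "\<dots> \<le> 2 * s0 + 9 * (n * (T + 4)) + 4 * Lc" by (simp add: algebra_simps)
  finally show ?thesis .
qed

lemma words_mem': "t \<le> 8 \<Longrightarrow> j < M \<Longrightarrow> words (mem t j) \<le> 3 * s0"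
proof -
  assume t: "t \<le> 8" and j: "j < M"
  consider "t = 0" | "t = 8" | "0 < t" "t < 8" using t by linarith
  then show ?thesis
  proof cases
    case 1
    then show ?thesis using input_fits[OF j] by simp
  next
    case 2
    then show ?thesis using edges_le[OF j] mem_8[OF j] by (simp add: words_map[where l = 2])
  next
    case 3
    then show ?thesis using words_mem[OF 3 j] budget by simp
  qed
qed

lemma words_work: "t < 8 \<Longrightarrow> j < M \<Longrightarrow> words (work t j) \<le> 3 * s0"
proof -
  assume t: "t < 8" and j: "j < M"
  have "words (fresh_records fresh \<rho> t j) = fresh t j"
    unfolding fresh_records_def by (subst words_map[where l = 0]) auto
  then have w: "words (work t j) = words (mem t j) + fresh t j" by (simp add: work_def)
  show ?thesis
  proof (cases "t = 1")
    case False
    then show ?thesis using words_mem'[of t j] t j w by (simp add: fresh_def)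
  next
    case True
    have "n div M + 1 \<le> 2 * n" using M_le parts div_le_dividend[of n M] by linarith
    then have "fresh t j \<le> 2 * n * (T + 1)" using True by (simp add: fresh_def del: mult_Suc mult_Suc_right)
    also have "\<dots> \<le> 2 * (n * (T + 4))" by (simp add: algebra_simps)
    finally show ?thesis using words_mem[of t j] True j w budget by simp
  qed
qed

text \<open>The largest integers are packed pairs, below n^2; labels are below n and tags are at
  most T + 4.\<close>

lemma ints_small:
  assumes "t \<le> 8" "j < M" "p \<in> set (mem t j)" "k \<in> set (fst p)"
  shows "k \<le> n ^ 2"
proof -
  have nn: "n \<le> n ^ 2" by (simp add: power2_eq_square)
  have pr_small: "fst (pr e) < n" "snd (pr e) < n" if "e \<in> set (edges_at i)" "i < M" for e i
    using that place_at(4) pr_less by auto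
  show ?thesis
  proof (cases t)
    case 0
    then obtain x where x: "x \<in> set (place j)" "p = (input_key x, input_val x)"
      using assms by (auto simp: rinput_def)
    then have "x \<in> V <+> E" using place_at(2)[OF assms(2)] by auto
    then have "k < n" using x assms(4) lab_less pr_less by (auto simp: input_key_def split: sum.splits)
    then show ?thesis using nn by simp
  next
    case (Suc t')
    then obtain i where i: "i < M" and p: "p \<in> set (step t' i (work t' i) j)"
      using assms(3) by (auto simp: mem_Suc)
    have t': "t' \<le> 7" using Suc assms(1) by simp
    have table: "k \<le> n ^ 2" if ptab: "p \<in> set (table_records vs tags f)" and vs: "\<And>v. v \<in> set vs \<Longrightarrow> v < n"
        and tg: "\<And>x. x \<in> set tags \<Longrightarrow> x \<le> T + 4" for vs tags f
    proof -
      obtain v x where "v \<in> set vs" "x \<in> set tags" "fst p = [v, x]" using fst_table_records[OF ptab] by blast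
      then have "k < n \<or> k \<le> T + 4" using vs tg assms(4) by auto
      then show ?thesis using nn tags by linarith
    qed
    consider "p \<in> set (map (\<lambda>p. ([fst p, snd p], output_val (map fst (work 7 i)) (work 7 i) p)) (edge_keys 7 (map fst (work 7 i))))" "t' = 7"
      | "p \<in> set (kept t' (map fst (work t' i)) (work t' i))"
      | vs tags f where "p \<in> set (table_records vs tags f)" "vs \<in> {[0..<n], owned i, owned j}"
          "tags \<in> {carry t', gather t', bcast t'}"
      | "p \<in> set (local_copies t' (map fst (work t' i)) (work t' i) j)"
      using p by (auto simp: step_def step'_def split: if_splits)
    then show ?thesis
    proof cases
      case 1
      then have "k < n" using assms(4) pr_small[OF _ i] i by (auto simp: edge_keys_inv)
      then show ?thesis using nn by simp
    next
      case 2
      then obtain e where e: "e \<in> set (edges_at i)" "k = fst (pr e) * n + snd (pr e)"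
        using assms(4) i t' by (auto simp: kept_def edge_keys_inv edge_key_def)
      have "Suc (fst (pr e)) * n \<le> n * n" using pr_small[OF e(1) i] by (intro mult_right_mono) auto
      then show ?thesis using e pr_small[OF e(1) i] by (simp add: power2_eq_square)
    next
      case 3
      show ?thesis
        using 3(2,3) by (intro table[OF 3(1)]) (auto simp: set_owned carry_def gather_def bcast_def split: if_splits)
    next
      case 4
      then have "k < n \<or> k = 0" using assms(4) pr_small[OF _ i] i t' by (auto simp: local_copies_alt edge_keys_inv)
      then show ?thesis using nn by auto
    qed
  qed
qed

lemma respects_memory:
  "mpc_respects_memory (record_mpc M 8 fresh step) (3 * s0) (n ^ 2) (mpc_input lab b r place) \<rho>"
  unfolding mpc_input_eq
proof (rule record_respects_memory)
  show "drecs ks (\<lambda>rs. step t i rs j)" for t i j ks by (rule drecs_step)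
  show "words (mem t j @ fresh_records fresh \<rho> t j) \<le> 3 * s0" if "t < 8" "j < M" for t j
    using words_work[OF that] by (simp add: work_def)
  show "(\<Sum>j<M. words (step t i (mem t i @ fresh_records fresh \<rho> t i) j)) \<le> 3 * s0" if "t < 8" "i < M" for t i
    using words_sent[OF that] by (simp add: work_def)
qed (use words_mem' ints_small in auto)

end

end

section \<open>Memory bounds with high probability\<close>

context lp_graph
begin

text \<open>Each part receives at most its share 1 / N of every weight function in W, up to the
  factor 4 and the slack L. All parts are covered, so the property can also be used for the random
  part of a vertex.\<close>

definition spread :: "(nat \<Rightarrow> real) set \<Rightarrow> real \<Rightarrow> (nat \<Rightarrow> nat) \<Rightarrow> bool" where
  "spread W L i \<longleftrightarrow> (\<forall>c\<in>W. \<forall>p\<in>{1..N}.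
     (\<Sum>w\<in>V. c w * indicator {p} (i w)) \<le> 4 * (1 / real N) * (\<Sum>w\<in>V. c w) + L)"

lemma spreadD: "spread W L i \<Longrightarrow> c \<in> W \<Longrightarrow> p \<in> {1..N} \<Longrightarrow>
    (\<Sum>w\<in>V. c w * indicator {p} (i w)) \<le> 4 * (1 / real N) * (\<Sum>w\<in>V. c w) + L"
  unfolding spread_def by blast

lemma prob_spread:
  assumes W: "finite W" "\<And>c w. c \<in> W \<Longrightarrow> w \<in> V \<Longrightarrow> 0 \<le> c w" "\<And>c w. c \<in> W \<Longrightarrow> w \<in> V \<Longrightarrow> c w \<le> 1"
  shows "{i \<in> space part_space. spread W L i} \<in> sets part_space"
    and "1 - real (card W) * real N * exp (- L) \<le> measure part_space {i \<in> space part_space. spread W L i}"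
proof -
  define A where "A = (\<lambda>(c, p). {i \<in> space part_space.
      4 * (1 / real N) * (\<Sum>w\<in>V. c w) + L < (\<Sum>w\<in>V. c w * indicator {p} (i w))})"
  have meas: "A q \<in> sets part_space" for q
  proof -
    obtain c p where q: "q = (c, p)" by (cases q)
    have [measurable]: "(\<lambda>i. \<Sum>w\<in>V. c w * indicator {p} (i w)) \<in> borel_measurable part_space"
    proof (intro borel_measurable_sum borel_measurable_times)
      fix w assume "w \<in> V"
      then show "(\<lambda>i. indicator {p} (i w)) \<in> borel_measurable part_space"
        by (intro measurable_compose[OF measurable_component_singleton]) auto
    qed simp
    show ?thesis unfolding A_def q split by measurable
  qed
  have compl: "{i \<in> space part_space. spread W L i} = space part_space - (\<Union>q\<in>W \<times> {1..N}. A q)"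
  proof -
    have "i \<in> A (c, p) \<longleftrightarrow> i \<in> space part_space \<and>
        \<not> (\<Sum>w\<in>V. c w * indicator {p} (i w)) \<le> 4 * (1 / real N) * (\<Sum>w\<in>V. c w) + L" for i c p
      unfolding A_def split not_le by blast
    then show ?thesis unfolding spread_def by blast
  qed
  have fin: "finite (W \<times> {1..N})" using W(1) by simp
  show "{i \<in> space part_space. spread W L i} \<in> sets part_space"
    unfolding compl using fin meas by (intro sets.Diff sets.finite_UN) auto
  have "measure part_space (A q) \<le> exp (- L)" if q: "q \<in> W \<times> {1..N}" for q
  proof -
    obtain c p where cp: "q = (c, p)" "c \<in> W" "p \<in> {1..N}" using q by blast
    show ?thesis unfolding A_def cp split
      using W cp(2) measure_pmf_of_interval[OF cp(3)]
      by (intro parts.upper_tail_weighted_bits) auto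
  qed
  then have "measure part_space (\<Union>q\<in>W \<times> {1..N}. A q) \<le> real (card (W \<times> {1..N})) * exp (- L)"
    by (rule prob_finite_union_le[OF prob_space_part_space fin meas _ order_refl])
  moreover have "measure part_space {i \<in> space part_space. spread W L i} = 1 - measure part_space (\<Union>q\<in>W \<times> {1..N}. A q)"
    unfolding compl using fin meas by (intro prob_space.prob_compl[OF prob_space_part_space] sets.finite_UN) auto
  ultimately show "1 - real (card W) * real N * exp (- L) \<le> measure part_space {i \<in> space part_space. spread W L i}"
    by (simp add: card_cartesian_product)
qed

text \<open>A pair of an edge set F and a vertex v stands for the neighbourhood of v in F. The
  family \<F> will hold E and the edge set of each machine.\<close>

definition neighbour_weights :: "nat set set set \<Rightarrow> (nat \<Rightarrow> real) set" where
  "neighbour_weights \<F> = (\<lambda>p w. of_bool ({snd p, w} \<in> fst p)) ` (\<F> \<times> V)"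

lemma twice_card_edges_le:
  assumes F: "F \<subseteq> E"
  shows "2 * real (card {e \<in> F. Q e}) = (\<Sum>v\<in>V. \<Sum>w\<in>V. if {v, w} \<in> F then of_bool (Q {v, w}) else 0)"
    and "(\<Sum>v\<in>V. \<Sum>w\<in>V. of_bool ({v, w} \<in> F)) = 2 * real (card F)"
proof -
  interpret F: lp_graph V F b r
    using graph F b_nonneg r_nonneg by unfold_locales (auto simp: simple_graph_def)
  have "(\<Sum>v\<in>V. \<Sum>w\<in>V. if {v, w} \<in> F then of_bool (Q {v, w}) else 0) = (\<Sum>v\<in>V. \<Sum>e\<in>incident F v. of_bool (Q e) :: real)"
    by (intro sum.cong refl F.sum_incident_neighbours[symmetric])
  also have "\<dots> = (\<Sum>e\<in>F. \<Sum>v\<in>e. of_bool (Q e))" by (rule F.sum_incident_swap)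
  also have "\<dots> = (\<Sum>e\<in>F. 2 * of_bool (Q e))" using F.card_edge by (intro sum.cong refl) simp
  also have "\<dots> = 2 * real (card {e \<in> F. Q e})" by (simp add: sum_distrib_left[symmetric] Int_def)
  finally show "2 * real (card {e \<in> F. Q e}) = (\<Sum>v\<in>V. \<Sum>w\<in>V. if {v, w} \<in> F then of_bool (Q {v, w}) else 0)" ..
  have "(\<Sum>v\<in>V. \<Sum>w\<in>V. of_bool ({v, w} \<in> F) :: real) = (\<Sum>v\<in>V. \<Sum>e\<in>incident F v. 1)"
    by (intro sum.cong refl, subst F.sum_incident_neighbours) (auto simp: of_bool_def)
  also have "\<dots> = 2 * real (card F)" by (simp add: F.sum_card_incident)
  finally show "(\<Sum>v\<in>V. \<Sum>w\<in>V. of_bool ({v, w} \<in> F)) = 2 * real (card F)" .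
qed

text \<open>Edges of F are counted from both ends: by \<open>spread\<close>, a vertex has few
  neighbours in its own part. For F the edges of one machine this bounds what the machine
  sends.\<close>

lemma card_local_edges_le:
  assumes F: "F \<subseteq> E" "F \<in> \<F>" and i: "\<And>v. v \<in> V \<Longrightarrow> i v \<in> {1..N}" and spread: "spread (neighbour_weights \<F>) L i"
    and L: "0 \<le> L"
  shows "real (card {e \<in> F. \<exists>p. \<forall>u\<in>e. i u = p}) \<le> 8 * real (card F) / real N + real (card V) * L"
proof -
  have "2 * real (card {e \<in> F. \<exists>p. \<forall>u\<in>e. i u = p})
      = (\<Sum>v\<in>V. \<Sum>w\<in>V. if {v, w} \<in> F then of_bool (\<exists>p. \<forall>u\<in>{v, w}. i u = p) else 0)"
    by (rule twice_card_edges_le(1)[OF F(1)])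
  also have "\<dots> \<le> (\<Sum>v\<in>V. \<Sum>w\<in>V. of_bool ({v, w} \<in> F) * indicator {i v} (i w))"
    by (intro sum_mono) (auto simp: indicator_def)
  also have "\<dots> \<le> (\<Sum>v\<in>V. 4 * (1 / real N) * (\<Sum>w\<in>V. of_bool ({v, w} \<in> F)) + L)"
  proof (rule sum_mono)
    fix v assume v: "v \<in> V"
    have "(\<lambda>w. of_bool ({v, w} \<in> F)) \<in> neighbour_weights \<F>"
      unfolding neighbour_weights_def using v F(2) by (intro image_eqI[of _ _ "(F, v)"]) auto
    then show "(\<Sum>w\<in>V. of_bool ({v, w} \<in> F) * indicator {i v} (i w))
        \<le> 4 * (1 / real N) * (\<Sum>w\<in>V. of_bool ({v, w} \<in> F)) + L"
      by (rule spreadD[OF spread _ i[OF v]])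
  qed
  also have "\<dots> = 4 * (1 / real N) * (\<Sum>v\<in>V. \<Sum>w\<in>V. of_bool ({v, w} \<in> F)) + real (card V) * L"
    by (simp add: sum.distrib sum_distrib_left)
  also have "\<dots> = 8 * real (card F) / real N + real (card V) * L"
    unfolding twice_card_edges_le(2)[OF F(1)] by simp
  finally show ?thesis by simp
qed

text \<open>\<open>spread\<close> is used twice: for neighbourhoods, so that a vertex has at most
  about deg / N neighbours in part p; and for degrees divided by n, which are at most 1, so that
  part p has at most about the fraction 1 / N of the total degree. The result is of order m / N^2
  plus slack.\<close>

lemma card_part_edges_le:
  assumes F: "E \<in> \<F>" and p: "p \<in> {1..N}" and L: "0 \<le> L" and V: "0 < card V"
    and spread: "spread (insert (\<lambda>w. real (card (incident E w)) / real (card V)) (neighbour_weights \<F>)) L i"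
  shows "real (card {e \<in> E. \<forall>u\<in>e. i u = p})
    \<le> 4 / real N * (real (card V) * (8 * real (card E) / (real N * real (card V)) + L)) + real (card V) * L"
proof -
  let ?n = "real (card V)" and ?d = "\<lambda>v. real (card (incident E v))"
  have deg: "(\<Sum>w\<in>V. of_bool ({v, w} \<in> E)) = ?d v" if "v \<in> V" for v
    using sum_incident_neighbours[OF that, of "\<lambda>_. 1"] by (simp add: of_bool_def)
  have "2 * real (card {e \<in> E. \<forall>u\<in>e. i u = p})
      = (\<Sum>v\<in>V. \<Sum>w\<in>V. if {v, w} \<in> E then of_bool (\<forall>u\<in>{v, w}. i u = p) else 0)"
    by (rule twice_card_edges_le(1)[OF order_refl])
  also have "\<dots> \<le> (\<Sum>v\<in>V. indicator {p} (i v) * (\<Sum>w\<in>V. of_bool ({v, w} \<in> E) * indicator {p} (i w)))"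
    unfolding sum_distrib_left by (intro sum_mono) (auto simp: indicator_def)
  also have "\<dots> \<le> (\<Sum>v\<in>V. indicator {p} (i v) * (4 * (1 / real N) * ?d v + L))"
  proof (intro sum_mono mult_left_mono)
    fix v assume v: "v \<in> V"
    have "(\<lambda>w. of_bool ({v, w} \<in> E)) \<in> neighbour_weights \<F>"
      unfolding neighbour_weights_def using v F by (intro image_eqI[of _ _ "(E, v)"]) auto
    then have "(\<Sum>w\<in>V. of_bool ({v, w} \<in> E) * indicator {p} (i w))
        \<le> 4 * (1 / real N) * (\<Sum>w\<in>V. of_bool ({v, w} \<in> E)) + L"
      by (intro spreadD[OF spread _ p]) simp
    then show "(\<Sum>w\<in>V. of_bool ({v, w} \<in> E) * indicator {p} (i w)) \<le> 4 * (1 / real N) * ?d v + L"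
      unfolding deg[OF v] .
  qed simp
  also have "\<dots> \<le> (\<Sum>v\<in>V. 4 / real N * (?n * (?d v / ?n * indicator {p} (i v))) + L)"
    using V L by (intro sum_mono) (auto simp: indicator_def)
  also have "\<dots> = 4 / real N * (?n * (\<Sum>v\<in>V. ?d v / ?n * indicator {p} (i v))) + ?n * L"
    by (simp add: sum.distrib sum_distrib_left)
  also have "\<dots> \<le> 4 / real N * (?n * (4 * (1 / real N) * (\<Sum>v\<in>V. ?d v / ?n) + L)) + ?n * L"
    by (intro add_mono mult_left_mono order_refl spreadD[OF spread _ p]) auto
  also have "(\<Sum>v\<in>V. ?d v / ?n) = 2 * real (card E) / ?n"
    by (simp add: sum_divide_distrib[symmetric] sum_card_incident)
  finally show ?thesis by simp
qed

lemma degree_le: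
  assumes "v \<in> V"
  shows "real (card (incident E v)) \<le> real (card V)"
proof -
  have "real (card (incident E v)) = (\<Sum>w\<in>V. if {v, w} \<in> E then 1 else 0)"
    using sum_incident_neighbours[OF assms, of "\<lambda>_. 1"] by simp
  also have "\<dots> \<le> (\<Sum>w\<in>V. 1)" by (intro sum_mono) auto
  finally show ?thesis by simp
qed

lemma twice_card_E_le: "2 * real (card E) \<le> real (card V) * real (card V)"
proof -
  have "(\<Sum>v\<in>V. real (card (incident E v))) \<le> real (card V) * real (card V)"
    by (rule sum_bounded_above) (rule degree_le)
  then show ?thesis by (simp add: sum_card_incident)
qed

text \<open>The good event concerns the parts only: \<open>spread\<close> with slack h^2 for the
  degrees and for the neighbourhoods in E and in the edge sets of the machines. It depends on the
  placement of the input, whereas the program does not. N >= 1600 = 8 * 200 makes 8 s0 / N at most n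
  h^2, and \<open>dense\<close> makes 16 * 2m / N^2 at most 16 n.\<close>

lemma computes_one_round:
  fixes M h :: nat
  defines "s0 \<equiv> 200 * (card V * h\<^sup>2)"
  assumes N: "1600 \<le> N" "N < M" and M: "M \<le> card V" and h: "1 \<le> h" and T: "T + 4 \<le> 11 * h\<^sup>2" "T + 4 \<le> card V ^ 2"
    and dense: "2 * real (card E) \<le> real (card V) * (real N)\<^sup>2"
    and p: "p \<le> 1 - (real (M + 1) * real (card V) + 1) * real N * exp (- (real h)\<^sup>2)"
  shows "mpc_computes_one_round
    (record_mpc M 8 (one_round_program.fresh (card V) M T) (one_round_program.step (card V) (card E) M N T))
    (3 * s0) (card V ^ 2) p V E b r"
  unfolding mpc_computes_one_round_def
proof (intro allI impI)
  fix lab :: "nat \<Rightarrow> nat" and place :: "nat \<Rightarrow> (nat + nat set) list"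
  let ?P = "record_mpc M 8 (one_round_program.fresh (card V) M T) (one_round_program.step (card V) (card E) M N T)"
  let ?n = "card V"
  have machines: "mpc_machines ?P = M" by (simp add: record_mpc_def)
  assume lab: "bij_betw lab V {..<card V}" and place: "distributes (mpc_machines ?P) place (V <+> E)"
    and fits: "\<forall>j<mpc_machines ?P. length (mpc_input lab b r place j) \<le> 3 * s0"
  have run: "one_round_run V E b r M lab place"
    using lab place N unfolding machines by unfold_locales auto
  define idx where "idx p = (1 :: nat, lab (fst p) mod M, lab (fst p) div M * (T + 1) + snd p)" for p :: "nat \<times> nat"
  define \<phi> where "\<phi> = choices V b N T idx"
  \<comment> \<open>The owner, the quotient by M and an offset below T + 1 determine vertex and
    iteration, so no cell is read twice.\<close>
  have inj: "inj_on idx (V \<times> {0..T})"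
  proof (rule inj_onI)
    fix x y assume x: "x \<in> V \<times> {0..T}" and y: "y \<in> V \<times> {0..T}" and eq: "idx x = idx y"
    have mod: "lab (fst x) mod M = lab (fst y) mod M" and
      ind: "lab (fst x) div M * (T + 1) + snd x = lab (fst y) div M * (T + 1) + snd y"
      using eq by (simp_all add: idx_def)
    have div_mod: "(a * d + k) div d = a" "(a * d + k) mod d = k" if "k < d" for a d k :: nat
      using that by simp_all
    have "snd x < T + 1" "snd y < T + 1" using x y by auto
    with ind have "lab (fst x) div M = lab (fst y) div M" "snd x = snd y"
      using div_mod[of "snd x" "T + 1" "lab (fst x) div M"] div_mod[of "snd y" "T + 1" "lab (fst y) div M"] by metis+
    with mod have "lab (fst x) = lab (fst y)" by (metis div_mult_mod_eq)
    then have "fst x = fst y" using inj_onD[OF bij_betw_imp_inj_on[OF lab]] x y by auto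
    with \<open>snd x = snd y\<close> show "x = y" by (simp add: prod_eq_iff)
  qed
  have Npos: "0 < N" using N by simp
  have phi: "\<phi> \<in> measurable tape_space (one_round_space V E b)"
    "distr tape_space (one_round_space V E b) \<phi> = one_round_space V E b"
    unfolding \<phi>_def tape_space_def one_round_space_def
    using distr_choices[OF finite_V b_nonneg Npos inj] by simp_all
  define \<F> where "\<F> = insert E ((\<lambda>j. set (one_round_run.edges_at place j)) ` {..<M})"
  define W where "W = insert (\<lambda>w. real (card (incident E w)) / real ?n) (neighbour_weights \<F>)"
  define L where "L = (real h)\<^sup>2"
  define Gd where "Gd = {i \<in> space part_space. spread W L i}"
  have Vpos: "0 < ?n" using M N by linarith
  have finW: "finite W" by (simp add: W_def \<F>_def neighbour_weights_def)
  have cardW: "real (card W) \<le> real (M + 1) * real ?n + 1"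
  proof -
    have "card \<F> \<le> M + 1"
      unfolding \<F>_def using card_image_le[of "{..<M}" "\<lambda>j. set (one_round_run.edges_at place j)"]
      by (intro order_trans[OF card_insert_le_m1]) auto
    moreover have "card (neighbour_weights \<F>) \<le> card (\<F> \<times> V)"
      unfolding neighbour_weights_def by (intro card_image_le) (simp add: \<F>_def)
    ultimately have "card (neighbour_weights \<F>) \<le> (M + 1) * ?n"
      unfolding card_cartesian_product by (meson le_trans mult_le_mono1)
    moreover have "card W \<le> card (neighbour_weights \<F>) + 1"
      unfolding W_def using card_insert_le_m1 by (metis Suc_eq_plus1 card_insert_if finite_insert finW W_def le_refl le_SucI)
    ultimately have "card W \<le> (M + 1) * ?n + 1" by simp
    then have "real (card W) \<le> real ((M + 1) * ?n + 1)" by (rule of_nat_mono)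
    then show ?thesis by (simp add: algebra_simps)
  qed
  have W01: "0 \<le> c w" "c w \<le> 1" if "c \<in> W" "w \<in> V" for c w
    using that degree_le[OF that(2)] Vpos by (auto simp: W_def neighbour_weights_def)
  have Gd: "Gd \<in> sets part_space" "p \<le> measure part_space Gd"
  proof -
    show "Gd \<in> sets part_space" unfolding Gd_def by (rule prob_spread(1)) (use finW W01 in auto)
    have "1 - real (card W) * real N * exp (- L) \<le> measure part_space Gd"
      unfolding Gd_def by (rule prob_spread(2)) (use finW W01 in auto)
    moreover have "real (card W) * real N * exp (- L) \<le> (real (M + 1) * real ?n + 1) * real N * exp (- L)"
      using cardW by (intro mult_right_mono) auto
    ultimately show "p \<le> measure part_space Gd" using p unfolding L_def by linarith
  qed
  define good where "good = \<phi> -` (Gd \<times> space threshold_space) \<inter> space tape_space"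
  have GdT: "Gd \<times> space threshold_space \<in> sets (one_round_space V E b)"
    unfolding one_round_space_eq using Gd(1) by simp
  have good: "good \<in> sets tape_space" unfolding good_def using phi(1) GdT by (rule measurable_sets)
  have "measure tape_space good = measure (distr tape_space (one_round_space V E b) \<phi>) (Gd \<times> space threshold_space)"
    unfolding good_def by (rule measure_distr[OF phi(1) GdT, symmetric])
  also have "\<dots> = measure part_space Gd"
  proof -
    have "emeasure (one_round_space V E b) (Gd \<times> space threshold_space) = emeasure part_space Gd"
      unfolding one_round_space_eq using Gd(1)
      by (subst sigma_finite_measure.emeasure_pair_measure_Times[OF prob_space_imp_sigma_finite[OF prob_space_threshold_space]])
         (simp_all only: prob_space.emeasure_space_1[OF prob_space_threshold_space] mult_1_right sets.top)
    then show ?thesis by (simp add: phi(2) measure_def)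
  qed
  finally have "p \<le> measure tape_space good" using Gd(2) by simp
  moreover have "mpc_respects_memory ?P (3 * s0) (?n ^ 2) (mpc_input lab b r place) \<rho> \<and>
      mpc_outputs ?P lab E (mpc_input lab b r place) \<rho> (one_round_mpc V E b r (\<phi> \<rho>))" if \<rho>: "\<rho> \<in> good" for \<rho>
  proof -
    interpret run: one_round_run V E b r M lab place \<rho> by (rule run)
    have idx: "run.idx = idx" by (simp add: fun_eq_iff run.idx_def idx_def run.random_index_def)
    have \<omega>: "run.\<omega> = \<phi> \<rho>" unfolding run.\<omega>_def \<phi>_def idx ..
    have spread: "spread W L (fst run.\<omega>)"
      using \<rho> unfolding \<omega> good_def Gd_def by auto
    have spread': "spread (neighbour_weights \<F>) L (fst run.\<omega>)"
      using spread unfolding W_def spread_def by simp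
    have L0: "0 \<le> L" by (simp add: L_def)
    have N1600: "1600 \<le> real N" using N by simp
    have fits': "words (run.rinput j) \<le> 3 * s0" if "j < M" for j
      using fits that unfolding machines run.mpc_input_eq words_def by blast
    have "mpc_respects_memory ?P (3 * s0) (?n ^ 2) (mpc_input lab b r place) \<rho>"
    \<comment> \<open>18 = 16 + 1 + 1, from the three terms of the bound for received edges.\<close>
    proof (rule run.respects_memory[where Lc = "18 * (?n * h\<^sup>2)"])
      show "words (run.rinput j) \<le> 3 * s0" if "j < M" for j by (rule fits'[OF that])
      show "M \<le> ?n" by (rule M)
      show "T + 4 \<le> ?n ^ 2" by (rule T)
      \<comment> \<open>11 * 11 + 4 * 18 = 193, below the 200 in the definition of
        \<open>s0\<close>.\<close>
      show "11 * (?n * (T + 4)) + 4 * (18 * (?n * h\<^sup>2)) \<le> s0"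
      proof -
        have "?n * (T + 4) \<le> ?n * (11 * h\<^sup>2)" using T by (intro mult_left_mono) auto
        then show ?thesis unfolding s0_def by linarith
      qed
      show "length (filter (\<lambda>e. \<exists>j. e \<in> run.part_edges j) (run.edges_at i)) \<le> 18 * (?n * h\<^sup>2)" if i: "i < M" for i
      proof -
        let ?F = "set (run.edges_at i)"
        have F: "?F \<subseteq> E" "?F \<in> \<F>" using run.place_at(4)[OF i] i by (auto simp: \<F>_def)
        have len: "length (run.edges_at i) \<le> s0" by (rule run.length_edges_at[OF fits'[OF i]])
        have "length (filter (\<lambda>e. \<exists>j. e \<in> run.part_edges j) (run.edges_at i))
            = card (set (filter (\<lambda>e. \<exists>j. e \<in> run.part_edges j) (run.edges_at i)))"
          using run.place_at(3)[OF i] by (intro distinct_card[symmetric] distinct_filter)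
        also have "set (filter (\<lambda>e. \<exists>j. e \<in> run.part_edges j) (run.edges_at i))
            = {e \<in> ?F. \<exists>p. \<forall>u\<in>e. fst run.\<omega> u = p}"
          using F(1) by (auto simp: run.part_edges_def)
        finally have "real (length (filter (\<lambda>e. \<exists>j. e \<in> run.part_edges j) (run.edges_at i)))
            \<le> 8 * real (card ?F) / real N + real ?n * L"
          using card_local_edges_le[OF F run.part_omega_range spread' L0] by simp
        also have "\<dots> \<le> real ?n * L + real ?n * L"
        proof -
          have "8 * real (card ?F) \<le> 8 * real s0"
            using len distinct_card[OF run.place_at(3)[OF i]] by simp
          also have "\<dots> = 1600 * (real ?n * L)" by (simp add: s0_def L_def)
          also have "\<dots> \<le> real N * (real ?n * L)" using N1600 L0 by (intro mult_right_mono) auto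
          finally show ?thesis using N1600 by (simp add: field_simps)
        qed
        also have "\<dots> \<le> real (18 * (?n * h\<^sup>2))" by (simp add: L_def)
        finally show ?thesis by (simp only: of_nat_le_iff)
      qed
      show "card (run.part_edges j) \<le> 18 * (?n * h\<^sup>2)" if "j < M" for j
      proof (cases "j \<in> {1..N}")
        case False
        have "run.part_edges j = {}"
        proof (rule equals0I)
          fix e assume "e \<in> run.part_edges j"
          then have e: "e \<in> E" "\<And>u. u \<in> e \<Longrightarrow> fst run.\<omega> u = j" by (auto simp: run.part_edges_def)
          have "e \<noteq> {}" using card_edge[OF e(1)] by fastforce
          then obtain u where u: "u \<in> e" by blast
          then have "fst run.\<omega> u \<in> {1..N}" using run.part_omega_range edge_subset[OF e(1)] by blast
          with e(2)[OF u] False show False by simp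
        qed
        then show ?thesis by simp
      next
        case True
        have "E \<in> \<F>" by (simp add: \<F>_def)
        from card_part_edges_le[OF this True L0 Vpos spread[unfolded W_def]]
        have "real (card (run.part_edges j))
            \<le> 4 / real N * (real ?n * (8 * real (card E) / (real N * real ?n) + L)) + real ?n * L"
          by (simp add: run.part_edges_def)
        also have "\<dots> = 16 * (2 * real (card E) / (real N)\<^sup>2) + 4 / real N * (real ?n * L) + real ?n * L"
        proof -
          have "real ?n \<noteq> 0" "real N \<noteq> 0" using Vpos N1600 by linarith+
          then have "x \<noteq> 0 \<Longrightarrow> y \<noteq> 0 \<Longrightarrow> 4 / x * (y * (8 * e / (x * y) + L)) + y * L
              = 16 * (2 * e / x\<^sup>2) + 4 / x * (y * L) + y * L" for x y e :: real
            by (simp add: field_simps power2_eq_square)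
          then show ?thesis using \<open>real ?n \<noteq> 0\<close> \<open>real N \<noteq> 0\<close> by blast
        qed
        also have "\<dots> \<le> 16 * real ?n + 1 * (real ?n * L) + real ?n * L"
          using dense N1600 L0 Vpos by (intro add_mono mult_left_mono mult_right_mono order_refl)
            (auto simp: divide_simps)
        also have "\<dots> \<le> real (18 * (?n * h\<^sup>2))"
        proof -
          have "1 \<le> L" using h by (simp add: L_def)
          then have "real ?n * 1 \<le> real ?n * L" by (intro mult_left_mono) auto
          then show ?thesis by (simp add: L_def)
        qed
        finally show ?thesis by (simp only: of_nat_le_iff)
      qed
    qed
    moreover have "mpc_outputs ?P lab E (mpc_input lab b r place) \<rho> (one_round_mpc V E b r (\<phi> \<rho>))"
      using run.outputs_correct unfolding \<omega> .
    ultimately show ?thesis ..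
  qed
  ultimately show "\<exists>\<phi> good. \<phi> \<in> measurable tape_space (one_round_space V E b) \<and>
      distr tape_space (one_round_space V E b) \<phi> = one_round_space V E b \<and>
      good \<in> sets tape_space \<and> p \<le> measure tape_space good \<and>
      (\<forall>\<rho>\<in>good. mpc_respects_memory ?P (3 * s0) (?n ^ 2) (mpc_input lab b r place) \<rho> \<and>
        mpc_outputs ?P lab E (mpc_input lab b r place) \<rho> (one_round_mpc V E b r (\<phi> \<rho>)))"
    using phi good by blast
qed

end

text \<open>S = 3 * s0 with s0 = 200 n h^2 and h the ceiling of ln n. As h <= 2 ln n, S is at most
  2400 n (ln n)^2, the origin of C = 2400 and k = 2; w = 2 is for packed pairs. M * s0 is at most n
  + m + s0, so the total memory is linear in m. Records have at most three words, so n + m <= M * (S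
  div 3) guarantees that an admissible placement of the input exists. Only n0 depends on c.\<close>

lemma mpc_program_exists:
  "\<exists>(C::real) (k::nat) (R::nat) (w::nat). \<forall>c::nat. \<exists>n0::nat. \<forall>n\<ge>n0. \<forall>m::nat.
     real n * ln (real n) ^ 10 \<le> real m \<longrightarrow>
     (\<exists>P S. mpc_rounds P \<le> R \<and> real S \<le> C * real n * ln (real n) ^ k \<and>
        real (mpc_machines P * S) \<le> C * real m \<and> n + m \<le> mpc_machines P * (S div 3) \<and>
        (\<forall>V E b r. simple_graph V E \<longrightarrow> card V = n \<longrightarrow> card E = m \<longrightarrow>
           (\<forall>v\<in>V. 0 \<le> b v) \<longrightarrow> (\<forall>e\<in>E. 0 \<le> r e) \<longrightarrow>
           mpc_computes_one_round P S (n ^ w) (1 - 1 / real n ^ c) V E b r))"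
proof (rule exI[of _ 2400], rule exI[of _ 2], rule exI[of _ 8], rule exI[of _ 2], rule allI)
  fix c :: nat
  \<comment> \<open>c + 5 <= ln n turns exp (- (ln n)^2) into at most n^(-c-5); 1600^2 gives N >=
    1600; 5120000 = 8 * 800^2 gives N * s0 < m; 800 gives s0 <= m.\<close>
  have "eventually (\<lambda>n::nat. 3 \<le> n \<and> 1 \<le> ln (real n) \<and> real c + 5 \<le> ln (real n) \<and>
      1600\<^sup>2 \<le> ln (real n) ^ 10 \<and> 5120000 * ln (real n) ^ 4 < ln (real n) ^ 10 \<and> 800 * ln (real n) ^ 2 \<le> ln (real n) ^ 10) at_top"
    by (intro eventually_conj eventually_ge_at_top; real_asymp)
  then obtain n0 :: nat where n0: "\<And>n. n0 \<le> n \<Longrightarrow> 3 \<le> n \<and> 1 \<le> ln (real n) \<and> real c + 5 \<le> ln (real n) \<and>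
      1600\<^sup>2 \<le> ln (real n) ^ 10 \<and> 5120000 * ln (real n) ^ 4 < ln (real n) ^ 10 \<and> 800 * ln (real n) ^ 2 \<le> ln (real n) ^ 10"
    unfolding eventually_at_top_linorder by blast
  show "\<exists>n0::nat. \<forall>n\<ge>n0. \<forall>m::nat. real n * ln (real n) ^ 10 \<le> real m \<longrightarrow>
     (\<exists>P S. mpc_rounds P \<le> 8 \<and> real S \<le> 2400 * real n * ln (real n) ^ 2 \<and>
        real (mpc_machines P * S) \<le> 2400 * real m \<and> n + m \<le> mpc_machines P * (S div 3) \<and>
        (\<forall>V E b r. simple_graph V E \<longrightarrow> card V = n \<longrightarrow> card E = m \<longrightarrow>
           (\<forall>v\<in>V. 0 \<le> b v) \<longrightarrow> (\<forall>e\<in>E. 0 \<le> r e) \<longrightarrow>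
           mpc_computes_one_round P S (n ^ 2) (1 - 1 / real n ^ c) V E b r))"
  proof (intro exI[of _ n0] allI impI)
    fix n m :: nat assume "n0 \<le> n" and dense: "real n * ln (real n) ^ 10 \<le> real m"
    note n = n0[OF \<open>n0 \<le> n\<close>]
    define l where "l = ln (real n)"
    have n3: "3 \<le> n" and l1: "1 \<le> l" and lc: "real c + 5 \<le> l" and l1600: "1600\<^sup>2 \<le> l ^ 10"
      and l4: "5120000 * l ^ 4 < l ^ 10" and l2: "800 * l ^ 2 \<le> l ^ 10"
      using n by (auto simp: l_def)
    have dense': "real n * l ^ 10 \<le> real m" using dense by (simp add: l_def)
    define h where "h = nat \<lceil>l\<rceil>"
    have h: "l \<le> real h" "real h \<le> 2 * l" "1 \<le> h" 
    proof -
      have rh: "real h = of_int \<lceil>l\<rceil>" using l1 by (simp add: h_def)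
      show 1: "l \<le> real h" unfolding rh by linarith
      show "real h \<le> 2 * l" unfolding rh using l1 by linarith
      show "1 \<le> h" using 1 l1 by linarith
    qed
    define s0 where "s0 = 200 * (n * h\<^sup>2)"
    have s0pos: "0 < s0" using n3 h(3) by (simp add: s0_def)
    have s0_le: "real s0 \<le> 800 * real n * l\<^sup>2"
    proof -
      have "(real h)\<^sup>2 \<le> (2 * l)\<^sup>2" using h by (intro power_mono) auto
      then have "real n * (real h)\<^sup>2 \<le> real n * (4 * l\<^sup>2)" by (intro mult_left_mono) (auto simp: power_mult_distrib)
      then show ?thesis by (simp add: s0_def)
    qed
    have s0_m: "real s0 \<le> real m"
    proof -
      have "real n * (800 * l\<^sup>2) \<le> real n * l ^ 10" using l2 by (intro mult_left_mono) auto
      then show ?thesis using s0_le dense' by simp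
    qed
    have n_m: "real n \<le> real m"
    proof -
      have "real n * 1 \<le> real n * l ^ 10" using l1 by (intro mult_left_mono one_le_power) auto
      then show ?thesis using dense' by simp
    qed
    \<comment> \<open>The least number of machines with n + m < M * s0.\<close>
    define M where "M = (n + m) div s0 + 1"
    define N where "N = nat \<lceil>sqrt (2 * real m / real n)\<rceil>"
    define T where "T = nat \<lfloor>log 2 (real N) / 1000\<rfloor>"
    define P where "P = record_mpc M 8 (one_round_program.fresh n M T) (one_round_program.step n m M N T)"
    have M_lower: "n + m \<le> M * s0"
    proof -
      have "n + m < ((n + m) div s0 + 1) * s0" using dividend_less_div_times[OF s0pos, of "n + m"] by simp
      then show ?thesis by (simp add: M_def)
    qed
    have M_upper: "M * s0 \<le> n + m + s0"
      unfolding M_def using div_times_less_eq_dividend[of "n + m" s0] by simp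
    have d1: "1 \<le> 2 * real m / real n" using n_m n3 by (simp add: field_simps)
    have N2: "2 * real m / real n \<le> (real N)\<^sup>2" "(real N)\<^sup>2 \<le> 4 * (2 * real m / real n)"
      unfolding N_def using nat_ceiling_sqrt_bounds[OF d1] by simp_all
    have N1600: "1600 \<le> N"
    proof -
      have "l ^ 10 \<le> real m / real n" using dense' n3 by (simp add: field_simps)
      then have "1600\<^sup>2 \<le> (real N)\<^sup>2" using l1600 N2(1) by simp
      then have "1600 \<le> real N" by (rule power2_le_imp_le) simp
      then show ?thesis by simp
    qed
    \<comment> \<open>Up to constants N^2 is at most m / n and s0 at most n l^2, so (N s0)^2 is of
      order m n l^4, which density puts below m^2.\<close>
    have NM: "N < M"
    proof -
      have "(real N * real s0)\<^sup>2 < (real m)\<^sup>2"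
      proof -
        have "real s0 = 200 * (real n * (real h)\<^sup>2)" by (simp add: s0_def)
        have "(real N * real s0)\<^sup>2 = (real N)\<^sup>2 * (real s0)\<^sup>2" by (simp add: power_mult_distrib)
        also have "\<dots> \<le> (4 * (2 * real m / real n)) * (800 * real n * l\<^sup>2)\<^sup>2"
          using N2(2) s0_le by (intro mult_mono power_mono) auto
        also have "(800 * real n * l\<^sup>2)\<^sup>2 = 640000 * (real n * real n) * l ^ 4"
          by (simp add: power2_eq_square power4_eq_xxxx)
        also have "4 * (2 * real m / real n) * (640000 * (real n * real n) * l ^ 4) = real m * (real n * (5120000 * l ^ 4))"
          using n3 by simp
        also have "\<dots> < real m * (real n * l ^ 10)"
          using l4 n3 n_m by (intro mult_strict_left_mono) auto
        also have "\<dots> \<le> real m * real m" using dense' by (intro mult_left_mono) auto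
        finally show ?thesis by (simp add: power2_eq_square)
      qed
      then have "real N * real s0 < real m" by (rule power2_less_imp_less) simp
      also have "\<dots> \<le> real (M * s0)" using M_lower by linarith
      finally have "real s0 * real N < real s0 * real M" by (simp add: mult.commute)
      then show ?thesis using s0pos by (simp add: mult_less_cancel_left)
    qed
    show "\<exists>P S. mpc_rounds P \<le> 8 \<and> real S \<le> 2400 * real n * ln (real n) ^ 2 \<and>
        real (mpc_machines P * S) \<le> 2400 * real m \<and> n + m \<le> mpc_machines P * (S div 3) \<and>
        (\<forall>V E b r. simple_graph V E \<longrightarrow> card V = n \<longrightarrow> card E = m \<longrightarrow>
           (\<forall>v\<in>V. 0 \<le> b v) \<longrightarrow> (\<forall>e\<in>E. 0 \<le> r e) \<longrightarrow>
           mpc_computes_one_round P S (n ^ 2) (1 - 1 / real n ^ c) V E b r)"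
    proof (intro exI[of _ P] exI[of _ "3 * s0"] conjI allI impI)
      show "mpc_rounds P \<le> 8" by (simp add: P_def record_mpc_def)
      have machines: "mpc_machines P = M" by (simp add: P_def record_mpc_def)
      show "real (3 * s0) \<le> 2400 * real n * ln (real n) ^ 2" using s0_le by (simp add: l_def)
      have "real (M * s0) \<le> real n + real m + real s0" using M_upper by linarith
      then show "real (mpc_machines P * (3 * s0)) \<le> 2400 * real m"
        unfolding machines using n_m s0_m by simp
      show "n + m \<le> mpc_machines P * (3 * s0 div 3)" unfolding machines using M_lower by simp
      fix V E b r
      assume graph: "simple_graph V E" and V: "card V = n" and E: "card E = m"
        and b: "\<forall>v\<in>V. 0 \<le> (b v :: real)" and r: "\<forall>e\<in>E. 0 \<le> (r e :: real)"
      interpret lp_graph V E b r using graph b r by unfold_locales auto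
      have N_eq: "num_parts V E = N" by (simp add: num_parts_def avg_degree_def V E N_def)
      have T_eq: "num_iters V E = T" by (simp add: num_iters_def N_eq T_def)
      have Mn: "M \<le> n"
      proof -
        have "2 * m \<le> n * n" using twice_card_E_le unfolding V E by (metis of_nat_le_iff of_nat_mult of_nat_numeral)
        have "200 * n \<le> s0" using h(3) by (simp add: s0_def)
        have "(n + m) div s0 \<le> (n + m) div (200 * n)"
          using n3 by (intro div_le_mono2 \<open>200 * n \<le> s0\<close>) simp
        also have "\<dots> \<le> (n + n * n) div (200 * n)"
          using \<open>2 * m \<le> n * n\<close> by (intro div_le_mono) simp
        also have "\<dots> = (1 + n) div 200"
        proof -
          have "n + n * n = n * (1 + n)" "200 * n = n * 200" by (simp_all add: algebra_simps)
          then show ?thesis using n3 by (simp only: div_mult_mult1)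
        qed
        finally show ?thesis unfolding M_def using n3 by linarith
      qed
      have TN: "T + 1 \<le> N" using num_iters_bounds(3)[of V E] N1600 by (simp add: N_eq T_eq)
      have T11: "T + 4 \<le> 11 * h\<^sup>2"
      proof -
        have "2 ^ T \<le> real N powr 0.001" using num_iters_bounds(1)[of V E] N1600 by (simp add: N_eq T_eq)
        also have "\<dots> \<le> real N powr 1" using N1600 by (intro powr_mono) auto
        also have "\<dots> \<le> real n" using NM Mn N1600 by simp
        finally have "real T * ln 2 \<le> l" unfolding l_def using n3 by (simp add: ln_realpow[symmetric])
        moreover have "real T * (1 / 2) \<le> real T * ln 2"
          using ln_2_less_1 ln2_ge_two_thirds by (intro mult_left_mono) auto
        ultimately have "real T \<le> 2 * real h" using h(1) by simp
        then have "T \<le> 2 * h" by linarith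
        moreover have "h \<le> h * h" by (cases h) auto
        ultimately show ?thesis unfolding power2_eq_square using h(3) by linarith
      qed
      have Tn: "T + 4 \<le> n ^ 2"
      proof -
        have "3 * n \<le> n * n" using n3 by (intro mult_right_mono) auto
        then show ?thesis unfolding power2_eq_square using TN NM Mn n3 by linarith
      qed
      \<comment> \<open>M and N are at most n, so the union bound has at most n^5 events, each of
        probability at most exp (- h^2) <= n^(-c-5).\<close>
      have prob: "1 - 1 / real n ^ c \<le> 1 - (real (M + 1) * real n + 1) * real N * exp (- (real h)\<^sup>2)"
      proof -
        have "(real (M + 1) * real n + 1) * real N \<le> (real (n + 1) * real n + 1) * real n"
          using Mn NM by (intro mult_mono add_mono) auto
        also have "\<dots> \<le> real n ^ 5"
        proof -
          have "(n + 1) * n + 1 \<le> n ^ 4"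
          proof -
            have sq: "n \<le> n * n" by (cases n) auto
            have "(n + 1) * n + 1 = n * n + n + 1" by (simp add: algebra_simps)
            also have "\<dots> \<le> 3 * (n * n)" using sq n3 by linarith
            also have "\<dots> \<le> (n * n) * (n * n)" using sq n3 by (intro mult_right_mono) linarith+
            finally show ?thesis by (simp add: power4_eq_xxxx)
          qed
          then have "real ((n + 1) * n + 1) \<le> real (n ^ 4)" by (rule of_nat_mono)
          then have "(real (n + 1) * real n + 1) * real n \<le> real n ^ 4 * real n"
            by (intro mult_right_mono) (simp_all add: algebra_simps)
          then show ?thesis using power_Suc2[of "real n" 4] by simp
        qed
        finally have count: "(real (M + 1) * real n + 1) * real N \<le> real n ^ 5" .
        have "real (c + 5) * l \<le> l * l" using lc l1 by (intro mult_right_mono) auto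
        also have "\<dots> \<le> (real h)\<^sup>2" unfolding power2_eq_square using h(1) l1 by (intro mult_mono) auto
        finally have "exp (- (real h)\<^sup>2) \<le> exp (- (real (c + 5) * l))" by simp
        also have "\<dots> = 1 / real n ^ (c + 5)"
        proof -
          have "exp (real (c + 5) * l) = exp l ^ (c + 5)" by (rule exp_of_nat_mult)
          also have "exp l = real n" using n3 by (simp add: l_def)
          finally show ?thesis by (simp only: exp_minus inverse_eq_divide)
        qed
        finally have "(real (M + 1) * real n + 1) * real N * exp (- (real h)\<^sup>2) \<le> real n ^ 5 * (1 / real n ^ (c + 5))"
          using count by (intro mult_mono) auto
        also have "\<dots> = 1 / real n ^ c" using n3 by (simp add: power_add)
        finally show ?thesis by simp
      qed
      have dense2: "2 * real m \<le> real n * (real N)\<^sup>2" using N2(1) n3 by (simp add: field_simps)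
      have "mpc_computes_one_round
        (record_mpc M 8 (one_round_program.fresh (card V) M (num_iters V E))
          (one_round_program.step (card V) (card E) M (num_parts V E) (num_iters V E)))
        (3 * (200 * (card V * h\<^sup>2))) (card V ^ 2) (1 - 1 / real n ^ c) V E b r"
        by (rule computes_one_round) (simp_all only: N_eq T_eq V E N1600 NM Mn h(3) T11 Tn prob dense2)
      then show "mpc_computes_one_round P (3 * s0) (n ^ 2) (1 - 1 / real n ^ c) V E b r"
        by (simp only: P_def s0_def N_eq T_eq V E)
    qed
  qed
qed

theorem theorem3p14:
  shows "(\<exists>n0::nat. \<forall>V E b r.
            simple_graph V E \<longrightarrow> n0 \<le> card V \<longrightarrow>
            real (card V) * ln (real (card V)) ^ 10 \<le> real (card E) \<longrightarrow>
            (\<forall>v\<in>V. 0 \<le> b v) \<longrightarrow> (\<forall>e\<in>E. 0 \<le> r e) \<longrightarrow>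
            (\<forall>\<omega>\<in>space (one_round_space V E b). lp_feasible V E b r (one_round_mpc V E b r \<omega>)) \<and>
            integrable (one_round_space V E b)
              (\<lambda>\<omega>. real (card (E_loose V E b r (one_round_mpc V E b r \<omega>) 0.05)) / real (card V)) \<and>
            (\<integral>\<omega>. real (card (E_loose V E b r (one_round_mpc V E b r \<omega>) 0.05)) / real (card V)
               \<partial>one_round_space V E b)
              \<le> (real (card E) / real (card V)) powr 0.9999)
       \<and> (\<exists>(C::real) (k::nat) (R::nat) (w::nat). \<forall>c::nat. \<exists>n0::nat. \<forall>n\<ge>n0. \<forall>m::nat.
            real n * ln (real n) ^ 10 \<le> real m \<longrightarrow>
            (\<exists>P S. mpc_rounds P \<le> R \<and>
               real S \<le> C * real n * ln (real n) ^ k \<and>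
               real (mpc_machines P * S) \<le> C * real m \<and>
               n + m \<le> mpc_machines P * (S div 3) \<and>
               (\<forall>V E b r. simple_graph V E \<longrightarrow> card V = n \<longrightarrow> card E = m \<longrightarrow>
                  (\<forall>v\<in>V. 0 \<le> b v) \<longrightarrow> (\<forall>e\<in>E. 0 \<le> r e) \<longrightarrow>
                  mpc_computes_one_round P S (n ^ w) (1 - 1 / real n ^ c) V E b r)))"
proof (rule conjI[OF _ mpc_program_exists])
  obtain n0 :: nat where n0: "\<forall>V E b r. simple_graph V E \<longrightarrow> n0 \<le> card V \<longrightarrow>
     real (card V) * ln (real (card V)) ^ 10 \<le> real (card E) \<longrightarrow>
     (\<forall>v\<in>V. 0 \<le> b v) \<longrightarrow> (\<forall>e\<in>E. 0 \<le> r e) \<longrightarrow>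
     (\<integral>\<omega>. real (card (E_loose V E b r (one_round_mpc V E b r \<omega>) 0.05)) / real (card V)
        \<partial>one_round_space V E b) \<le> (real (card E) / real (card V)) powr 0.9999"
    using expected_loose_asymptotic by blast
  show "\<exists>n0::nat. \<forall>V E b r.
            simple_graph V E \<longrightarrow> n0 \<le> card V \<longrightarrow>
            real (card V) * ln (real (card V)) ^ 10 \<le> real (card E) \<longrightarrow>
            (\<forall>v\<in>V. 0 \<le> b v) \<longrightarrow> (\<forall>e\<in>E. 0 \<le> r e) \<longrightarrow>
            (\<forall>\<omega>\<in>space (one_round_space V E b). lp_feasible V E b r (one_round_mpc V E b r \<omega>)) \<and>
            integrable (one_round_space V E b)
              (\<lambda>\<omega>. real (card (E_loose V E b r (one_round_mpc V E b r \<omega>) 0.05)) / real (card V)) \<and>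
            (\<integral>\<omega>. real (card (E_loose V E b r (one_round_mpc V E b r \<omega>) 0.05)) / real (card V)
               \<partial>one_round_space V E b)
              \<le> (real (card E) / real (card V)) powr 0.9999"
  proof (intro exI[of _ n0] allI impI)
    fix V E b r
    assume graph: "simple_graph V E" and n: "n0 \<le> card V"
      and dense: "real (card V) * ln (real (card V)) ^ 10 \<le> real (card E)"
      and b: "\<forall>v\<in>V. 0 \<le> (b v :: real)" and r: "\<forall>e\<in>E. 0 \<le> (r e :: real)"
    interpret lp_graph V E b r using graph b r by unfold_locales auto
    show "(\<forall>\<omega>\<in>space (one_round_space V E b). lp_feasible V E b r (one_round_mpc V E b r \<omega>)) \<and>
      integrable (one_round_space V E b)
        (\<lambda>\<omega>. real (card (E_loose V E b r (one_round_mpc V E b r \<omega>) 0.05)) / real (card V)) \<and>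
      (\<integral>\<omega>. real (card (E_loose V E b r (one_round_mpc V E b r \<omega>) 0.05)) / real (card V)
         \<partial>one_round_space V E b) \<le> (real (card E) / real (card V)) powr 0.9999"
      using one_round_mpc_feasible integrable_loose n0 graph n dense b r by blast
  qed
qed

end
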